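(* Let $d\geq 2$ be an integer and let $0<c<1$. There exists a constant $C=C(d,c)>0$ such that for every integer $n\geq 1$, $$\mathbb{E}_n\, d(x_0,x_n) > Cn,$$ where $(x_0,x_1,\ldots,x_n)$ is the $n$-step continuous self-avoiding walk on $\mathbb{H}^d$ with exclusion distance $c$, and $\mathbb{E}_n$ is the expectation with respect to its law $\mathbb{P}_n$.
   Context: $\mathbb{H}^d$ denotes $d$-dimensional hyperbolic space (constant curvature $-1$), and $d(\cdot,\cdot)$ denotes its distance function (the letter $d$ is also used for the dimension). Consider the continuous $n$-step random walk $x_0,x_1,\ldots,x_n$ on $\mathbb{H}^d$, started at a fixed point $x_0$, where, for each $k$, the next vertex $x_{k+1}$ is chosen uniformly (with respect to the normalized rotation-invariant measure), and independently of the previous steps, on the sphere of radius $1$ centred at $x_k$. Let $\mathbb{P}_n$ be the law of this walk conditioned on the event that $d(x_i,x_j)>c$ for all $0\leq i<j\leq n$, where $0<c<1$ is fixed. $\mathbb{P}_n$ is called the SAW (self-avoiding walk) measure, and $\mathbb{E}_n$ denotes expectation with respect to $\mathbb{P}_n$. *)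

theory Defs
  imports "HOL-Probability.Probability"
begin

section \<open>Hyperbolic space: the hyperboloid model\<close>

text \<open>The negative of the Lorentz form on \<open>\<real> \<times> \<real>\<^sup>d\<close>; on the hyperboloid it equals \<open>cosh\<close> of the
  distance.\<close>

definition lorentz :: "real \<times> (real^'d) \<Rightarrow> real \<times> (real^'d) \<Rightarrow> real" where
  "lorentz p q = fst p * fst q - snd p \<bullet> snd q"

typedef ('d::finite) hyperbolic = "{p :: real \<times> (real^'d). lorentz p p = 1 \<and> fst p > 0}"
  morphisms coords Abs_hyperbolic
proof
  show "(1, 0) \<in> {p :: real \<times> (real^'d). lorentz p p = 1 \<and> fst p > 0}"
    by (simp add: lorentz_def)
qed

abbreviation tcoord :: "'d::finite hyperbolic \<Rightarrow> real" where "tcoord p \<equiv> fst (coords p)"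
abbreviation xcoord :: "'d::finite hyperbolic \<Rightarrow> real^'d" where "xcoord p \<equiv> snd (coords p)"

lemma tcoord_pos: "tcoord p > 0"
  using coords[of p] by simp

lemma tcoord_square: "(tcoord p)\<^sup>2 = 1 + xcoord p \<bullet> xcoord p"
  using coords[of p] by (simp add: lorentz_def power2_eq_square)

lemma tcoord_eq: "tcoord p = sqrt (1 + xcoord p \<bullet> xcoord p)"
  using tcoord_square[of p] tcoord_pos[of p] by (metis real_sqrt_unique less_imp_le)

lemma hyperbolic_eqI: "xcoord p = xcoord q \<Longrightarrow> p = q"
  by (metis tcoord_eq coords_inject prod.collapse)

lemma norm_xcoord_less: "norm (xcoord p) < tcoord p"
  unfolding tcoord_eq norm_eq_sqrt_inner by simp

lemma lorentz_pos: "lorentz (coords p) (coords q) > 0"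
proof -
  have "xcoord p \<bullet> xcoord q \<le> norm (xcoord p) * norm (xcoord q)"
    by (rule norm_cauchy_schwarz)
  also have "\<dots> < tcoord p * tcoord q"
    by (intro mult_strict_mono norm_xcoord_less tcoord_pos) auto
  finally show ?thesis by (simp add: lorentz_def)
qed

text \<open>The tangent space at \<open>q\<close> is the \<open>lorentz\<close>-orthogonal complement of \<open>q\<close>; there the negative of
  \<open>lorentz\<close> is positive semidefinite.\<close>

lemma lorentz_tangent_nonpos:
  assumes "lorentz u (coords q) = 0"
  shows "lorentz u u \<le> 0"
proof -
  have "(fst u * tcoord q)\<^sup>2 = (snd u \<bullet> xcoord q)\<^sup>2"
    using assms by (simp add: lorentz_def)
  also have "\<dots> \<le> (snd u \<bullet> snd u) * (xcoord q \<bullet> xcoord q)"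
    by (rule Cauchy_Schwarz_ineq)
  also have "\<dots> \<le> (snd u \<bullet> snd u) * (tcoord q)\<^sup>2"
    by (intro mult_left_mono) (auto simp: tcoord_square)
  finally have "(fst u)\<^sup>2 * (tcoord q)\<^sup>2 \<le> (snd u \<bullet> snd u) * (tcoord q)\<^sup>2"
    by (simp add: power_mult_distrib)
  then have "(fst u)\<^sup>2 \<le> snd u \<bullet> snd u"
    using tcoord_pos[of q] by (simp add: mult_le_cancel_right)
  then show ?thesis by (simp add: lorentz_def power2_eq_square)
qed

lemma lorentz_algebra:
  "lorentz (p + q) r = lorentz p r + lorentz q r"
  "lorentz r (p + q) = lorentz r p + lorentz r q"
  "lorentz (p - q) r = lorentz p r - lorentz q r"
  "lorentz r (p - q) = lorentz r p - lorentz r q"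
  "lorentz (c *\<^sub>R p) r = c * lorentz p r"
  "lorentz r (c *\<^sub>R p) = c * lorentz r p"
  by (simp_all add: lorentz_def algebra_simps inner_add_left inner_add_right
      inner_diff_left inner_diff_right)

lemma lorentz_commute: "lorentz p q = lorentz q p"
  by (simp add: lorentz_def inner_commute mult.commute)

lemma lorentz_tangent_CS:
  assumes u: "lorentz u (coords q) = 0" and w: "lorentz w (coords q) = 0"
  shows "(lorentz u w)\<^sup>2 \<le> lorentz u u * lorentz w w"
proof -
  define a b c where "a = - lorentz u u" and "b = - lorentz u w" and "c = - lorentz w w"
  have *: "0 \<le> s\<^sup>2 * a + 2 * s * t * b + t\<^sup>2 * c" for s t
  proof -
    have "lorentz (s *\<^sub>R u + t *\<^sub>R w) (s *\<^sub>R u + t *\<^sub>R w) \<le> 0"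
      by (rule lorentz_tangent_nonpos[of _ q]) (simp add: lorentz_algebra u w)
    then show ?thesis
      by (simp add: lorentz_algebra a_def b_def c_def lorentz_commute[of w u]
          power2_eq_square algebra_simps)
  qed
  have a0: "0 \<le> a" and c0: "0 \<le> c" using *[of 1 0] *[of 0 1] by auto
  have "b\<^sup>2 \<le> a * c"
  proof (cases "c = 0")
    case True
    have "b = 0"
    proof (rule ccontr)
      assume "b \<noteq> 0"
      then show False using *[of 1 "-(a+1)/(2*b)"] True a0 by (simp add: field_simps)
    qed
    with True show ?thesis by simp
  next
    case False
    with c0 have "c > 0" by simp
    have "0 \<le> c * (c * a - b\<^sup>2)"
      using *[of c "-b"] by (simp add: power2_eq_square algebra_simps)
    with \<open>c > 0\<close> show ?thesis by (simp add: zero_le_mult_iff mult.commute)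
  qed
  then show ?thesis by (simp add: a_def b_def c_def)
qed

lemma lorentz_self [simp]: "lorentz (coords p) (coords p) = 1"
  using coords[of p] by simp

lemma lorentz_ge_1: "lorentz (coords p) (coords q) \<ge> 1"
proof -
  let ?a = "lorentz (coords p) (coords q)"
  have "lorentz (coords p - ?a *\<^sub>R coords q) (coords p - ?a *\<^sub>R coords q) \<le> 0"
    by (rule lorentz_tangent_nonpos[of _ q]) (simp add: lorentz_algebra)
  then have "1 \<le> ?a\<^sup>2"
    by (simp add: lorentz_algebra lorentz_commute[of "coords q" "coords p"] power2_eq_square)
  with lorentz_pos[of p q] show ?thesis
    by (metis abs_of_pos one_power2 power2_le_iff_abs_le abs_le_square_iff abs_1)
qed

lemma lorentz_triangle:
  "lorentz (coords p) (coords r) \<le>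
     lorentz (coords p) (coords q) * lorentz (coords q) (coords r)
     + sqrt ((lorentz (coords p) (coords q))\<^sup>2 - 1) * sqrt ((lorentz (coords q) (coords r))\<^sup>2 - 1)"
proof -
  let ?a = "lorentz (coords p) (coords q)" and ?b = "lorentz (coords q) (coords r)"
  let ?c = "lorentz (coords p) (coords r)"
  let ?u = "coords p - ?a *\<^sub>R coords q" and ?w = "coords r - ?b *\<^sub>R coords q"
  have uu: "lorentz ?u ?u = 1 - ?a\<^sup>2" and ww: "lorentz ?w ?w = 1 - ?b\<^sup>2"
    and uw: "lorentz ?u ?w = ?c - ?a * ?b"
    by (simp_all add: lorentz_algebra lorentz_commute[of "coords q" "coords p"]
        lorentz_commute[of "coords r" "coords q"] power2_eq_square)
  have "(lorentz ?u ?w)\<^sup>2 \<le> lorentz ?u ?u * lorentz ?w ?w"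
    by (rule lorentz_tangent_CS[of _ q])
       (simp_all add: lorentz_algebra lorentz_commute[of "coords r" "coords q"])
  then have "(?c - ?a * ?b)\<^sup>2 \<le> (?a\<^sup>2 - 1) * (?b\<^sup>2 - 1)"
    unfolding uu ww uw by (simp add: algebra_simps)
  then have "\<bar>?c - ?a * ?b\<bar> \<le> sqrt ((?a\<^sup>2 - 1) * (?b\<^sup>2 - 1))"
    by (metis real_sqrt_abs real_sqrt_le_mono)
  then show ?thesis by (simp add: real_sqrt_mult)
qed

instantiation hyperbolic :: (finite) metric_space
begin

definition dist_hyperbolic :: "'a hyperbolic \<Rightarrow> 'a hyperbolic \<Rightarrow> real" where
  "dist_hyperbolic p q = arcosh (lorentz (coords p) (coords q))"

definition uniformity_hyperbolic :: "('a hyperbolic \<times> 'a hyperbolic) filter" where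
  "uniformity_hyperbolic = (INF e\<in>{0<..}. principal {(x, y). dist x y < e})"

definition open_hyperbolic :: "'a hyperbolic set \<Rightarrow> bool" where
  "open_hyperbolic U = (\<forall>x\<in>U. eventually (\<lambda>(x', y). x' = x \<longrightarrow> y \<in> U) uniformity)"

instance
proof
  fix p q r :: "'a hyperbolic"
  show "dist p q = 0 \<longleftrightarrow> p = q"
  proof
    assume "dist p q = 0"
    then have a: "lorentz (coords p) (coords q) = 1"
      using lorentz_ge_1[of p q] by (simp add: dist_hyperbolic_def)
    define u where "u = coords p - coords q"
    have 0: "lorentz u (coords q) = 0" and uu: "lorentz u u = 0"
      by (simp_all add: u_def lorentz_algebra a lorentz_commute[of "coords q" "coords p"])
    have st: "(fst u)\<^sup>2 = snd u \<bullet> snd u"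
      using uu by (simp add: lorentz_def power2_eq_square)
    have "(fst u * tcoord q)\<^sup>2 = (snd u \<bullet> xcoord q)\<^sup>2"
      using 0 by (simp add: lorentz_def)
    also have "\<dots> \<le> (snd u \<bullet> snd u) * (xcoord q \<bullet> xcoord q)"
      by (rule Cauchy_Schwarz_ineq)
    finally have "snd u \<bullet> snd u \<le> 0"
      by (simp add: power_mult_distrib st tcoord_square algebra_simps)
    then have "snd u = 0" by (metis inner_gt_zero_iff not_less)
    then show "p = q" by (intro hyperbolic_eqI) (simp add: u_def)
  qed (simp add: dist_hyperbolic_def)
  show "dist p q \<le> dist p r + dist q r"
  proof -
    let ?a = "dist p r" and ?b = "dist q r"
    have nn: "?a \<ge> 0" "?b \<ge> 0" by (simp_all add: dist_hyperbolic_def lorentz_ge_1)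
    have "lorentz (coords p) (coords q) \<le> cosh (?a + ?b)"
      using lorentz_triangle[of p q r]
      by (simp add: cosh_add dist_hyperbolic_def lorentz_ge_1 sinh_arcosh_real
          lorentz_commute[of "coords r" "coords q"])
    then have "cosh (dist p q) \<le> cosh (?a + ?b)"
      by (simp add: dist_hyperbolic_def lorentz_ge_1)
    moreover have "dist p q \<ge> 0" by (simp add: dist_hyperbolic_def lorentz_ge_1)
    ultimately show ?thesis
      using nn cosh_real_nonneg_le_iff[of "dist p q" "?a + ?b"] by simp
  qed
qed (rule uniformity_hyperbolic_def open_hyperbolic_def)+

end

lemma cosh_dist: "cosh (dist p q) = lorentz (coords p) (coords q)"
  by (simp add: dist_hyperbolic_def lorentz_ge_1)

lemma dist_eq_iff_lorentz:
  "dist p q = dist p' q' \<longleftrightarrow> lorentz (coords p) (coords q) = lorentz (coords p') (coords q')"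
  by (metis cosh_dist dist_hyperbolic_def)

subsection \<open>The coordinate homeomorphism with \<open>\<real>\<^sup>d\<close>\<close>

definition hlift :: "real^'d \<Rightarrow> ('d::finite) hyperbolic" where
  "hlift x = Abs_hyperbolic (sqrt (1 + x \<bullet> x), x)"

lemma coords_hlift: "coords (hlift x) = (sqrt (1 + x \<bullet> x), x)"
proof -
  have "0 < 1 + x \<bullet> x" using inner_ge_zero[of x] by linarith
  then show ?thesis unfolding hlift_def
    by (subst Abs_hyperbolic_inverse) (simp_all add: lorentz_def flip: power2_eq_square)
qed

lemma xcoord_hlift [simp]: "xcoord (hlift x) = x"
  by (simp add: coords_hlift)

lemma hlift_xcoord [simp]: "hlift (xcoord p) = p"
  by (rule hyperbolic_eqI) simp

lemma isCont_hlift: "isCont hlift x"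
proof -
  have "((\<lambda>y. lorentz (coords (hlift y)) (coords (hlift x))) \<longlongrightarrow>
      lorentz (coords (hlift x)) (coords (hlift x))) (at x)"
    unfolding lorentz_def coords_hlift fst_conv snd_conv by (intro tendsto_intros)
  then have "((\<lambda>y. arcosh (lorentz (coords (hlift y)) (coords (hlift x)))) \<longlongrightarrow> arcosh 1) (at x)"
    by (intro tendsto_arcosh_strong) (auto simp: lorentz_ge_1)
  then show ?thesis
    unfolding isCont_def by (subst tendsto_dist_iff) (simp add: dist_hyperbolic_def)
qed

lemma continuous_on_hlift: "continuous_on A hlift"
  by (simp add: continuous_at_imp_continuous_on isCont_hlift)

lemma tcoord_eq_cosh: "tcoord p = cosh (dist (hlift 0) p)"
  unfolding cosh_dist by (simp add: lorentz_def coords_hlift)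

lemma isCont_tcoord: "isCont tcoord p"
  unfolding tcoord_eq_cosh by (intro continuous_intros)

lemma isCont_xcoord: "isCont xcoord p"
proof -
  let ?L = "\<lambda>q. lorentz (coords q) (coords p)"
  have L: "(?L \<longlongrightarrow> 1) (at p)"
  proof -
    have "((\<lambda>q. cosh (dist q p)) \<longlongrightarrow> cosh (dist p p)) (at p)"
      by (intro tendsto_intros)
    then show ?thesis by (simp add: cosh_dist)
  qed
  have "(norm (xcoord q - xcoord p))\<^sup>2 = (tcoord q - tcoord p)\<^sup>2 + 2 * (?L q - 1)" for q
    unfolding power2_norm_eq_inner lorentz_def
    using tcoord_square[of p] tcoord_square[of q]
    by (simp add: inner_diff_left inner_diff_right inner_commute power2_eq_square algebra_simps)
  then have eq: "dist (xcoord q) (xcoord p) = sqrt ((tcoord q - tcoord p)\<^sup>2 + 2 * (?L q - 1))" for q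
    by (metis dist_norm norm_ge_zero real_sqrt_unique)
  have "((\<lambda>q. dist (xcoord q) (xcoord p)) \<longlongrightarrow> sqrt ((tcoord p - tcoord p)\<^sup>2 + 2 * (1 - 1))) (at p)"
    unfolding eq by (intro tendsto_intros L isCont_tcoord[unfolded isCont_def])
  then show ?thesis
    unfolding isCont_def by (subst tendsto_dist_iff) simp
qed

lemma continuous_on_xcoord: "continuous_on A xcoord"
  by (simp add: continuous_at_imp_continuous_on isCont_xcoord)

instance hyperbolic :: (finite) second_countable_topology
proof
  obtain B :: "(real^'a) set set" where B: "countable B" "topological_basis B"
    using ex_countable_basis by blast
  let ?B = "(\<lambda>U. hlift ` U) ` B"
  have im: "hlift ` U = xcoord -` U" for U :: "(real^'a) set"
    by (auto simp: image_iff) (metis hlift_xcoord)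
  have "topological_basis ?B"
  proof (rule topological_basisI)
    fix U' assume "U' \<in> ?B"
    then show "open U'"
      using B(2) continuous_on_xcoord[of UNIV]
      by (auto simp: im intro!: open_vimage intro: topological_basis_open)
  next
    fix O' and p :: "'a hyperbolic" assume O: "open O'" "p \<in> O'"
    have "open (hlift -` O')" using O(1) continuous_on_hlift[of UNIV] by (rule open_vimage)
    moreover have "xcoord p \<in> hlift -` O'" using O(2) by simp
    ultimately obtain U where "U \<in> B" "xcoord p \<in> U" "U \<subseteq> hlift -` O'"
      using B(2) by (meson topological_basisE)
    then show "\<exists>B'\<in>?B. p \<in> B' \<and> B' \<subseteq> O'"
      by (intro bexI[of _ "hlift ` U"]) (auto simp: im)
  qed
  then show "\<exists>B::'a hyperbolic set set. countable B \<and> open = generate_topology B"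
    using B(1) by (metis countable_image topological_basis_imp_subbasis)
qed

subsection \<open>Isometries\<close>

definition isometry_fixing :: "'d::finite hyperbolic \<Rightarrow> ('d hyperbolic \<Rightarrow> 'd hyperbolic) \<Rightarrow> bool" where
  "isometry_fixing p f \<longleftrightarrow> (\<forall>x y. dist (f x) (f y) = dist x y) \<and> f p = p"

text \<open>The Lorentz boost taking the origin \<open>hlift 0\<close> to \<open>p\<close>.\<close>

definition boost :: "'d::finite hyperbolic \<Rightarrow> 'd hyperbolic \<Rightarrow> 'd hyperbolic" where
  "boost p q = hlift (xcoord q + (tcoord q + (xcoord p \<bullet> xcoord q) / (1 + tcoord p)) *\<^sub>R xcoord p)"

definition reflect :: "'d::finite hyperbolic \<Rightarrow> 'd hyperbolic" where
  "reflect p = hlift (- xcoord p)"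

lemma coords_reflect [simp]: "xcoord (reflect p) = - xcoord p" "tcoord (reflect p) = tcoord p"
  by (simp_all add: reflect_def tcoord_eq)

lemma xcoord_boost:
  "xcoord (boost p q) = xcoord q + (tcoord q + (xcoord p \<bullet> xcoord q) / (1 + tcoord p)) *\<^sub>R xcoord p"
  by (simp add: boost_def)

lemma boost_inner:
  "xcoord (boost p q) \<bullet> xcoord (boost p q') =
    (tcoord p * tcoord q + xcoord p \<bullet> xcoord q) * (tcoord p * tcoord q' + xcoord p \<bullet> xcoord q')
    - tcoord q * tcoord q' + xcoord q \<bullet> xcoord q'"
proof -
  define t s s' a a' where "t = tcoord p" and "s = tcoord q" and "s' = tcoord q'"
    and "a = xcoord p \<bullet> xcoord q" and "a' = xcoord p \<bullet> xcoord q'"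
  have t: "t > 0" by (simp add: t_def tcoord_pos)
  have xx: "xcoord p \<bullet> xcoord p = (t + 1) * (t - 1)"
    using tcoord_square[of p] by (simp add: t_def power2_eq_square algebra_simps)
  have "xcoord (boost p q) \<bullet> xcoord (boost p q') =
      xcoord q \<bullet> xcoord q' + (s' + a' / (1 + t)) * a + (s + a / (1 + t)) * a'
      + (s + a / (1 + t)) * (s' + a' / (1 + t)) * ((t + 1) * (t - 1))"
    unfolding xcoord_boost xx[symmetric]
    by (simp add: inner_add_left inner_add_right inner_commute s_def s'_def a_def a'_def t_def
        algebra_simps)
  also have "\<dots> = (t * s + a) * (t * s' + a') - s * s' + xcoord q \<bullet> xcoord q'"
    using t by (simp add: divide_simps) algebra
  finally show ?thesis by (simp add: t_def s_def s'_def a_def a'_def)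
qed

lemma tcoord_boost: "tcoord (boost p q) = tcoord p * tcoord q + xcoord p \<bullet> xcoord q"
proof -
  have "(tcoord (boost p q))\<^sup>2 = (tcoord p * tcoord q + xcoord p \<bullet> xcoord q)\<^sup>2"
    unfolding tcoord_square[of "boost p q"] boost_inner
    using tcoord_square[of q] by (simp add: power2_eq_square)
  moreover have "tcoord p * tcoord q + xcoord p \<bullet> xcoord q > 0"
    using lorentz_pos[of "reflect p" q] by (simp add: lorentz_def)
  ultimately show ?thesis
    using tcoord_pos[of "boost p q"] by (simp add: power2_eq_iff_nonneg)
qed

lemma dist_boost [simp]: "dist (boost p q) (boost p q') = dist q q'"
  unfolding dist_eq_iff_lorentz lorentz_def tcoord_boost boost_inner by simp

lemma boost_origin [simp]: "boost p (hlift 0) = p"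
  by (rule hyperbolic_eqI) (simp add: xcoord_boost coords_hlift)

lemma boost_reflect [simp]: "boost p (boost (reflect p) q) = q"
proof (rule hyperbolic_eqI)
  define t s a where "t = tcoord p" and "s = tcoord q" and "a = xcoord p \<bullet> xcoord q"
  have t: "t > 0" by (simp add: t_def tcoord_pos)
  have xx: "xcoord p \<bullet> xcoord p = (t + 1) * (t - 1)"
    using tcoord_square[of p] by (simp add: t_def power2_eq_square algebra_simps)
  define k where "k = s - a / (1 + t)"
  have x: "xcoord (boost (reflect p) q) = xcoord q - k *\<^sub>R xcoord p"
    by (simp add: xcoord_boost k_def t_def s_def a_def)
  have "tcoord (boost (reflect p) q) = t * s - a"
    by (simp add: tcoord_boost t_def s_def a_def)
  then have "xcoord (boost p (boost (reflect p) q)) =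
      xcoord q - k *\<^sub>R xcoord p + (t * s - a + (a - k * ((t + 1) * (t - 1))) / (1 + t)) *\<^sub>R xcoord p"
    unfolding xcoord_boost[of p] x by (simp add: inner_diff_right xx a_def t_def)
  moreover have "t * s - a + (a - k * ((t + 1) * (t - 1))) / (1 + t) = k"
    using t unfolding k_def by (simp add: divide_simps) algebra
  ultimately show "xcoord (boost p (boost (reflect p) q)) = xcoord q" by simp
qed

lemma reflect_reflect [simp]: "reflect (reflect p) = p"
  by (rule hyperbolic_eqI) simp

lemma boost_reflect' [simp]: "boost (reflect p) (boost p q) = q"
  using boost_reflect[of "reflect p" q] by simp

lemma boost_reflect_self [simp]: "boost (reflect p) p = hlift 0"
  using boost_reflect'[of p "hlift 0"] by simp

text \<open>The isometries fixing the origin are the orthogonal maps of \<open>\<real>\<^sup>d\<close>.\<close>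

lemma isometry_fixing_origin:
  assumes "isometry_fixing (hlift 0) g"
  obtains G where "orthogonal_transformation G" "\<And>x. g (hlift x) = hlift (G x)"
proof -
  define G where "G x = xcoord (g (hlift x))" for x
  have g: "g (hlift x) = hlift (G x)" for x by (simp add: G_def)
  have d: "dist (g x) (g y) = dist x y" and o: "g (hlift 0) = hlift 0" for x y
    using assms by (auto simp: isometry_fixing_def)
  have t: "tcoord (g x) = tcoord x" for x
    using d[of "hlift 0" x] unfolding tcoord_eq_cosh by (simp add: o)
  have ip: "G x \<bullet> G y = x \<bullet> y" for x y
    using d[of "hlift x" "hlift y"] unfolding dist_eq_iff_lorentz
    by (simp add: lorentz_def t G_def)
  have "(norm (G x - G y))\<^sup>2 = (norm (x - y))\<^sup>2" for x y
    by (simp add: power2_norm_eq_inner inner_diff_left inner_diff_right ip)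
  then have "dist (G x) (G y) = dist x y" for x y
    by (simp add: dist_norm)
  moreover have "G 0 = 0" by (simp add: G_def o)
  ultimately have "orthogonal_transformation G"
    by (simp add: orthogonal_transformation_isometry)
  with g show thesis by (rule that[rotated]) 
qed

lemma orthogonal_isometry:
  assumes G: "orthogonal_transformation G"
  shows "isometry_fixing (hlift 0) (\<lambda>p. hlift (G (xcoord p)))"
  using assms unfolding isometry_fixing_def dist_eq_iff_lorentz lorentz_def coords_hlift
  by (simp add: orthogonal_transformation_def linear_0 tcoord_eq)

lemma isometry_fixing_transitive:
  fixes p :: "'d::finite hyperbolic"
  assumes "dist p x = dist p y"
  obtains f where "isometry_fixing p f" "f x = y"
proof -
  let ?b = "boost (reflect p)"
  have "dist (hlift 0) (?b x) = dist (hlift 0) (?b y)"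
    using assms by (metis boost_reflect_self dist_boost)
  then have "tcoord (?b x) = tcoord (?b y)" by (simp add: tcoord_eq_cosh)
  then have "norm (xcoord (?b x)) = norm (xcoord (?b y))"
    by (simp add: tcoord_eq norm_eq_sqrt_inner)
  then obtain G where G: "orthogonal_transformation G" "G (xcoord (?b x)) = xcoord (?b y)"
    by (rule orthogonal_transformation_exists)
  let ?g = "\<lambda>p. hlift (G (xcoord p))"
  have g: "isometry_fixing (hlift 0) ?g" by (rule orthogonal_isometry) fact
  let ?f = "\<lambda>q. boost p (?g (?b q))"
  have "isometry_fixing p ?f" using g by (simp add: isometry_fixing_def)
  moreover have "?f x = y" by (simp add: G)
  ultimately show thesis by (rule that)
qed

lemma isometry_continuous: "isometry_fixing p f \<Longrightarrow> continuous_on A f"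
  unfolding isometry_fixing_def continuous_on_iff by metis

lemma isometry_measurable: "isometry_fixing p f \<Longrightarrow> f \<in> borel_measurable borel"
  by (intro borel_measurable_continuous_onI isometry_continuous)

section \<open>The uniform measure on a unit sphere\<close>

text \<open>The rotations about \<open>p\<close> are the isometries fixing \<open>p\<close> (orientation-reversing ones included).
  A distance-preserving self-map of hyperbolic space is automatically bijective.\<close>

definition uniform_on_unit_sphere :: "'d::finite hyperbolic \<Rightarrow> 'd hyperbolic measure \<Rightarrow> bool" where
  "uniform_on_unit_sphere p M \<longleftrightarrow>
     prob_space M \<and> sets M = sets borel \<and> (AE q in M. q \<in> sphere p 1) \<and>
     (\<forall>f. isometry_fixing p f \<longrightarrow> distr M borel f = M)"

text \<open>The description is well-defined: see \<open>unit_sphere_measure_iff\<close> below.\<close>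

definition unit_sphere_measure :: "'d::finite hyperbolic \<Rightarrow> 'd hyperbolic measure" where
  "unit_sphere_measure p = (THE M. uniform_on_unit_sphere p M)"

subsection \<open>Uniqueness\<close>

lemma uniform_on_unit_sphere_ball:
  assumes M: "uniform_on_unit_sphere p M" and x: "x \<in> sphere p 1" and y: "y \<in> sphere p 1"
  shows "emeasure M (ball x r) = emeasure M (ball y r)"
proof -
  obtain f where f: "isometry_fixing p f" "f x = y"
    using isometry_fixing_transitive[of p x y] x y by auto
  have [simp]: "sets M = sets borel" and "distr M borel f = M"
    using M f(1) by (auto simp: uniform_on_unit_sphere_def)
  then have "emeasure M (ball y r) = emeasure (distr M borel f) (ball y r)" by simp
  also have "\<dots> = emeasure M (f -` ball y r \<inter> space M)"
    using isometry_measurable[OF f(1)]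
    by (intro emeasure_distr) (auto simp: measurable_cong_sets[of M borel borel borel])
  also have "f -` ball y r \<inter> space M = ball x r"
    using f by (auto simp: isometry_fixing_def sets_eq_imp_space_eq[of M borel])
  finally show ?thesis ..
qed

text \<open>If \<open>M\<close> and \<open>N\<close> are both uniform, double integration of \<open>dist x y < r\<close> shows that their
  balls of radius \<open>r\<close> centred on the sphere have the same mass, and Fatou's lemma as \<open>r\<close> tends to 0
  compares them on open sets.\<close>

lemma uniform_on_unit_sphere_le:
  assumes M: "uniform_on_unit_sphere p M" and N: "uniform_on_unit_sphere p N" and "open U"
  shows "emeasure M U \<le> emeasure N U"
proof -
  have sM [measurable_cong, simp]: "sets M = sets borel"
    and sN [measurable_cong, simp]: "sets N = sets borel"
    and aeM: "AE q in M. q \<in> sphere p 1" and aeN: "AE q in N. q \<in> sphere p 1"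
    using M N by (auto simp: uniform_on_unit_sphere_def)
  have spM [simp]: "space M = UNIV" and spN [simp]: "space N = UNIV"
    by (simp_all add: sets_eq_imp_space_eq[OF sM] sets_eq_imp_space_eq[OF sN])
  interpret M: prob_space M using M by (simp add: uniform_on_unit_sphere_def)
  interpret N: prob_space N using N by (simp add: uniform_on_unit_sphere_def)
  interpret NM: pair_prob_space N M ..
  obtain z where z: "z \<in> sphere p 1"
    using M.AE_contr aeM by auto
  define h where "h r = emeasure N (ball z r)" for r
  have meas: "(\<lambda>(y, x). indicator V y * indicator {y. dist x y < r} y :: ennreal)
      \<in> borel_measurable (N \<Otimes>\<^sub>M M)" if [measurable]: "V \<in> sets borel" for V r
    by (measurable)
  have Nball: "(\<integral>\<^sup>+ y. indicator V y * indicator {y. dist x y < r} y \<partial>N) = emeasure N (V \<inter> ball x r)"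
    if "V \<in> sets borel" for V x r
  proof -
    have "(\<integral>\<^sup>+ y. indicator V y * indicator {y. dist x y < r} y \<partial>N) = (\<integral>\<^sup>+ y. indicator (V \<inter> ball x r) y \<partial>N)"
      by (intro nn_integral_cong) (auto split: split_indicator)
    then show ?thesis using that by simp
  qed
  have swap: "(\<integral>\<^sup>+ x. emeasure N (V \<inter> ball x r) \<partial>M) = emeasure M (ball z r) * emeasure N V"
    if V [measurable]: "V \<in> sets borel" for V r
  proof -
    have "(\<integral>\<^sup>+ x. emeasure N (V \<inter> ball x r) \<partial>M) =
        (\<integral>\<^sup>+ x. (\<integral>\<^sup>+ y. indicator V y * indicator {y. dist x y < r} y \<partial>N) \<partial>M)"
      using V by (simp add: Nball)
    also have "\<dots> = (\<integral>\<^sup>+ y. (\<integral>\<^sup>+ x. indicator V y * indicator {y. dist x y < r} y \<partial>M) \<partial>N)"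
      by (rule NM.Fubini'[OF meas[OF V]])
    also have "\<dots> = (\<integral>\<^sup>+ y. emeasure M (ball z r) * indicator V y \<partial>N)"
    proof (rule nn_integral_cong_AE)
      have "(\<integral>\<^sup>+ x. indicator V y * indicator {y. dist x y < r} y \<partial>M) = emeasure M (ball z r) * indicator V y"
        if y: "y \<in> sphere p 1" for y
      proof -
        have "(\<integral>\<^sup>+ x. indicator V y * indicator {y. dist x y < r} y \<partial>M) =
            (\<integral>\<^sup>+ x. indicator V y * indicator (ball y r) x \<partial>M)"
          by (intro nn_integral_cong) (auto split: split_indicator simp: dist_commute)
        also have "\<dots> = indicator V y * emeasure M (ball y r)"
          by (subst nn_integral_cmult) (auto intro!: borel_measurable_indicator)
        finally show ?thesis
          using uniform_on_unit_sphere_ball[OF M y z] by (simp add: mult.commute)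
      qed
      with aeN show "AE y in N. (\<integral>\<^sup>+ x. indicator V y * indicator {y. dist x y < r} y \<partial>M) =
          emeasure M (ball z r) * indicator V y"
        by auto
    qed
    also have "\<dots> = emeasure M (ball z r) * emeasure N V"
      by (subst nn_integral_cmult) auto
    finally show ?thesis .
  qed
  have h_eq: "emeasure M (ball z r) = h r" for r
  proof -
    have "emeasure M (ball z r) = (\<integral>\<^sup>+ x. emeasure N (UNIV \<inter> ball x r) \<partial>M)"
      using N.emeasure_space_1 by (subst swap) auto
    also have "\<dots> = (\<integral>\<^sup>+ x. h r \<partial>M)"
    proof (rule nn_integral_cong_AE)
      show "AE x in M. emeasure N (UNIV \<inter> ball x r) = h r"
        using aeM by eventually_elim (use uniform_on_unit_sphere_ball[OF N _ z] in \<open>simp add: h_def\<close>)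
    qed
    also have "\<dots> = h r" using M.emeasure_space_1 by simp
    finally show ?thesis .
  qed
  have h_pos: "h r \<noteq> 0" if "r > 0" for r
  proof
    assume h0: "h r = 0"
    obtain F where F: "F \<subseteq> (\<lambda>x. ball x r) ` sphere p 1" "countable F"
        "\<Union>F = \<Union>((\<lambda>x. ball x r) ` sphere p 1)"
      by (rule Lindelof[of "(\<lambda>x. ball x r) ` sphere p 1"]) auto
    have "B \<in> null_sets N" if "B \<in> F" for B
      using that F(1) h0 uniform_on_unit_sphere_ball[OF N _ z]
      by (auto simp: null_sets_def h_def)
    then have "\<Union>F \<in> null_sets N" using F(2) by (metis Sup_set_def null_sets_UN' image_ident)
    moreover have "sphere p 1 \<subseteq> \<Union>F" using that unfolding F(3) by force
    ultimately have "AE q in N. q \<notin> sphere p 1"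
      by (metis (mono_tags, lifting) AE_not_in eventually_mono subsetD)
    with aeN have "AE q in N. False" by eventually_elim simp
    then show False using N.AE_contr by auto
  qed
  have h_fin: "h r \<noteq> \<infinity>" for r by (simp add: h_def)
  define r where "r k = inverse (real (Suc k))" for k
  have r0: "r k > 0" for k by (simp add: r_def)
  define u where "u k x = emeasure N (U \<inter> ball x (r k)) / h (r k)" for k x
  have U [measurable]: "U \<in> sets borel" using \<open>open U\<close> by simp
  have um [measurable]: "u k \<in> borel_measurable M" for k
  proof -
    have "(\<lambda>x. \<integral>\<^sup>+ y. indicator U y * indicator {y. dist x y < r k} y \<partial>N) \<in> borel_measurable M"
      by measurable
    then show ?thesis unfolding u_def Nball[OF U] by simp
  qed
  have "emeasure M U = (\<integral>\<^sup>+ x. indicator U x \<partial>M)" by simp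
  also have "\<dots> \<le> (\<integral>\<^sup>+ x. liminf (\<lambda>k. u k x) \<partial>M)"
  proof (rule nn_integral_mono_AE)
    have "indicator U x \<le> liminf (\<lambda>k. u k x)" if x: "x \<in> sphere p 1" for x
    proof (cases "x \<in> U")
      case True
      then obtain e where e: "e > 0" "ball x e \<subseteq> U" using \<open>open U\<close> openE by blast
      have "\<forall>\<^sub>F k in sequentially. r k < e"
        unfolding r_def using LIMSEQ_inverse_real_of_nat e(1) by (rule order_tendstoD)
      then have "\<forall>\<^sub>F k in sequentially. 1 \<le> u k x"
      proof eventually_elim
        case (elim k)
        then have "U \<inter> ball x (r k) = ball x (r k)" using e(2) by auto
        then have "u k x = h (r k) / h (r k)"
          using uniform_on_unit_sphere_ball[OF N x z] by (simp add: u_def h_def)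
        also have "\<dots> = 1" using h_pos[OF r0] h_fin by (simp add: ennreal_divide_self top.not_eq_extremum)
        finally show ?case by simp
      qed
      then show ?thesis using True by (simp add: Liminf_bounded)
    qed simp
    with aeM show "AE x in M. indicator U x \<le> liminf (\<lambda>k. u k x)" by auto
  qed
  also have "\<dots> \<le> liminf (\<lambda>k. \<integral>\<^sup>+ x. u k x \<partial>M)"
    by (rule nn_integral_liminf) measurable
  also have "(\<lambda>k. \<integral>\<^sup>+ x. u k x \<partial>M) = (\<lambda>k. emeasure N U)"
  proof
    fix k
    have "(\<integral>\<^sup>+ x. u k x \<partial>M) = (\<integral>\<^sup>+ x. emeasure N (U \<inter> ball x (r k)) \<partial>M) / h (r k)"
    proof -
      have "(\<lambda>x. \<integral>\<^sup>+ y. indicator U y * indicator {y. dist x y < r k} y \<partial>N) \<in> borel_measurable M"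
        by measurable
      then show ?thesis unfolding u_def Nball[OF U] by (rule nn_integral_divide)
    qed
    also have "\<dots> = h (r k) * emeasure N U / h (r k)" by (simp add: swap h_eq)
    also have "\<dots> = emeasure N U"
      using h_pos[OF r0] h_fin
      by (simp add: ennreal_mult_divide_eq mult.commute)
    finally show "(\<integral>\<^sup>+ x. u k x \<partial>M) = emeasure N U" .
  qed
  also have "liminf (\<lambda>k. emeasure N U) = emeasure N U" by (simp add: Liminf_const)
  finally show ?thesis .
qed

lemma uniform_on_unit_sphere_unique:
  assumes M: "uniform_on_unit_sphere p M" and N: "uniform_on_unit_sphere p N"
  shows "M = N"
proof (rule measure_eqI_generator_eq[where E = "{S. open S}" and \<Omega> = UNIV and A = "\<lambda>_. UNIV"])
  show "emeasure M X = emeasure N X" if "X \<in> {S. open S}" for X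
    using that uniform_on_unit_sphere_le[OF M N, of X] uniform_on_unit_sphere_le[OF N M, of X] by simp
  show "sets M = sigma_sets UNIV {S. open S}" "sets N = sigma_sets UNIV {S. open S}"
    using M N by (auto simp: uniform_on_unit_sphere_def borel_def)
  interpret M: prob_space M using M by (simp add: uniform_on_unit_sphere_def)
  show "emeasure M UNIV \<noteq> \<infinity>" by simp
qed (auto simp: Int_stable_def)

subsection \<open>Existence\<close>

lemma orthogonal_transformation_continuous:
  fixes f :: "'a::euclidean_space \<Rightarrow> 'a"
  shows "orthogonal_transformation f \<Longrightarrow> continuous_on A f"
  by (intro linear_continuous_on linear_conv_bounded_linear[THEN iffD1] orthogonal_transformation_linear)

lemma emeasure_orthogonal_le:
  fixes f :: "'a::euclidean_space \<Rightarrow> 'a"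
  assumes f: "orthogonal_transformation f" and U: "open U"
  shows "emeasure lborel U \<le> emeasure lborel (f -` U)"
proof -
  define K where "K = {(x, r). 0 < r \<and> ball x r \<subseteq> U}"
  let ?B = "\<lambda>i. ball (fst i) (snd i) :: 'a set"
  obtain C where C: "countable C" "C \<subseteq> K"
    and disj: "pairwise (\<lambda>i j. disjnt (?B i) (?B j)) C" and neg: "negligible (U - (\<Union>i\<in>C. ?B i))"
  proof (rule Vitali_covering_theorem_balls[of U K fst snd])
    fix x and d :: real assume "x \<in> U" "0 < d"
    then obtain e where "e > 0" "ball x e \<subseteq> U" using U openE by blast
    then show "\<exists>i. i \<in> K \<and> x \<in> ?B i \<and> snd i < d"
      using \<open>0 < d\<close> by (intro exI[of _ "(x, min e (d/2))"]) (auto simp: K_def)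
  qed
  have cont: "continuous_on UNIV f"
    using f by (rule orthogonal_transformation_continuous)
  have pre: "f -` ball x r = ball (inv f x) r" for x r
  proof -
    have "f (inv f x) = x" using f by (simp add: orthogonal_transformation_surj surj_f_inv_f)
    then have "dist x (f y) = dist (inv f x) y" for y
      using f by (metis orthogonal_transformation_isometry)
    then show ?thesis by auto
  qed
  have ball: "emeasure lborel (f -` ?B i) = emeasure lborel (?B i)" for i
  proof -
    have "emeasure lborel (ball (inv f (fst i)) (snd i)) = emeasure lborel (ball (fst i) (snd i))"
      by (cases "snd i \<ge> 0") (simp_all add: emeasure_ball ball_empty)
    then show ?thesis by (simp add: pre)
  qed
  have d1: "disjoint_family_on ?B C"
    using disj by (auto simp: disjoint_family_on_def pairwise_def disjnt_def)
  then have d2: "disjoint_family_on (\<lambda>i. f -` ?B i) C"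
    unfolding disjoint_family_on_def by (metis vimage_Int vimage_empty)
  have m: "f -` V \<in> sets lborel" if "open V" for V
    using that cont by (simp add: open_vimage)
  have UB: "open (\<Union>i\<in>C. ?B i)" by auto
  have "emeasure lborel U \<le> emeasure lborel ((\<Union>i\<in>C. ?B i) \<union> (U - (\<Union>i\<in>C. ?B i)))"
    using U UB by (intro emeasure_mono) auto
  also have "\<dots> = emeasure lborel (\<Union>i\<in>C. ?B i)"
  proof (rule emeasure_Un_null_set)
    have "U - (\<Union>i\<in>C. ?B i) \<in> sets borel" using U UB by auto
    then show "U - (\<Union>i\<in>C. ?B i) \<in> null_sets lborel"
      using neg by (simp add: negligible_iff_null_sets null_sets_completion_iff)
  qed (use UB in auto)
  also have "\<dots> = (\<integral>\<^sup>+i. emeasure lborel (?B i) \<partial>count_space C)"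
    by (rule emeasure_UN_countable[OF _ C(1) d1]) auto
  also have "\<dots> = (\<integral>\<^sup>+i. emeasure lborel (f -` ?B i) \<partial>count_space C)"
    by (simp add: ball)
  also have "\<dots> = emeasure lborel (\<Union>i\<in>C. f -` ?B i)"
    by (rule emeasure_UN_countable[OF _ C(1) d2, symmetric]) (rule m, simp)
  also have "\<dots> \<le> emeasure lborel (f -` U)"
    using C(2) m[OF U] by (intro emeasure_mono) (fastforce simp: K_def)+
  finally show ?thesis .
qed

lemma emeasure_orthogonal:
  fixes f :: "'a::euclidean_space \<Rightarrow> 'a"
  assumes f: "orthogonal_transformation f" and U: "open U"
  shows "emeasure lborel (f -` U) = emeasure lborel U"
proof (rule antisym)
  have g: "orthogonal_transformation (inv f)" using f by (rule orthogonal_transformation_inv)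
  have "continuous_on UNIV f"
    using f by (rule orthogonal_transformation_continuous)
  then have "open (f -` U)" using U by (rule open_vimage[rotated])
  then have "emeasure lborel (f -` U) \<le> emeasure lborel (inv f -` (f -` U))"
    by (rule emeasure_orthogonal_le[OF g])
  also have "inv f -` (f -` U) = U"
    using f by (auto simp: orthogonal_transformation_surj surj_f_inv_f)
  finally show "emeasure lborel (f -` U) \<le> emeasure lborel U" .
qed (rule emeasure_orthogonal_le[OF f U])

abbreviation ball_measure :: "'a::euclidean_space measure" where
  "ball_measure \<equiv> uniform_measure lborel (ball 0 1)"

lemma prob_space_ball_measure: "prob_space ball_measure"
proof (rule prob_space_uniform_measure)
  show "emeasure lborel (ball (0::'a) 1) \<noteq> 0"
    using content_ball_pos[of 1 "0::'a"] by (auto simp: measure_def)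
  show "emeasure lborel (ball (0::'a) 1) \<noteq> \<infinity>"
    using emeasure_lborel_ball_finite[of "0::'a" 1] by simp
qed

lemma distr_ball_measure_orthogonal:
  fixes f :: "'a::euclidean_space \<Rightarrow> 'a"
  assumes f: "orthogonal_transformation f"
  shows "distr ball_measure borel f = ball_measure"
proof (rule measure_eqI_generator_eq[where E = "{S. open S}" and \<Omega> = UNIV and A = "\<lambda>_. UNIV"])
  have cont: "continuous_on UNIV f"
    using f by (rule orthogonal_transformation_continuous)
  then have fm [measurable]: "f \<in> borel_measurable borel" by (rule borel_measurable_continuous_onI)
  then have fm' [measurable]: "f \<in> ball_measure \<rightarrow>\<^sub>M borel" by simp
  interpret P: prob_space "ball_measure :: 'a measure" by (rule prob_space_ball_measure)
  show "emeasure (distr ball_measure borel f) X = emeasure ball_measure X" if "X \<in> {S. open S}" for X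
  proof -
    have X: "open X" using that by simp
    have "f -` ball 0 1 = ball 0 1"
      using f by (auto simp: orthogonal_transformation_norm)
    then have "f -` (ball 0 1 \<inter> X) = ball 0 1 \<inter> f -` X" by auto
    moreover have "open (f -` X)" using X cont by (rule open_vimage)
    ultimately show ?thesis
      using emeasure_orthogonal[OF f open_Int[OF open_ball X], of 0 1] X
      by (simp add: emeasure_distr)
  qed
  show "emeasure (distr ball_measure borel f) UNIV \<noteq> \<infinity>"
    using P.emeasure_space_1 by (simp add: emeasure_distr)
qed (auto simp: Int_stable_def borel_def)

text \<open>The unit sphere around \<open>p\<close> is parametrised by directions: the point at distance 1 from the
  origin in direction \<open>v\<close> is \<open>hlift (sinh 1 *\<^sub>R sgn v)\<close>.\<close>

definition sphere_map :: "'d::finite hyperbolic \<Rightarrow> real^'d \<Rightarrow> 'd hyperbolic" where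
  "sphere_map p v = boost p (hlift (sinh 1 *\<^sub>R sgn v))"

lemma dist_sphere_map:
  assumes "v \<noteq> 0"
  shows "dist p (sphere_map p v) = 1"
proof -
  have "sgn v \<bullet> sgn v = 1"
    using assms by (simp add: norm_sgn flip: power2_norm_eq_inner)
  then have "cosh (dist (hlift 0) (hlift (sinh 1 *\<^sub>R sgn v))) = sqrt (1 + (sinh 1)\<^sup>2)"
    by (simp add: coords_hlift power2_eq_square flip: tcoord_eq_cosh)
  also have "\<dots> = cosh 1" using cosh_square_eq[of "1::real"] by (simp add: real_sqrt_unique)
  finally have "dist (hlift 0) (hlift (sinh 1 *\<^sub>R sgn v)) = 1"
    by (metis arcosh_cosh_real zero_le_dist zero_le_one)
  then show ?thesis unfolding sphere_map_def by (metis boost_origin dist_boost)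
qed

lemma measurable_hlift [measurable]: "hlift \<in> borel_measurable borel"
  by (intro borel_measurable_continuous_onI continuous_on_hlift)

lemma measurable_xcoord [measurable]: "xcoord \<in> borel_measurable borel"
  by (intro borel_measurable_continuous_onI continuous_on_xcoord)

lemma measurable_sphere_map:
  "(\<lambda>(p, v). sphere_map p v) \<in> borel \<Otimes>\<^sub>M borel \<rightarrow>\<^sub>M borel"
  unfolding sphere_map_def boost_def tcoord_eq sgn_div_norm by measurable

lemma measurable_sphere_map2 [measurable]: "sphere_map p \<in> borel_measurable borel"
  using measurable_compose[OF measurable_Pair1' measurable_sphere_map, of p] by simp

lemma uniform_on_unit_sphere_exists:
  fixes p :: "'d::finite hyperbolic"
  shows "uniform_on_unit_sphere p (distr ball_measure borel (sphere_map p))" (is "uniform_on_unit_sphere p ?M")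
  unfolding uniform_on_unit_sphere_def
proof (intro conjI allI impI)
  interpret prob_space "ball_measure :: (real^'d) measure" by (rule prob_space_ball_measure)
  have m [measurable]: "sphere_map p \<in> ball_measure \<rightarrow>\<^sub>M borel" by simp
  show "prob_space ?M" by (rule prob_space_distr) fact
  show "sets ?M = sets borel" by simp
  have "AE v in (ball_measure :: (real^'d) measure). v \<noteq> 0"
    by (rule AE_uniform_measureI) (auto intro: AE_lborel_singleton eventually_mono[OF AE_lborel_singleton])
  then show "AE q in ?M. q \<in> sphere p 1"
    by (subst AE_distr_iff) (auto elim!: eventually_mono simp: dist_sphere_map)
  fix f assume f: "isometry_fixing p f"
  let ?g = "\<lambda>q. boost (reflect p) (f (boost p q))"
  have "isometry_fixing (hlift 0) ?g" using f by (simp add: isometry_fixing_def)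
  then obtain G where G: "orthogonal_transformation G" and g: "\<And>x. ?g (hlift x) = hlift (G x)"
    by (rule isometry_fixing_origin) blast
  have Gs: "G (sinh 1 *\<^sub>R sgn v) = sinh 1 *\<^sub>R sgn (G v)" for v
    using G by (simp add: sgn_div_norm orthogonal_transformation_scaleR orthogonal_transformation_norm)
  have eq: "f \<circ> sphere_map p = sphere_map p \<circ> G"
  proof
    fix v
    have "boost p (?g (hlift (sinh 1 *\<^sub>R sgn v))) = boost p (hlift (sinh 1 *\<^sub>R sgn (G v)))"
      unfolding g Gs ..
    then show "(f \<circ> sphere_map p) v = (sphere_map p \<circ> G) v" by (simp add: sphere_map_def)
  qed
  have "continuous_on UNIV G"
    using G by (rule orthogonal_transformation_continuous)
  then have Gm [measurable]: "G \<in> ball_measure \<rightarrow>\<^sub>M borel"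
    using borel_measurable_continuous_onI[of G] by simp
  have "distr ?M borel f = distr ball_measure borel (sphere_map p \<circ> G)"
    using isometry_measurable[OF f] by (simp add: distr_distr eq)
  also have "\<dots> = distr (distr ball_measure borel G) borel (sphere_map p)"
    by (simp add: distr_distr)
  also have "\<dots> = ?M" by (simp add: distr_ball_measure_orthogonal[OF G])
  finally show "distr ?M borel f = ?M" .
qed

theorem unit_sphere_measure_iff: "uniform_on_unit_sphere p M \<longleftrightarrow> M = unit_sphere_measure p"
  unfolding unit_sphere_measure_def
  by (metis (mono_tags) the_equality uniform_on_unit_sphere_exists uniform_on_unit_sphere_unique)

lemma unit_sphere_measure_eq: "unit_sphere_measure p = distr ball_measure borel (sphere_map p)"
  using uniform_on_unit_sphere_exists unit_sphere_measure_iff by metis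

section \<open>The walk and the self-avoiding walk measure\<close>

abbreviation path_space :: "nat \<Rightarrow> (nat \<Rightarrow> 'd::finite hyperbolic) measure" where
  "path_space n \<equiv> PiM {..n} (\<lambda>_. borel)"

text \<open>\<open>walk x\<^sub>0 n\<close> is the joint law of \<open>(x\<^sub>0, \<dots>, x\<^sub>n)\<close>: given the first \<open>n + 1\<close> vertices, the next one
  has the uniform distribution on the unit sphere around the last.\<close>

primrec walk :: "'d::finite hyperbolic \<Rightarrow> nat \<Rightarrow> (nat \<Rightarrow> 'd hyperbolic) measure" where
  "walk x\<^sub>0 0 = return (path_space 0) (\<lambda>i\<in>{..0}. x\<^sub>0)"
| "walk x\<^sub>0 (Suc n) =
     walk x\<^sub>0 n \<bind> (\<lambda>x. distr (unit_sphere_measure (x n)) (path_space (Suc n)) (\<lambda>y. x(Suc n := y)))"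

definition self_avoiding :: "real \<Rightarrow> nat \<Rightarrow> (nat \<Rightarrow> 'd::finite hyperbolic) set" where
  "self_avoiding c n = {x \<in> space (path_space n). \<forall>i j. i < j \<and> j \<le> n \<longrightarrow> dist (x i) (x j) > c}"

text \<open>\<open>uniform_measure M A\<close> is \<open>M\<close> conditioned on the event \<open>A\<close>.\<close>

definition saw_measure ::
    "real \<Rightarrow> 'd::finite hyperbolic \<Rightarrow> nat \<Rightarrow> (nat \<Rightarrow> 'd hyperbolic) measure" where
  "saw_measure c x\<^sub>0 n = uniform_measure (walk x\<^sub>0 n) (self_avoiding c n)"

lemma unit_sphere_measure_measurable [measurable]:
  "unit_sphere_measure \<in> borel \<rightarrow>\<^sub>M prob_algebra borel"
  unfolding unit_sphere_measure_eq[abs_def]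
  by (rule measurable_distr_prob_space2[where M = borel])
     (auto simp: space_prob_algebra prob_space_ball_measure measurable_sphere_map)

lemma walk_step_measurable:
  "(\<lambda>x. distr (unit_sphere_measure (x n)) (path_space (Suc n)) (\<lambda>y. x(Suc n := y)))
     \<in> path_space n \<rightarrow>\<^sub>M prob_algebra (path_space (Suc n))"
proof (rule measurable_distr_prob_space2[where M = borel])
  show "(\<lambda>(x, y). x(Suc n := y)) \<in> path_space n \<Otimes>\<^sub>M borel \<rightarrow>\<^sub>M path_space (Suc n)"
    using measurable_add_dim[of "Suc n" "{..n}" "\<lambda>_. borel"] by (simp add: atMost_Suc)
qed measurable

lemma walk_prob_algebra: "walk x\<^sub>0 n \<in> space (prob_algebra (path_space n))"
proof (induction n)
  case 0
  show ?case by (auto simp: space_prob_algebra intro!: prob_space_return simp: space_PiM)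
next
  case (Suc n)
  then show ?case
    using prob_space_bind'[OF Suc walk_step_measurable] sets_bind'[OF Suc walk_step_measurable]
    by (simp add: space_prob_algebra)
qed

lemma self_avoiding_measurable [measurable]: "self_avoiding c n \<in> sets (path_space n)"
proof -
  have "self_avoiding c n = {x \<in> space (path_space n). \<forall>j\<in>{..n}. \<forall>i\<in>{..<j}. dist (x i) (x j) > c}"
    by (auto simp: self_avoiding_def)
  also have "\<dots> \<in> sets (path_space n)"
    by measurable
  finally show ?thesis .
qed

end

theory Submission
  imports Defs
begin

text \<open>
  Call a window of \<open>k\<close> consecutive steps of a walk a cut if it separates the past from the future so
  well that every distance across it exceeds the distances to its two ends by 1. Cuts in disjoint
  windows each contribute 1 to the distance of the end points (\<open>card_cuts_le_dist\<close>). As an expected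
  displacement is to be bounded from below, it suffices to find linearly many positions \<open>j\<close> on
  average such that a cut occurs at \<open>j\<close>.

  Cuts are created by surgery. Suppose that a self-avoiding walk avoids a half-space whose
  boundary passes within bounded distance of the vertex \<open>x j\<close>, and that \<open>x j\<close> is its vertex nearest
  to a point \<open>q\<close> deep in that half-space. Insert \<open>k\<close> further steps at \<open>x j\<close> that lead
  almost straight towards \<open>q\<close>, and apply to the tail of the walk the half-turn that exchanges the ends
  of the inserted path. The tail then lies deep in the empty half-space, hence the new walk is again
  self-avoiding and has a cut at \<open>j\<close> (\<open>surgery_self_avoiding_cut\<close>). The half-turn is an
  isometry and the inserted steps have probability bounded from below, so for each \<open>j\<close> the probability
  that an \<open>(n + k)\<close>-step walk is self-avoiding with a cut at \<open>j\<close> is at least a constant times the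
  probability that an \<open>n\<close>-step walk is self-avoiding and exposed at \<open>j\<close> in the above sense
  (\<open>nn_integral_surgery\<close>, \<open>surgery_probability\<close>). Conditioning on self-avoidance does not spoil
  the comparison, since longer walks are less likely to be self-avoiding.

  It remains to see that every separated finite set has a positive proportion of exposed points
  (\<open>many_exposed\<close>). This is where negative curvature enters. Divide the upper half-space into dyadic
  cells, which form a tree, and choose two children of each cell. If there are no points of the set
  below one of the chosen children of an occupied cell, then there is an empty half-space below that
  child, and the point of the set nearest to a point far down in it is exposed. If there are points
  below both chosen children, then the tree of occupied cells branches there; as a finite tree has
  fewer branchings than leaves, at most half of the occupied cells are of this kind
  (\<open>card_bad_cells\<close>).
\<close>

section \<open>Upper half-space coordinates\<close>

text \<open>The distance enters through its hyperbolic cosine, which is bilinear in hyperboloid coordinates;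
  the triangle inequality becomes multiplicative, with the constant 2.\<close>

lemma cosh_dist_triangle:
  fixes x y z :: "'d::finite hyperbolic"
  shows "cosh (dist x z) \<le> 2 * cosh (dist x y) * cosh (dist y z)"
proof -
  have "cosh (dist x z) \<le> cosh (dist x y + dist y z)"
    using dist_triangle[of x z y] by (simp add: cosh_real_nonneg_le_iff)
  also have "\<dots> \<le> 2 * cosh (dist x y) * cosh (dist y z)"
    using mult_mono[of "sinh (dist x y)" "cosh (dist x y)" "sinh (dist y z)" "cosh (dist y z)"]
    by (simp add: cosh_add sinh_le_cosh_real)
  finally show ?thesis .
qed

text \<open>The hyperboloid is mapped to the upper half-space \<open>{u. u $ i > 0}\<close>: the light ray in the
  direction of the axis \<open>i\<close> becomes the point at infinity, so that the height is the inverse of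
  \<open>tcoord p - xcoord p $ i\<close>.\<close>

definition half_space_point :: "'d \<Rightarrow> 'd::finite hyperbolic \<Rightarrow> real^'d" where
  "half_space_point i p =
    (\<chi> l. (if l = i then 1 else xcoord p $ l) / (tcoord p - xcoord p $ i))"

lemma half_space_denom_pos: "tcoord p - xcoord p $ i > 0"
  using component_le_norm_cart[of "xcoord p" i] norm_xcoord_less[of p] by linarith

lemma half_space_height_pos: "half_space_point i p $ i > 0"
  using half_space_denom_pos[of p i] by (simp add: half_space_point_def)

lemma inner_split_axis:
  fixes x y :: "real^'d::finite"
  shows "x \<bullet> y = x $ i * y $ i + (\<Sum>l\<in>UNIV - {i}. x $ l * y $ l)"
  unfolding inner_vec_def inner_real_def by (rule sum.remove) auto

lemma cosh_dist_half_space: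
  "cosh (dist p q) = 1 + (norm (half_space_point i p - half_space_point i q))\<^sup>2
     / (2 * half_space_point i p $ i * half_space_point i q $ i)"
proof -
  define a b where "a = tcoord p - xcoord p $ i" and "b = tcoord q - xcoord q $ i"
  define S where "S x y = (\<Sum>l\<in>UNIV - {i}. x $ l * y $ l)" for x y :: "real^'a"
  have a: "a > 0" and b: "b > 0"
    unfolding a_def b_def by (rule half_space_denom_pos)+
  have pp: "(tcoord p)\<^sup>2 = 1 + (xcoord p $ i)\<^sup>2 + S (xcoord p) (xcoord p)"
    and qq: "(tcoord q)\<^sup>2 = 1 + (xcoord q $ i)\<^sup>2 + S (xcoord q) (xcoord q)"
    unfolding tcoord_square inner_split_axis[of _ _ i] S_def by (simp_all add: power2_eq_square)
  have "(norm (half_space_point i p - half_space_point i q))\<^sup>2 =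
      (1 / a - 1 / b)\<^sup>2 + (\<Sum>l\<in>UNIV - {i}. (xcoord p $ l / a - xcoord q $ l / b)\<^sup>2)"
    unfolding power2_norm_eq_inner inner_split_axis[of _ _ i]
    by (simp add: half_space_point_def a_def b_def power2_eq_square)
  also have "(\<Sum>l\<in>UNIV - {i}. (xcoord p $ l / a - xcoord q $ l / b)\<^sup>2) =
      S (xcoord p) (xcoord p) / a\<^sup>2 + S (xcoord q) (xcoord q) / b\<^sup>2
        - 2 * S (xcoord p) (xcoord q) / (a * b)"
    unfolding S_def sum_distrib_left sum_divide_distrib sum.distrib[symmetric] sum_subtractf[symmetric]
    by (intro sum.cong refl) (use a b in \<open>simp add: field_simps power2_eq_square\<close>)
  finally have n: "(norm (half_space_point i p - half_space_point i q))\<^sup>2 = \<dots> + (1 / a - 1 / b)\<^sup>2"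
    by simp
  have l: "cosh (dist p q) = tcoord p * tcoord q - xcoord p $ i * xcoord q $ i - S (xcoord p) (xcoord q)"
    by (simp add: cosh_dist lorentz_def inner_split_axis[of _ _ i] S_def)
  have sp: "S (xcoord p) (xcoord p) = a * (a + 2 * xcoord p $ i) - 1"
    and sq: "S (xcoord q) (xcoord q) = b * (b + 2 * xcoord q $ i) - 1"
    using pp qq by (simp_all add: a_def b_def power2_eq_square algebra_simps)
  have tp: "tcoord p = a + xcoord p $ i" and tq: "tcoord q = b + xcoord q $ i"
    by (simp_all add: a_def b_def)
  have hp: "half_space_point i p $ i = 1 / a" and hq: "half_space_point i q $ i = 1 / b"
    by (simp_all add: half_space_point_def a_def b_def)
  show ?thesis
    unfolding l n sp sq tp tq hp hq
    using a b by (simp add: field_simps power2_eq_square)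
qed

lemma half_space_point_surj:
  fixes u :: "real^'d::finite"
  assumes "u $ i > 0"
  obtains p where "half_space_point i p = u"
proof -
  define x :: "real^'d" where
    "x = (\<chi> l. if l = i then ((norm u)\<^sup>2 - 1) / (2 * u $ i) else u $ l / u $ i)"
  define S where "S = (\<Sum>l\<in>UNIV - {i}. u $ l * u $ l)"
  have nu: "(norm u)\<^sup>2 = (u $ i)\<^sup>2 + S"
    unfolding power2_norm_eq_inner inner_split_axis[of _ _ i] by (simp add: S_def power2_eq_square)
  have "x \<bullet> x = (((norm u)\<^sup>2 - 1) / (2 * u $ i))\<^sup>2 + S / (u $ i)\<^sup>2"
    unfolding inner_split_axis[of _ _ i] S_def sum_divide_distrib
    by (simp add: x_def power2_eq_square)
  then have "1 + x \<bullet> x = (((norm u)\<^sup>2 + 1) / (2 * u $ i))\<^sup>2"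
    unfolding nu using assms by (simp add: field_simps power2_eq_square)
  then have t: "tcoord (hlift x) = ((norm u)\<^sup>2 + 1) / (2 * u $ i)"
    using assms by (simp add: coords_hlift)
  have "tcoord (hlift x) - xcoord (hlift x) $ i = 1 / u $ i"
    unfolding t using assms by (simp add: x_def field_simps)
  then have "half_space_point i (hlift x) = u"
    using assms by (simp add: vec_eq_iff half_space_point_def x_def)
  then show thesis by (rule that)
qed

section \<open>Packing\<close>

lemma compact_cball_origin: "compact (cball (hlift 0 :: 'd::finite hyperbolic) r)"
proof (cases "r \<ge> 0")
  case True
  have "cball (hlift 0 :: 'd hyperbolic) r = hlift ` cball 0 (sinh r)"
  proof -
    have "dist (hlift 0) p \<le> r \<longleftrightarrow> norm (xcoord p) \<le> sinh r" for p :: "'d hyperbolic"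
    proof -
      have "dist (hlift 0) p \<le> r \<longleftrightarrow> tcoord p \<le> cosh r"
        unfolding tcoord_eq_cosh using True by (simp add: cosh_real_nonneg_le_iff)
      also have "\<dots> \<longleftrightarrow> (tcoord p)\<^sup>2 \<le> (cosh r)\<^sup>2"
        by (metis tcoord_pos cosh_real_nonneg less_imp_le power_mono_iff pos2)
      also have "\<dots> \<longleftrightarrow> (norm (xcoord p))\<^sup>2 \<le> (sinh r)\<^sup>2"
        by (simp add: tcoord_square cosh_square_eq power2_norm_eq_inner)
      also have "\<dots> \<longleftrightarrow> norm (xcoord p) \<le> sinh r"
        using True by (simp add: power_mono_iff)
      finally show ?thesis .
    qed
    then show ?thesis
      by (auto simp: image_iff) (metis dist_0_norm hlift_xcoord mem_cball)
  qed
  then show ?thesis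
    by (simp add: compact_continuous_image continuous_on_hlift)
next
  case False
  then have "cball (hlift 0 :: 'd hyperbolic) r = {}" by (metis cball_empty not_le)
  then show ?thesis by simp
qed

definition separated :: "real \<Rightarrow> 'a::metric_space set \<Rightarrow> bool" where
  "separated c A \<longleftrightarrow> (\<forall>x\<in>A. \<forall>y\<in>A. x \<noteq> y \<longrightarrow> dist x y > c)"

text \<open>Balls of equal radius are isometric, so compactness of one of them bounds the cardinality of
  separated subsets of all of them.\<close>

lemma packing_bound:
  assumes "c > 0"
  obtains N :: nat where "N > 0"
    "\<And>(p :: 'd::finite hyperbolic) A. A \<subseteq> cball p r \<Longrightarrow> separated c A \<Longrightarrow> finite A \<and> card A \<le> N"
proof -
  let ?o = "hlift 0 :: 'd hyperbolic"
  obtain T where T: "finite T" "cball ?o r \<subseteq> (\<Union>t\<in>T. ball t (c / 2))"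
    using compact_imp_seq_compact[OF compact_cball_origin, THEN seq_compact_imp_totally_bounded]
      assms by (metis half_gt_zero)
  have origin: "finite A \<and> card A \<le> card T" if A: "A \<subseteq> cball ?o r" "separated c A" for A
  proof -
    have "\<forall>a\<in>A. \<exists>t. t \<in> T \<and> dist t a < c / 2"
      using T(2) A(1) by fastforce
    then obtain f where f: "\<And>a. a \<in> A \<Longrightarrow> f a \<in> T \<and> dist (f a) a < c / 2"
      by metis
    have "inj_on f A"
    proof (rule inj_onI, rule ccontr)
      fix a b assume ab: "a \<in> A" "b \<in> A" "f a = f b" "a \<noteq> b"
      have "dist a b < c"
        using f[OF ab(1)] f[OF ab(2)] ab(3) dist_triangle_half_r[of "f a" a c b] by simp
      then show False using A(2) ab unfolding separated_def by (meson less_asym)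
    qed
    moreover have "f ` A \<subseteq> T" using f by auto
    ultimately show ?thesis
      using T(1) by (metis card_inj_on_le inj_on_finite)
  qed
  show thesis
  proof (rule that[of "Suc (card T)"])
    fix p :: "'d hyperbolic" and A assume A: "A \<subseteq> cball p r" "separated c A"
    let ?g = "boost (reflect p)"
    have inj: "inj_on ?g A" by (rule inj_onI) (metis boost_reflect)
    have "dist ?o (?g x) = dist p x" for x
      by (metis boost_reflect_self dist_boost)
    then have "?g ` A \<subseteq> cball ?o r" using A(1) by auto
    moreover have "separated c (?g ` A)" using A(2) by (auto simp: separated_def)
    ultimately have "finite (?g ` A)" "card (?g ` A) \<le> card T" using origin by auto
    then show "finite A \<and> card A \<le> Suc (card T)"
      using inj by (simp add: finite_image_iff card_image)
  qed simp
qed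

section \<open>Dyadic cells\<close>

definition level :: "'d \<Rightarrow> 'd::finite hyperbolic \<Rightarrow> int" where
  "level i p = \<lfloor>log 2 (half_space_point i p $ i)\<rfloor>"

definition cube :: "'d \<Rightarrow> int \<Rightarrow> 'd::finite hyperbolic \<Rightarrow> 'd \<Rightarrow> int" where
  "cube i K p l = (if l = i then 0 else \<lfloor>half_space_point i p $ l / 2 powr K\<rfloor>)"

definition cell :: "'d \<Rightarrow> 'd::finite hyperbolic \<Rightarrow> int \<times> ('d \<Rightarrow> int)" where
  "cell i p = (level i p, cube i (level i p) p)"

text \<open>The children of a cell are the cells one level lower whose base lies in its base. Only the two
  children at opposite corners of the cell are used: \<open>below i z \<epsilon> x\<close> says that \<open>x\<close> lies in the child
  with corner \<open>\<epsilon>\<close> of the cell of \<open>z\<close> or in a descendant of it.\<close>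

definition below :: "'d \<Rightarrow> 'd::finite hyperbolic \<Rightarrow> int \<Rightarrow> 'd hyperbolic \<Rightarrow> bool" where
  "below i z \<epsilon> x \<longleftrightarrow> level i x < level i z \<and>
     (\<forall>l. l \<noteq> i \<longrightarrow> cube i (level i z - 1) x l = 2 * cube i (level i z) z l + \<epsilon>)"

lemma height_level:
  "2 powr level i p \<le> half_space_point i p $ i" "half_space_point i p $ i < 2 * 2 powr level i p"
proof -
  let ?y = "half_space_point i p $ i"
  have y: "?y = 2 powr (log 2 ?y)" using half_space_height_pos[of i p] by simp
  have "real_of_int (level i p) \<le> log 2 ?y" "log 2 ?y < real_of_int (level i p) + 1"
    unfolding level_def by linarith+
  then have "2 powr level i p \<le> 2 powr (log 2 ?y)" "2 powr (log 2 ?y) < 2 powr (level i p + 1)"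
    by simp_all
  then show "2 powr level i p \<le> ?y" "?y < 2 * 2 powr level i p"
    using y by (simp_all add: powr_add)
qed

lemma level_less:
  assumes "half_space_point i p $ i < 2 powr K"
  shows "level i p < K"
proof -
  have "2 powr level i p < (2 powr K :: real)" using height_level(1)[of i p] assms by linarith
  then show ?thesis by simp
qed

lemma cube_bounds:
  assumes "l \<noteq> i"
  shows "real_of_int (cube i K p l) * 2 powr K \<le> half_space_point i p $ l"
    "half_space_point i p $ l < (real_of_int (cube i K p l) + 1) * 2 powr K"
proof -
  let ?r = "half_space_point i p $ l / 2 powr K"
  have "real_of_int (cube i K p l) \<le> ?r" "?r < real_of_int (cube i K p l) + 1"
    using assms by (simp_all add: cube_def)
  then show "real_of_int (cube i K p l) * 2 powr K \<le> half_space_point i p $ l"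
    "half_space_point i p $ l < (real_of_int (cube i K p l) + 1) * 2 powr K"
    by (simp_all add: field_simps)
qed

lemma cube_Suc: "cube i (K + 1) p l = cube i K p l div 2"
proof -
  have "half_space_point i p $ l / 2 powr (K + 1) = half_space_point i p $ l / 2 powr K / 2"
    by (simp add: powr_add)
  then show ?thesis
    using floor_divide_real_eq_div[of 2 "half_space_point i p $ l / 2 powr K"]
    by (simp add: cube_def powr_add)
qed

lemma cube_eq_mono:
  assumes "cube i K p = cube i K q" and "K \<le> K'"
  shows "cube i K' p = cube i K' q"
  using assms(2)
proof (induction K' rule: int_ge_induct)
  case base
  show ?case by (fact assms(1))
next
  case (step K')
  show ?case by (rule ext) (simp add: cube_Suc step.IH)
qed

lemma below_cube_eq:
  assumes "below i z \<epsilon> x" and "\<epsilon> \<in> {0, 1}"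
  shows "cube i (level i z) x = cube i (level i z) z"
proof
  fix l
  show "cube i (level i z) x l = cube i (level i z) z l"
  proof (cases "l = i")
    case False
    then have "cube i (level i z - 1) x l div 2 = cube i (level i z) z l"
      using assms by (auto simp: below_def)
    then show ?thesis using cube_Suc[of i "level i z - 1" x l] by simp
  qed (simp add: cube_def)
qed

lemma below_cong:
  assumes "cell i z = cell i z'" and "cell i x = cell i x'"
  shows "below i z \<epsilon> x \<longleftrightarrow> below i z' \<epsilon> x'"
proof -
  have z: "level i z = level i z'" "cube i (level i z') z = cube i (level i z') z'"
    and x: "level i x = level i x'" "cube i (level i x') x = cube i (level i x') x'"
    using assms by (auto simp: cell_def)
  have "cube i (level i z' - 1) x = cube i (level i z' - 1) x'" if "level i x' < level i z'"
    using cube_eq_mono[OF x(2)] that by simp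
  then show ?thesis
    by (auto simp: below_def z x)
qed

text \<open>Call a cell bad if there are points below both corner children. Mapping a bad cell and one of
  these children to a topmost point below the child is injective: if the same point arises from two
  bad cells on different levels, then the lower of these cells lies below the chosen child of the
  upper one, and higher than the point, which therefore was not topmost. The tree of cells branches
  at bad cells, so this is the bound of the number of branchings by the number of leaves.\<close>

lemma card_bad_cells:
  fixes A :: "'d::finite hyperbolic set"
  assumes A: "finite A" and inj: "inj_on (cell i) A" and l: "l \<noteq> i"
  shows "2 * card {z \<in> A. \<forall>\<epsilon>\<in>{0, 1}. \<exists>x\<in>A. below i z \<epsilon> x} \<le> card A"
proof -
  define Bad where "Bad = {z \<in> A. \<forall>\<epsilon>\<in>{0, 1}. \<exists>x\<in>A. below i z \<epsilon> x}"
  define top where "top = (\<lambda>(z, \<epsilon>). ARG_MAX (level i) x. x \<in> A \<and> below i z \<epsilon> x)"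
  have top: "top (z, \<epsilon>) \<in> A \<and> below i z \<epsilon> (top (z, \<epsilon>)) \<and>
      (\<forall>x\<in>A. below i z \<epsilon> x \<longrightarrow> level i x \<le> level i (top (z, \<epsilon>)))"
    if "z \<in> Bad" "\<epsilon> \<in> {0, 1}" for z \<epsilon>
  proof -
    let ?S = "{x \<in> A. below i z \<epsilon> x}"
    have "finite ?S" "?S \<noteq> {}" using A that by (auto simp: Bad_def)
    then obtain x where "x \<in> ?S" "\<And>y. y \<in> ?S \<Longrightarrow> level i y \<le> level i x"
      using Max_in[of "level i ` ?S"] Max_ge[of "level i ` ?S"] by fastforce
    then have "is_arg_max (level i) (\<lambda>x. x \<in> A \<and> below i z \<epsilon> x) x"
      by (fastforce simp: is_arg_max_linorder)
    then have "is_arg_max (level i) (\<lambda>x. x \<in> A \<and> below i z \<epsilon> x) (top (z, \<epsilon>))"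
      unfolding top_def arg_max_def prod.case by (rule someI)
    then show ?thesis by (auto simp: is_arg_max_linorder)
  qed
  have not_less: "\<not> level i z' < level i z"
    if "z \<in> Bad" "\<epsilon> \<in> {0, 1}" "z' \<in> Bad" "\<epsilon>' \<in> {0, 1}" "top (z, \<epsilon>) = top (z', \<epsilon>')"
    for z \<epsilon> z' \<epsilon>'
  proof
    assume less: "level i z' < level i z"
    let ?y = "top (z, \<epsilon>)"
    have y: "below i z \<epsilon> ?y" "below i z' \<epsilon>' ?y" using top that by metis+
    have "cube i (level i z - 1) ?y = cube i (level i z - 1) z'"
      using cube_eq_mono[OF below_cube_eq[OF y(2) that(4)]] less by simp
    then have "below i z \<epsilon> z'" using y(1) less by (simp add: below_def)
    then have "level i z' \<le> level i ?y"
      using top[OF that(1,2)] that(3) by (simp add: Bad_def)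
    then show False using y(2) by (simp add: below_def)
  qed
  have "inj_on top (Bad \<times> {0, 1})"
  proof (rule inj_onI, clarify)
    fix z \<epsilon> z' \<epsilon>' assume z: "z \<in> Bad" "\<epsilon> \<in> {0, 1::int}" "z' \<in> Bad" "\<epsilon>' \<in> {0, 1::int}"
      and eq: "top (z, \<epsilon>) = top (z', \<epsilon>')"
    have lev: "level i z = level i z'"
      using not_less[OF z eq] not_less[OF z(3,4,1,2) eq[symmetric]] by simp
    have y: "below i z \<epsilon> (top (z, \<epsilon>))" "below i z' \<epsilon>' (top (z, \<epsilon>))" using top z eq by metis+
    have "cell i z = cell i z'"
      using below_cube_eq[OF y(1) z(2)] below_cube_eq[OF y(2) z(4)] by (simp add: cell_def lev)
    then have "z = z'" using inj z by (auto simp: Bad_def inj_on_def)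
    moreover have "\<epsilon> = \<epsilon>'" using y l lev calculation by (auto simp: below_def)
    ultimately show "z = z' \<and> \<epsilon> = \<epsilon>'" ..
  qed
  moreover have "top ` (Bad \<times> {0, 1}) \<subseteq> A" using top by auto
  ultimately have "card (Bad \<times> {0, 1::int}) \<le> card A"
    using A by (rule card_inj_on_le)
  then show ?thesis by (simp add: card_cartesian_product Bad_def)
qed

lemma norm_le_of_components:
  fixes u :: "real^'d::finite"
  assumes "\<And>l. \<bar>u $ l\<bar> \<le> (if l = i then 2 * s else s)" and "s \<ge> 0"
  shows "norm u \<le> (real CARD('d) + 1) * s"
proof -
  have "norm u \<le> (\<Sum>l\<in>UNIV. \<bar>u $ l\<bar>)" by (rule norm_le_l1_cart)
  also have "\<dots> \<le> (\<Sum>l\<in>UNIV. s + (if l = i then s else 0))"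
    by (intro sum_mono) (metis assms(1) add_0_right mult_2)
  also have "\<dots> = (real CARD('d) + 1) * s"
    by (simp add: sum.distrib algebra_simps)
  finally show ?thesis .
qed

lemma dist_same_cell:
  fixes p q :: "'d::finite hyperbolic"
  assumes "cell i p = cell i q"
  shows "cosh (dist p q) \<le> 1 + (real CARD('d) + 1)\<^sup>2 / 2"
proof -
  let ?U = "half_space_point i" and ?B = "real CARD('d) + 1"
  let ?s = "2 powr real_of_int (level i p) :: real"
  have lev: "level i q = level i p" and cub: "cube i (level i p) q = cube i (level i p) p"
    using assms by (auto simp: cell_def)
  have "norm (?U p - ?U q) \<le> ?B * ?s"
  proof (rule norm_le_of_components[where i = i])
    fix l
    show "\<bar>(?U p - ?U q) $ l\<bar> \<le> (if l = i then 2 * ?s else ?s)"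
    proof (cases "l = i")
      case True
      then show ?thesis
        using height_level[of i p] height_level[of i q] by (simp add: lev abs_le_iff)
    next
      case False
      then show ?thesis
        using cube_bounds[OF False, where K = "level i p" and p = p]
            cube_bounds[OF False, where K = "level i p" and p = q]
        by (simp add: cub algebra_simps abs_le_iff)
    qed
  qed simp
  then have "(norm (?U p - ?U q))\<^sup>2 \<le> (?B * ?s)\<^sup>2" by (intro power_mono) auto
  also have "\<dots> = ?B\<^sup>2 * (?s * ?s)" by (simp add: power2_eq_square)
  also have "\<dots> \<le> ?B\<^sup>2 * (?U p $ i * ?U q $ i)"
    using height_level(1)[of i p] height_level(1)[of i q]
    by (intro mult_left_mono mult_mono) (auto simp: lev intro: less_imp_le[OF half_space_height_pos])
  finally show ?thesis
    using half_space_height_pos[of i p] half_space_height_pos[of i q]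
    unfolding cosh_dist_half_space[of p q i] by (simp add: field_simps)
qed

text \<open>Let \<open>q\<close> lie far below the centre of an empty child, at relative height \<open>h\<close>. Seen from \<open>z\<close>, the
  points of \<open>A\<close> are then not in the direction of \<open>q\<close>: up to a bounded factor, the path from \<open>x\<close> to
  \<open>q\<close> passes \<open>z\<close>. It matters that this factor does not depend on \<open>h\<close>, so that \<open>q\<close> can be
  arbitrarily far away.\<close>

lemma empty_child_shadow:
  fixes z :: "'d::finite hyperbolic"
  assumes empty: "\<And>x. x \<in> A \<Longrightarrow> \<not> below i z \<epsilon> x" and \<epsilon>: "\<epsilon> \<in> {0, 1}" and h: "0 < h" "h \<le> 1 / 2"
  defines "B \<equiv> real CARD('d) + 1"
  obtains q where "cosh (dist z q) \<ge> 1 / (16 * h)"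
    "\<And>x. x \<in> A \<Longrightarrow> cosh (dist x z) * cosh (dist z q) \<le>
      B\<^sup>2 * (24 + (1 + 4 * B)\<^sup>2) * cosh (dist x q)"
proof -
  define s :: real where "s = 2 powr real_of_int (level i z)"
  define m where "m = cube i (level i z) z"
  define u :: "real^'d" where
    "u = (\<chi> l. if l = i then h * s else (2 * real_of_int (m l) + real_of_int \<epsilon> + 1 / 2) * (s / 2))"
  have s: "s > 0" by (simp add: s_def)
  have B: "B \<ge> 1" by (simp add: B_def)
  obtain q where q: "half_space_point i q = u"
    by (rule half_space_point_surj[of u i]) (use s h in \<open>simp add: u_def\<close>)
  let ?U = "half_space_point i"
  have uq: "u $ i = h * s" by (simp add: u_def)
  have hs: "h * s \<le> s / 2" using mult_right_mono[OF h(2), of s] s by simp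
  have zi: "s \<le> ?U z $ i" "?U z $ i < 2 * s"
    using height_level[of i z] by (simp_all add: s_def)
  have zq: "norm (?U z - u) \<le> B * s" unfolding B_def
  proof (rule norm_le_of_components[where i = i])
    fix l
    show "\<bar>(?U z - u) $ l\<bar> \<le> (if l = i then 2 * s else s)"
    proof (cases "l = i")
      case True
      have "?U z $ i - h * s \<le> 2 * s" "h * s - ?U z $ i \<le> 2 * s"
        using zi hs mult_pos_pos[OF h(1) s] by linarith+
      then show ?thesis by (simp add: True uq abs_le_iff)
    next
      case False
      have "real_of_int (m l) * s \<le> ?U z $ l" "?U z $ l < (real_of_int (m l) + 1) * s"
        using cube_bounds[OF False, where K = "level i z" and p = z] by (simp_all add: m_def s_def)
      moreover have "real_of_int (m l) * s \<le> u $ l" "u $ l \<le> (real_of_int (m l) + 1) * s"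
        using \<epsilon> s False by (auto simp: u_def field_simps)
      ultimately show ?thesis using False by (simp add: algebra_simps abs_le_iff)
    qed
  qed (use s in simp)
  have zq_ge: "s / 2 \<le> norm (?U z - u)"
  proof -
    have "?U z $ i - h * s \<le> norm (?U z - u)"
      using component_le_norm_cart[of "?U z - u" i] by (simp add: uq)
    then show ?thesis using zi hs by linarith
  qed
  have cosh_zq: "cosh (dist z q) = 1 + (norm (?U z - u))\<^sup>2 / (2 * ?U z $ i * (h * s))"
    unfolding cosh_dist_half_space[of z q i] q uq ..
  have den: "0 < ?U z $ i * (h * s)" "s * (h * s) \<le> ?U z $ i * (h * s)"
      "?U z $ i * (h * s) \<le> 2 * s * (h * s)"
    using zi s h by (auto intro!: mult_right_mono)
  have low: "1 / (16 * h) \<le> cosh (dist z q)"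
  proof -
    have "1 / (16 * h) = (s / 2)\<^sup>2 / (2 * (2 * s * (h * s)))"
      using s h by (simp add: field_simps power2_eq_square)
    also have "\<dots> \<le> (norm (?U z - u))\<^sup>2 / (2 * (?U z $ i * (h * s)))"
      using den(1) s zq_ge by (intro frac_le power_mono mult_left_mono[OF den(3)]) auto
    finally show ?thesis unfolding cosh_zq by (simp add: mult.assoc)
  qed
  have up: "cosh (dist z q) \<le> B\<^sup>2 / h"
  proof -
    have "(norm (?U z - u))\<^sup>2 / (2 * (?U z $ i * (h * s))) \<le> (B * s)\<^sup>2 / (2 * (s * (h * s)))"
      using den s h zq by (intro frac_le power_mono) auto
    also have "\<dots> = B\<^sup>2 / (2 * h)" using s h by (simp add: field_simps power2_eq_square)
    finally have "cosh (dist z q) \<le> 1 + B\<^sup>2 / (2 * h)" unfolding cosh_zq by (simp add: mult.assoc)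
    moreover have "1 \<le> B\<^sup>2 / (2 * h)"
      using h one_le_power[OF B, of 2] by (simp add: field_simps)
    ultimately show ?thesis using h by (simp add: field_simps)
  qed
  have "cosh (dist x z) * cosh (dist z q) \<le> B\<^sup>2 * (24 + (1 + 4 * B)\<^sup>2) * cosh (dist x q)"
    if x: "x \<in> A" for x
  proof -
    define \<rho> where "\<rho> = norm (?U x - u)"
    define y where "y = ?U x $ i"
    have y: "y > 0" by (simp add: y_def half_space_height_pos)
    have \<rho>: "s / 4 \<le> \<rho>"
    proof (rule ccontr)
      assume "\<not> s / 4 \<le> \<rho>"
      then have comp: "\<bar>?U x $ l - u $ l\<bar> < s / 4" for l
        using component_le_norm_cart[of "?U x - u" l] by (simp add: \<rho>_def)
      have "\<bar>y - h * s\<bar> < s / 4" using comp[of i] by (simp add: uq y_def)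
      then have "y < s" using hs s by linarith
      then have "level i x < level i z" unfolding y_def s_def by (rule level_less)
      moreover have "cube i (level i z - 1) x l = 2 * m l + \<epsilon>" if "l \<noteq> i" for l
      proof -
        have p: "2 powr real_of_int (level i z - 1) = s / 2" by (simp add: s_def powr_diff)
        have "(2 * real_of_int (m l) + \<epsilon>) * (s / 2) \<le> ?U x $ l"
            "?U x $ l < (2 * real_of_int (m l) + \<epsilon> + 1) * (s / 2)"
          using comp[of l] that by (simp_all add: u_def abs_less_iff field_simps)
        then have "\<lfloor>?U x $ l / (s / 2)\<rfloor> = 2 * m l + \<epsilon>"
          using s by (intro floor_unique) (simp_all add: field_simps)
        then show ?thesis using that unfolding cube_def p by simp
      qed
      ultimately have "below i z \<epsilon> x" by (simp add: below_def m_def)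
      then show False using empty[OF x] by simp
    qed
    then have \<rho>0: "\<rho> > 0" using s by linarith
    have cosh_xq: "cosh (dist x q) \<ge> \<rho>\<^sup>2 / (2 * y * (h * s))"
      unfolding cosh_dist_half_space[of x q i] q uq by (simp add: \<rho>_def y_def)
    have "norm (?U x - ?U z) \<le> \<rho> + B * s"
      using zq norm_triangle_ineq4[of "?U x - u" "?U z - u"] by (simp add: \<rho>_def)
    also have "\<dots> \<le> (1 + 4 * B) * \<rho>"
      using mult_left_mono[OF \<rho>, of "4 * B"] B by (simp add: algebra_simps)
    finally have xz: "norm (?U x - ?U z) \<le> (1 + 4 * B) * \<rho>" .
    have "y - h * s \<le> \<rho>"
      using component_le_norm_cart[of "?U x - u" i] by (simp add: \<rho>_def y_def uq)
    then have "y \<le> 3 * \<rho>" using hs \<rho> by linarith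
    then have "y * s \<le> 3 * \<rho> * (4 * \<rho>)" using \<rho> y s \<rho>0 by (intro mult_mono) auto
    then have one: "1 \<le> 12 * \<rho>\<^sup>2 / (y * s)"
      using y s by (simp add: field_simps power2_eq_square)
    have "cosh (dist x z) \<le> 1 + ((1 + 4 * B) * \<rho>)\<^sup>2 / (2 * (y * s))"
    proof -
      have "(norm (?U x - ?U z))\<^sup>2 / (2 * (y * ?U z $ i)) \<le> ((1 + 4 * B) * \<rho>)\<^sup>2 / (2 * (y * s))"
        using xz y s zi by (intro frac_le power_mono) auto
      then show ?thesis
        unfolding cosh_dist_half_space[of x z i] by (simp add: y_def mult.assoc)
    qed
    also have "\<dots> \<le> (24 + (1 + 4 * B)\<^sup>2) * \<rho>\<^sup>2 / (2 * (y * s))"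
    proof -
      have "(24 + (1 + 4 * B)\<^sup>2) * \<rho>\<^sup>2 / (2 * (y * s)) =
          12 * \<rho>\<^sup>2 / (y * s) + ((1 + 4 * B) * \<rho>)\<^sup>2 / (2 * (y * s))"
        by (simp only: power_mult_distrib distrib_right[of 24] add_divide_distrib) simp
      then show ?thesis using one by linarith
    qed
    finally have "cosh (dist x z) * cosh (dist z q) \<le>
        ((24 + (1 + 4 * B)\<^sup>2) * \<rho>\<^sup>2 / (2 * (y * s))) * (B\<^sup>2 / h)"
      using up h y s by (intro mult_mono) auto
    also have "\<dots> = B\<^sup>2 * (24 + (1 + 4 * B)\<^sup>2) * (\<rho>\<^sup>2 / (2 * y * (h * s)))"
      by (simp add: field_simps)
    also have "\<dots> \<le> B\<^sup>2 * (24 + (1 + 4 * B)\<^sup>2) * cosh (dist x q)"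
      by (intro mult_left_mono cosh_xq) simp
    finally show ?thesis .
  qed
  with low show thesis by (rule that)
qed

section \<open>Exposed points\<close>

text \<open>In the direction of \<open>q\<close>, the point \<open>a\<close> sees nothing of \<open>A\<close>: the second condition says that
  the Gromov product of \<open>x\<close> and \<open>q\<close> at \<open>a\<close> is bounded, so that \<open>A\<close> stays in the complement of a
  half-space near \<open>a\<close>, and the first one that a path from \<open>a\<close> to \<open>q\<close> moves away from \<open>A\<close>
  from its start.\<close>

definition exposed :: "real \<Rightarrow> real \<Rightarrow> 'a::metric_space set \<Rightarrow> 'a \<Rightarrow> bool" where
  "exposed C L A a \<longleftrightarrow> (\<exists>q. L \<le> cosh (dist a q) \<and>
     (\<forall>x\<in>A. dist a q \<le> dist x q \<and> cosh (dist x a) * cosh (dist a q) \<le> C * cosh (dist x q)))"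

text \<open>The point \<open>z\<close> itself may be enclosed by nearby points of \<open>A\<close>, but the point of \<open>A\<close> nearest to
  \<open>q\<close> is not, and it lies within bounded distance of \<open>z\<close>.\<close>

lemma exposed_near:
  fixes z q :: "'d::finite hyperbolic"
  assumes A: "finite A" "z \<in> A" and L: "2 * C * L \<le> cosh (dist z q)"
    and q: "\<And>x. x \<in> A \<Longrightarrow> cosh (dist x z) * cosh (dist z q) \<le> C * cosh (dist x q)"
  shows "\<exists>a\<in>A. cosh (dist a z) \<le> C \<and> exposed (2 * C\<^sup>2) L A a"
proof -
  obtain a where a: "a \<in> A" "\<And>x. x \<in> A \<Longrightarrow> dist a q \<le> dist x q"
    using A arg_min_if_finite(1)[of A "\<lambda>x. dist x q"] arg_min_least[of A _ "\<lambda>x. dist x q"]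
    by (metis empty_iff)
  have pos: "cosh (dist x y) > 0" for x y :: "'d hyperbolic" by (rule cosh_real_pos)
  have az: "cosh (dist a q) \<le> cosh (dist z q)"
    using a(2)[OF A(2)] by (simp add: cosh_real_nonneg_le_iff)
  have C: "C \<ge> 1" using q[OF A(2)] pos[of z q] by simp
  have "cosh (dist a z) * cosh (dist z q) \<le> C * cosh (dist a q)" by (rule q[OF a(1)])
  also have "\<dots> \<le> C * cosh (dist z q)" using az C by (intro mult_left_mono) auto
  finally have near: "cosh (dist a z) \<le> C" using pos[of z q] by simp
  have "cosh (dist z q) \<le> 2 * cosh (dist z a) * cosh (dist a q)" by (rule cosh_dist_triangle)
  also have "\<dots> \<le> 2 * C * cosh (dist a q)"
    using near pos[of a q] by (simp add: dist_commute)
  finally have far: "L \<le> cosh (dist a q)" using L C by (meson mult_le_cancel_left_pos order_trans less_le_trans mult_pos_pos zero_less_numeral zero_less_one)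
  have "cosh (dist x a) * cosh (dist a q) \<le> 2 * C\<^sup>2 * cosh (dist x q)" if "x \<in> A" for x
  proof -
    have "cosh (dist x a) \<le> 2 * cosh (dist x z) * cosh (dist z a)" by (rule cosh_dist_triangle)
    also have "\<dots> \<le> 2 * cosh (dist x z) * C"
      using near by (intro mult_left_mono) (auto simp: dist_commute)
    finally have "cosh (dist x a) * cosh (dist a q) \<le> (2 * cosh (dist x z) * C) * cosh (dist z q)"
      using az C by (intro mult_mono) auto
    also have "\<dots> = 2 * C * (cosh (dist x z) * cosh (dist z q))" by simp
    also have "\<dots> \<le> 2 * C * (C * cosh (dist x q))"
      using q[OF that] C by (intro mult_left_mono) auto
    finally show ?thesis by (simp add: power2_eq_square)
  qed
  then have "exposed (2 * C\<^sup>2) L A a" unfolding exposed_def using far a(2) by blast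
  then show ?thesis using a(1) near by blast
qed

lemma card_le_fibers:
  assumes "finite A" and "f ` A \<subseteq> B" and "finite B"
    and "\<And>b. b \<in> B \<Longrightarrow> card {a \<in> A. f a = b} \<le> N"
  shows "card A \<le> N * card B"
proof -
  have "A = (\<Union>b\<in>B. {a \<in> A. f a = b})" using assms(2) by auto
  then have "card A \<le> (\<Sum>b\<in>B. card {a \<in> A. f a = b})"
    using card_UN_le[OF assms(3), of "\<lambda>b. {a \<in> A. f a = b}"] by simp
  also have "\<dots> \<le> card B * N" using sum_bounded_above[OF assms(4)] by simp
  finally show ?thesis by (simp add: mult.commute)
qed

text \<open>At least half of the occupied cells are not bad, and each of these has an exposed point within
  bounded distance. Packing bounds the number of points in a cell and the number of cells that
  lead to the same exposed point. The constants do not depend on the depth \<open>L\<close>.\<close>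

lemma many_exposed:
  assumes d: "CARD('d::finite) \<ge> 2" and c: "c > 0"
  obtains C :: real and N :: nat where "C > 0" "N > 0"
    "\<And>L (A :: 'd hyperbolic set). finite A \<Longrightarrow> separated c A \<Longrightarrow>
       card A \<le> N * card {a \<in> A. exposed C L A a}"
proof -
  obtain i l :: 'd where il: "l \<noteq> i"
    using d by (metis card_le_Suc0_iff_eq finite_class.finite_UNIV UNIV_I not_less_eq_eq numeral_2_eq_2)
  define B where "B = real CARD('d) + 1"
  define C where "C = B\<^sup>2 * (24 + (1 + 4 * B)\<^sup>2)"
  have B: "B \<ge> 1" by (simp add: B_def)
  have C: "C \<ge> 1"
    using mult_mono[OF one_le_power[OF B, of 2], of 1 "24 + (1 + 4 * B)\<^sup>2"] by (simp add: C_def)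
  have dist_le: "dist p q \<le> arcosh r" if "cosh (dist p q) \<le> r" for p q :: "'d hyperbolic" and r
  proof (rule ccontr)
    have r: "1 \<le> r" using that cosh_real_ge_1[of "dist p q"] by linarith
    assume "\<not> dist p q \<le> arcosh r"
    then have "cosh (arcosh r) < cosh (dist p q)"
      using r cosh_real_nonneg_less_iff[of "arcosh r" "dist p q"] by auto
    then show False using that r by simp
  qed
  obtain N\<^sub>1 where N1: "N\<^sub>1 > 0" "\<And>(p :: 'd hyperbolic) A. A \<subseteq> cball p (arcosh (1 + B\<^sup>2 / 2)) \<Longrightarrow>
      separated c A \<Longrightarrow> finite A \<and> card A \<le> N\<^sub>1"
    using packing_bound[OF c] by metis
  obtain N\<^sub>2 where N2: "N\<^sub>2 > 0" "\<And>(p :: 'd hyperbolic) A. A \<subseteq> cball p (arcosh C) \<Longrightarrow>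
      separated c A \<Longrightarrow> finite A \<and> card A \<le> N\<^sub>2"
    using packing_bound[OF c] by metis
  show thesis
  proof (rule that[of "2 * C\<^sup>2" "N\<^sub>1 * (2 * N\<^sub>2)"])
    fix L and A :: "'d hyperbolic set" assume A: "finite A" and sep: "separated c A"
    define E where "E = {a \<in> A. exposed (2 * C\<^sup>2) L A a}"
    have sub: "separated c S" if "S \<subseteq> A" for S using sep that by (auto simp: separated_def)
    obtain A' where A': "A' \<subseteq> A" "inj_on (cell i) A'" "cell i ` A = cell i ` A'"
      using subset_image_inj[of "cell i ` A" "cell i" A] by blast
    have fin': "finite A'" using A A'(1) by (rule rev_finite_subset)
    have "card A \<le> N\<^sub>1 * card (cell i ` A)"
    proof (rule card_le_fibers[OF A])
      fix b assume "b \<in> cell i ` A"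
      then obtain p where p: "p \<in> A" "b = cell i p" by auto
      have "{a \<in> A. cell i a = b} \<subseteq> cball p (arcosh (1 + B\<^sup>2 / 2))"
        using dist_same_cell[of i p] by (auto simp: p B_def intro!: dist_le)
      then show "card {a \<in> A. cell i a = b} \<le> N\<^sub>1" using N1(2) sub[of "{a \<in> A. cell i a = b}"] by blast
    qed (use A in auto)
    also have "card (cell i ` A) = card A'" by (simp add: A'(2,3) card_image)
    finally have 1: "card A \<le> N\<^sub>1 * card A'" .
    define Bad where "Bad = {z \<in> A'. \<forall>\<epsilon>\<in>{0, 1}. \<exists>x\<in>A'. below i z \<epsilon> x}"
    have "2 * card Bad \<le> card A'"
      unfolding Bad_def by (rule card_bad_cells[OF fin' A'(2) il])
    moreover have "card (A' - Bad) = card A' - card Bad"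
      using fin' by (intro card_Diff_subset) (auto simp: Bad_def)
    ultimately have 2: "card A' \<le> 2 * card (A' - Bad)" by simp
    have "\<exists>a\<in>A. cosh (dist a z) \<le> C \<and> exposed (2 * C\<^sup>2) L A a" if z: "z \<in> A' - Bad" for z
    proof -
      obtain \<epsilon> where \<epsilon>: "\<epsilon> \<in> {0, 1}" "\<And>x. x \<in> A' \<Longrightarrow> \<not> below i z \<epsilon> x"
        using z by (auto simp: Bad_def)
      have empty: "\<not> below i z \<epsilon> x" if "x \<in> A" for x
      proof -
        have "cell i x \<in> cell i ` A'" using that A'(3) by auto
        then obtain x' where "x' \<in> A'" "cell i x = cell i x'" by auto
        then show ?thesis using \<epsilon>(2) below_cong[of i z z x x'] by auto
      qed
      define h where "h = min (1 / 2) (1 / (16 * (1 + \<bar>2 * C * L\<bar>)))"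
      have h: "0 < h" "h \<le> 1 / 2" by (auto simp: h_def)
      have "h \<le> 1 / (16 * (1 + \<bar>2 * C * L\<bar>))" by (simp add: h_def)
      then have "1 + \<bar>2 * C * L\<bar> \<le> 1 / (16 * h)" using h(1) by (simp add: field_simps)
      then have hL: "2 * C * L \<le> 1 / (16 * h)" by linarith
      obtain q where q: "1 / (16 * h) \<le> cosh (dist z q)"
        "\<And>x. x \<in> A \<Longrightarrow> cosh (dist x z) * cosh (dist z q) \<le> C * cosh (dist x q)"
        using empty_child_shadow[OF empty \<epsilon>(1) h] unfolding C_def B_def by metis
      show ?thesis
        using A'(1) z hL q by (intro exposed_near[OF A]) auto
    qed
    then obtain near where near: "\<And>z. z \<in> A' - Bad \<Longrightarrow> near z \<in> E \<and> cosh (dist (near z) z) \<le> C"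
      unfolding E_def by (metis (mono_tags, lifting) mem_Collect_eq)
    have "card (A' - Bad) \<le> N\<^sub>2 * card E"
    proof (rule card_le_fibers)
      show "finite (A' - Bad)" "finite E" using fin' A by (auto simp: E_def)
      show "near ` (A' - Bad) \<subseteq> E" using near by auto
      fix a assume "a \<in> E"
      have "{z \<in> A' - Bad. near z = a} \<subseteq> cball a (arcosh C)"
        using near by (auto intro!: dist_le)
      then show "card {z \<in> A' - Bad. near z = a} \<le> N\<^sub>2"
        using N2(2) sub[of "{z \<in> A' - Bad. near z = a}"] A'(1) by blast
    qed
    then have "card A' \<le> 2 * (N\<^sub>2 * card E)" using 2 by linarith
    then have "N\<^sub>1 * card A' \<le> N\<^sub>1 * (2 * (N\<^sub>2 * card E))" by (rule mult_le_mono2)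
    with 1 have "card A \<le> N\<^sub>1 * (2 * (N\<^sub>2 * card E))" by (rule order_trans)
    then show "card A \<le> N\<^sub>1 * (2 * N\<^sub>2) * card {a \<in> A. exposed (2 * C\<^sup>2) L A a}"
      by (simp only: mult.assoc E_def)
  qed (use C N1(1) N2(1) in auto)
qed

section \<open>Half-turns\<close>

text \<open>The half-turn about the midpoint \<open>m\<close> of \<open>a\<close> and \<open>b\<close>: \<open>m\<close> is the normalisation of \<open>a + b\<close> in the
  ambient Lorentz space, and the half-turn is \<open>x \<mapsto> 2 \<langle>x, m\<rangle> m - x\<close>.\<close>

definition half_turn :: "'d::finite hyperbolic \<Rightarrow> 'd hyperbolic \<Rightarrow> 'd hyperbolic \<Rightarrow> 'd hyperbolic" where
  "half_turn a b x = Abs_hyperbolic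
     ((lorentz (coords x) (coords a + coords b) / (1 + lorentz (coords a) (coords b))) *\<^sub>R
        (coords a + coords b) - coords x)"

lemma coords_half_turn:
  "coords (half_turn a b x) =
     (lorentz (coords x) (coords a + coords b) / (1 + lorentz (coords a) (coords b))) *\<^sub>R
        (coords a + coords b) - coords x" (is "_ = ?w")
proof -
  define s r where "s = lorentz (coords x) (coords a + coords b)"
    and "r = s / (1 + lorentz (coords a) (coords b))"
  have ab: "1 + lorentz (coords a) (coords b) > 0" using lorentz_ge_1[of a b] by simp
  have w: "?w = r *\<^sub>R (coords a + coords b) - coords x" by (simp add: r_def s_def)
  have rs: "r * (1 + lorentz (coords a) (coords b)) = s" using ab by (simp add: r_def)
  have self: "lorentz (coords a + coords b) (coords a + coords b) = 2 * (1 + lorentz (coords a) (coords b))"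
    by (simp add: lorentz_algebra lorentz_commute[of "coords b" "coords a"])
  have wab: "lorentz ?w (coords a + coords b) = s"
  proof -
    have "lorentz ?w (coords a + coords b) =
        r * lorentz (coords a + coords b) (coords a + coords b) - s"
      by (simp only: w lorentz_algebra(3,5) s_def)
    also have "\<dots> = 2 * (r * (1 + lorentz (coords a) (coords b))) - s" by (simp only: self mult_ac)
    finally show ?thesis unfolding rs by simp
  qed
  have "lorentz ?w ?w = r * s - lorentz ?w (coords x)"
    by (subst (2) w) (simp only: lorentz_algebra(4,6) wab)
  also have "lorentz ?w (coords x) = r * s - 1"
    by (simp only: w lorentz_algebra(3,5) s_def lorentz_commute[of "coords a + coords b" "coords x"]
        lorentz_self)
  finally have ww: "lorentz ?w ?w = 1" by simp
  have "fst ?w > 0"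
  proof (rule ccontr)
    assume neg: "\<not> fst ?w > 0"
    have "(fst ?w)\<^sup>2 = 1 + snd ?w \<bullet> snd ?w"
      using ww by (simp add: lorentz_def power2_eq_square)
    then have "0 < (fst ?w)\<^sup>2" using inner_ge_zero[of "snd ?w"] by linarith
    then have "fst ?w \<noteq> 0" unfolding zero_less_power2 .
    then have "fst (- ?w) > 0" using neg by simp
    moreover have neg_lorentz: "lorentz (- u) v = - lorentz u v" "lorentz u (- v) = - lorentz u v"
      for u v :: "real \<times> (real^'a)"
      by (simp_all add: lorentz_def)
    then have "lorentz (- ?w) (- ?w) = 1" using ww by (simp only: minus_minus)
    ultimately obtain p where p: "coords p = - ?w"
      using Abs_hyperbolic_inverse[of "- ?w"] by auto
    have "- s = lorentz (coords p) (coords a) + lorentz (coords p) (coords b)"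
      unfolding wab[symmetric] lorentz_algebra(2)[symmetric] p by (simp only: neg_lorentz)
    moreover have "s > 0" unfolding s_def lorentz_algebra using lorentz_pos[of x a] lorentz_pos[of x b] by simp
    ultimately show False using lorentz_pos[of p a] lorentz_pos[of p b] by simp
  qed
  with ww show ?thesis unfolding half_turn_def by (intro Abs_hyperbolic_inverse) simp
qed

lemma cosh_dist_half_turn:
  "cosh (dist x (half_turn a b y)) =
     (cosh (dist x a) + cosh (dist x b)) * (cosh (dist y a) + cosh (dist y b)) / (1 + cosh (dist a b))
     - cosh (dist x y)"
  unfolding cosh_dist coords_half_turn by (simp add: lorentz_algebra)

lemma half_turn_left [simp]: "half_turn a b a = b"
proof -
  have "1 + lorentz (coords a) (coords b) > 0" using lorentz_ge_1[of a b] by simp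
  then have "coords (half_turn a b a) = coords b"
    by (simp add: coords_half_turn lorentz_algebra)
  then show ?thesis by (simp add: coords_inject)
qed

lemma cosh_dist_half_turn_sum:
  "cosh (dist (half_turn a b x) a) + cosh (dist (half_turn a b x) b) = cosh (dist x a) + cosh (dist x b)"
proof -
  have nz: "1 + cosh (dist a b) \<noteq> 0" using cosh_real_ge_1[of "dist a b"] by linarith
  have "cosh (dist a (half_turn a b x)) = cosh (dist x b)"
    unfolding cosh_dist_half_turn[of a] using nz by (simp add: dist_commute)
  moreover have "cosh (dist b (half_turn a b x)) = cosh (dist x a)"
    unfolding cosh_dist_half_turn[of b] using nz by (simp add: dist_commute add.commute)
  ultimately show ?thesis by (simp add: dist_commute)
qed

lemma half_turn_half_turn [simp]: "half_turn a b (half_turn a b x) = x"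
proof -
  define r where "r = (cosh (dist x a) + cosh (dist x b)) / (1 + cosh (dist a b))"
  have "coords (half_turn a b (half_turn a b x)) = r *\<^sub>R (coords a + coords b) - coords (half_turn a b x)"
    unfolding coords_half_turn[of a b "half_turn a b x"] r_def
    using cosh_dist_half_turn_sum[of a b x] by (simp add: cosh_dist lorentz_algebra)
  also have "\<dots> = coords x"
    unfolding coords_half_turn[of a b x] r_def by (simp add: cosh_dist lorentz_algebra)
  finally show ?thesis by (simp add: coords_inject)
qed

lemma dist_half_turn [simp]: "dist (half_turn a b x) (half_turn a b y) = dist x y"
proof -
  have "cosh (dist (half_turn a b x) (half_turn a b y)) = cosh (dist x y)"
    unfolding cosh_dist_half_turn[of "half_turn a b x"] cosh_dist_half_turn_sum
      dist_commute[of "half_turn a b x" y] cosh_dist_half_turn[of y]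
    by (simp add: dist_commute)
  then show ?thesis by (metis cosh_dist dist_hyperbolic_def)
qed

lemma dist_half_turn_swap: "dist (half_turn a b x) y = dist x (half_turn a b y)"
  using dist_half_turn[of a b x "half_turn a b y"] by simp

section \<open>Surgery at an exposed vertex\<close>

text \<open>The half-turn exchanges \<open>x j\<close> and \<open>y k\<close>, so for \<open>y 0 = x j\<close> the inserted path joins the first
  part of \<open>x\<close> to its turned tail.\<close>

definition surgery ::
    "nat \<Rightarrow> nat \<Rightarrow> (nat \<Rightarrow> 'd::finite hyperbolic) \<Rightarrow> (nat \<Rightarrow> 'd hyperbolic) \<Rightarrow> nat \<Rightarrow> 'd hyperbolic" where
  "surgery j k x y i = (if i < j then x i else if i < j + k then y (i - j)
     else half_turn (x j) (y k) (x (i - k)))"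

text \<open>A metric form of the statement that a wide strip between two disjoint half-spaces separates the
  vertices up to \<open>j\<close> from those after \<open>j + k\<close>.\<close>

definition cut :: "nat \<Rightarrow> nat \<Rightarrow> nat \<Rightarrow> (nat \<Rightarrow> 'a::metric_space) \<Rightarrow> bool" where
  "cut k n j x \<longleftrightarrow> j + k \<le> n \<and>
     (\<forall>u\<in>{..j}. \<forall>v\<in>{j + k..n}. dist (x u) (x j) + dist (x (j + k)) (x v) + 1 \<le> dist (x u) (x v))"

definition approach :: "real \<Rightarrow> nat \<Rightarrow> 'a::metric_space \<Rightarrow> (nat \<Rightarrow> 'a) \<Rightarrow> bool" where
  "approach t k q y \<longleftrightarrow>
     (\<forall>i<k. dist (y i) (y (Suc i)) \<le> 1 \<and> dist (y (Suc i)) q \<le> dist (y i) q - 1 + t)"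

lemma approach_dist:
  assumes "approach t k q y" and "i \<le> i'" and "i' \<le> k"
  shows "dist (y i) (y i') \<le> real (i' - i)" "dist (y i') q \<le> dist (y i) q - real (i' - i) * (1 - t)"
proof -
  have "dist (y i) (y i') \<le> real (i' - i) \<and> dist (y i') q \<le> dist (y i) q - real (i' - i) * (1 - t)"
    using assms(2,3)
  proof (induction i' rule: dec_induct)
    case (step m)
    have "dist (y m) (y (Suc m)) \<le> 1" "dist (y (Suc m)) q \<le> dist (y m) q - 1 + t"
      using assms(1) step by (auto simp: approach_def)
    then show ?case
      using step dist_triangle[of "y i" "y (Suc m)" "y m"] by (simp add: Suc_diff_le algebra_simps)
  qed auto
  then show "dist (y i) (y i') \<le> real (i' - i)" "dist (y i') q \<le> dist (y i) q - real (i' - i) * (1 - t)"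
    by auto
qed

lemma approach_separates:
  assumes y: "approach t k q y" and t: "t \<ge> 0" "real k * t < 1 - c" and i: "i < i'" "i' \<le> k"
  shows "dist (y i) (y i') > c"
proof -
  have "dist (y i) q \<le> dist (y i) (y i') + dist (y i') q" by (rule dist_triangle)
  then have "dist (y i) (y i') \<ge> real (i' - i) * (1 - t)"
    using approach_dist(2)[OF y, of i i'] i by linarith
  moreover have "real (i' - i) * t \<le> real k * t"
    using t(1) i by (intro mult_right_mono) auto
  moreover have "1 \<le> real (i' - i)" using i by simp
  ultimately show ?thesis using t(2) by (simp add: algebra_simps)
qed

lemma cosh_add_1_le:
  fixes s :: real
  shows "cosh (s + 1) \<le> 3 * cosh s"
proof -
  have "sinh s * sinh 1 \<le> cosh s * sinh 1"
    using sinh_le_cosh_real by (intro mult_right_mono) auto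
  then have "cosh (s + 1) \<le> cosh s * (cosh 1 + sinh 1)" by (simp add: cosh_add algebra_simps)
  also have "\<dots> \<le> cosh s * 3"
    using exp_le by (intro mult_left_mono) (auto simp: cosh_plus_sinh)
  finally show ?thesis by (simp add: mult.commute)
qed

text \<open>Both points are much farther from \<open>b\<close> than from \<open>a\<close>, so they lie in a half-space on the side
  of \<open>a\<close>, far from the midpoint of \<open>a\<close> and \<open>b\<close>. The half-turn moves \<open>x'\<close> to the opposite
  half-space on the side of \<open>b\<close>.\<close>

lemma half_turn_far:
  fixes a b x x' :: "'d::finite hyperbolic"
  assumes x: "P * cosh (dist x a) \<le> cosh (dist x b)" and x': "P * cosh (dist x' a) \<le> cosh (dist x' b)"
    and P: "0 \<le> P" "8 * (1 + cosh (dist a b)) \<le> P\<^sup>2"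
  shows "dist x a + dist x' a + 1 \<le> dist x (half_turn a b x')"
proof -
  let ?X = "cosh (dist x a)" and ?X' = "cosh (dist x' a)" and ?D = "1 + cosh (dist a b)"
  have D: "?D > 0" using cosh_real_ge_1[of "dist a b"] by linarith
  have "8 * (?X * ?X') \<le> (P * ?X) * (P * ?X') / ?D"
    using mult_right_mono[OF P(2), of "?X * ?X'"] D by (simp add: field_simps power2_eq_square)
  also have "\<dots> \<le> (?X + cosh (dist x b)) * (?X' + cosh (dist x' b)) / ?D"
    using D x x' P(1) by (intro divide_right_mono mult_mono) (auto intro: add_increasing)
  finally have "8 * (?X * ?X') - cosh (dist x x') \<le> cosh (dist x (half_turn a b x'))"
    unfolding cosh_dist_half_turn by simp
  moreover have "cosh (dist x x') \<le> 2 * (?X * ?X')"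
    using cosh_dist_triangle[of x x' a] by (simp add: dist_commute mult.assoc)
  moreover have "cosh (dist x a + dist x' a) \<le> 2 * (?X * ?X')"
    using mult_mono[of "sinh (dist x a)" ?X "sinh (dist x' a)" ?X']
    by (simp add: cosh_add sinh_le_cosh_real)
  moreover have "cosh (dist x a + dist x' a + 1) \<le> 3 * cosh (dist x a + dist x' a)"
    by (rule cosh_add_1_le)
  ultimately have "cosh (dist x a + dist x' a + 1) \<le> cosh (dist x (half_turn a b x'))" by linarith
  then show ?thesis by (simp add: cosh_real_nonneg_le_iff)
qed

text \<open>The inserted path approaches \<open>q\<close> at almost unit speed, so it leaves the walk, whose
  vertices are not nearer to \<open>q\<close> than \<open>x j\<close>. By the time it has made \<open>k\<close> steps it is deep in the
  half-space that the walk avoids, and the half-turn puts the tail of the walk into that half-space.\<close>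

lemma surgery_self_avoiding_cut:
  fixes x y :: "nat \<Rightarrow> 'd::finite hyperbolic"
  assumes sa: "\<And>i i'. i < i' \<Longrightarrow> i' \<le> n \<Longrightarrow> c < dist (x i) (x i')" and c: "c < 1" and j: "j \<le> n"
    and q: "\<And>i. i \<le> n \<Longrightarrow> dist (x j) q \<le> dist (x i) q"
      "\<And>i. i \<le> n \<Longrightarrow> cosh (dist (x i) (x j)) * cosh (dist (x j) q) \<le> C * cosh (dist (x i) q)"
    and y: "y 0 = x j" "approach t k q y"
    and t: "t \<ge> 0" "real k * t < 1 - c" "real k * t \<le> 1" and C: "C > 0"
    and k: "8 * (1 + cosh (real k)) \<le> (exp (real k - 1) / (4 * C))\<^sup>2"
  shows "i < i' \<Longrightarrow> i' \<le> n + k \<Longrightarrow> c < dist (surgery j k x y i) (surgery j k x y i')"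
    and "cut k (n + k) j (surgery j k x y)"
proof -
  define a b D P where "a = x j" and "b = y k" and "D = dist (x j) q" and "P = exp (real k - 1) / (4 * C)"
  let ?s = "surgery j k x y" and ?\<sigma> = "half_turn a b"
  \<comment> \<open>For \<open>k = 0\<close> the assumption on \<open>k\<close> would force \<open>C < 1\<close>, whereas \<open>C \<ge> 1\<close> by the case \<open>i = j\<close> of the
    assumption on \<open>q\<close>.\<close>
  have k0: "k > 0"
  proof (rule ccontr)
    assume "\<not> k > 0"
    with k have "16 \<le> (exp (- 1) / (4 * C))\<^sup>2" by simp
    moreover have "cosh (dist (x j) (x j)) * cosh (dist (x j) q) \<le> C * cosh (dist (x j) q)"
      by (rule q(2)[OF j])
    then have "1 \<le> C" by simp
    then have "exp (- 1) / (4 * C) \<le> 1" by (simp add: field_simps) (smt (verit) exp_le_one_iff)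
    then have "(exp (- 1) / (4 * C))\<^sup>2 \<le> 1" using C by (intro power_le_one) auto
    ultimately show False by linarith
  qed
  have yq: "dist (y i) q \<le> D - real i + real k * t" if "i \<le> k" for i
  proof -
    have "real i * t \<le> real k * t" using that t(1) by (intro mult_right_mono) auto
    then show ?thesis using approach_dist(2)[OF y(2), of 0 i] that by (simp add: y(1) D_def algebra_simps)
  qed
  have ya: "dist a (y i) \<le> real i" if "i \<le> k" for i
    using approach_dist(1)[OF y(2), of 0 i] that by (simp add: y(1) a_def)
  have far: "P * cosh (dist (x i) a) \<le> cosh (dist (x i) b)" if "i \<le> n" for i
  proof -
    have "cosh (dist (x i) q) \<le> 2 * cosh (dist (x i) b) * cosh (dist b q)" by (rule cosh_dist_triangle)
    also have "cosh (dist b q) \<le> 2 * cosh D * exp (1 - real k)"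
    proof -
      have "cosh (dist b q) \<le> exp (dist b q)"
        by (metis cosh_plus_sinh le_add_same_cancel1 sinh_real_nonneg_iff zero_le_dist)
      also have "\<dots> \<le> exp (D + (1 - real k))" using yq[of k] t(3) by (simp add: b_def)
      also have "\<dots> = exp D * exp (1 - real k)" by (rule exp_add)
      also have "\<dots> \<le> 2 * cosh D * exp (1 - real k)"
        by (intro mult_right_mono) (simp_all add: cosh_field_def)
      finally show ?thesis .
    qed
    finally have "cosh (dist (x i) q) \<le> 4 * exp (1 - real k) * cosh (dist (x i) b) * cosh D"
      by (simp add: mult_ac)
    then have "C * cosh (dist (x i) q) \<le> C * (4 * exp (1 - real k) * cosh (dist (x i) b) * cosh D)"
      using C by simp
    with q(2)[OF that] have "cosh (dist (x i) a) * cosh D \<le>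
        C * (4 * exp (1 - real k) * cosh (dist (x i) b) * cosh D)"
      unfolding a_def D_def by (rule order_trans)
    also have "\<dots> = (4 * C * exp (1 - real k) * cosh (dist (x i) b)) * cosh D" by (simp only: mult_ac)
    finally have "cosh (dist (x i) a) \<le> 4 * C * exp (1 - real k) * cosh (dist (x i) b)"
      by (rule mult_right_le_imp_le) simp
    then have "P * cosh (dist (x i) a) \<le> P * (4 * C * exp (1 - real k) * cosh (dist (x i) b))"
      using C by (intro mult_left_mono) (auto simp: P_def)
    also have "\<dots> = exp (real k - 1) * exp (1 - real k) * cosh (dist (x i) b)"
      using C by (simp add: P_def)
    also have "\<dots> = cosh (dist (x i) b)" by (simp flip: exp_add)
    finally show ?thesis .
  qed
  have P: "0 \<le> P" "8 * (1 + cosh (dist a b)) \<le> P\<^sup>2"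
  proof -
    have "cosh (dist a b) \<le> cosh (real k)"
      using ya[of k] by (simp add: b_def cosh_real_nonneg_le_iff)
    then show "8 * (1 + cosh (dist a b)) \<le> P\<^sup>2" using k by (simp add: P_def)
  qed (use C in \<open>simp add: P_def\<close>)
  have apart: "dist (x i) a + dist (x i') a + 1 \<le> dist (x i) (?\<sigma> (x i'))" if "i \<le> n" "i' \<le> n" for i i'
    using that by (intro half_turn_far[OF far far P]) auto
  have old_new: "c < dist (x i) (y l)" if "i \<le> n" "0 < l" "l \<le> k" for i l
  proof -
    have "D \<le> dist (x i) (y l) + dist (y l) q"
      using q(1)[OF that(1)] dist_triangle[of "x i" q "y l"] by (simp add: D_def)
    then show ?thesis using yq[OF that(3)] that(2) t(2) by simp
  qed
  have new_turned: "c < dist (y l) (?\<sigma> (x i))" if "i \<le> n" "l < k" for i l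
  proof -
    \<comment> \<open>Undo the half-turn: the image of \<open>y l\<close> is within \<open>l\<close> of \<open>b\<close>, hence closer to \<open>q\<close> than \<open>x i\<close>.\<close>
    have "dist (?\<sigma> (y l)) b = dist (y l) a"
      by (metis dist_half_turn half_turn_left)
    then have "dist (?\<sigma> (y l)) q \<le> real l + (D - real k + real k * t)"
      using dist_triangle[of "?\<sigma> (y l)" q b] ya[of l] yq[of k] that(2) by (simp add: b_def dist_commute)
    moreover have "D \<le> dist (x i) (?\<sigma> (y l)) + dist (?\<sigma> (y l)) q"
      using q(1)[OF that(1)] dist_triangle[of "x i" q "?\<sigma> (y l)"] by (simp add: D_def)
    moreover have "dist (x i) (?\<sigma> (y l)) = dist (y l) (?\<sigma> (x i))"
      by (metis dist_commute dist_half_turn_swap)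
    ultimately show ?thesis using that(2) t(2) by simp
  qed
  have s1: "?s i = x i" if "i \<le> j" for i
    using that k0 y(1) by (cases "i = j") (auto simp: surgery_def)
  have s2: "?s (j + l) = y l" if "l < k" for l using that by (simp add: surgery_def)
  have s3: "?s (i + k) = ?\<sigma> (x i)" if "j \<le> i" for i
    using that by (simp add: surgery_def a_def b_def)
  show "cut k (n + k) j ?s"
    unfolding cut_def
  proof (intro conjI ballI)
    fix u v assume u: "u \<in> {..j}" and v: "v \<in> {j + k..n + k}"
    then obtain i where i: "v = i + k" "j \<le> i" "i \<le> n" by (auto simp: le_iff_add)
    have "dist (?s (j + k)) (?s v) = dist (x i) a"
      using s3[of j] s3[OF i(2)] by (simp add: i(1) a_def[symmetric] dist_commute) (metis dist_half_turn half_turn_left dist_commute)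
    then show "dist (?s u) (?s j) + dist (?s (j + k)) (?s v) + 1 \<le> dist (?s u) (?s v)"
      using apart[of u i] u i j s1[of u] s1[of j] s3[OF i(2)] by (simp add: a_def)
  qed (use j in simp)
  assume ii: "i < i'" "i' \<le> n + k"
  consider "i' < j + k" "i' \<le> j" | l where "i' = j + l" "0 < l" "l < k" "i \<le> j"
    | l l' where "i = j + l" "i' = j + l'" "l < l'" "l' < k"
    | m where "i' = m + k" "j \<le> m" "m \<le> n" "i \<le> j"
    | l m where "i = j + l" "l < k" "i' = m + k" "j \<le> m" "m \<le> n"
    | m m' where "i = m + k" "i' = m' + k" "j \<le> m" "m < m'" "m' \<le> n"
  proof -
    have "i' \<le> j \<or> (j < i' \<and> i' < j + k) \<or> j + k \<le> i'" by linarith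
    moreover have "i \<le> j \<or> (j < i \<and> i < j + k) \<or> j + k \<le> i" by linarith
    moreover have "\<exists>m. u = m + k \<and> j \<le> m" if "j + k \<le> u" for u
      using that by (intro exI[of _ "u - k"]) auto
    moreover have "\<exists>l. u = j + l \<and> 0 < l \<and> l < k" if "j < u" "u < j + k" for u
      using that by (intro exI[of _ "u - j"]) auto
    ultimately show thesis using ii k0 that by (smt (verit) add_le_cancel_right add_less_cancel_left add_less_cancel_right le_add1 less_le_trans not_less nat_less_le)
  qed
  then show "c < dist (?s i) (?s i')"
  proof cases
    case 1
    then show ?thesis using sa[of i i'] ii j s1 by simp
  next
    case (2 l)
    then show ?thesis using old_new[of i l] j s1[of i] s2[of l] by simp
  next
    case (3 l l')
    then show ?thesis
      using approach_separates[OF y(2) t(1,2), of l l'] s2[of l] s2[of l'] by simp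
  next
    case (4 m)
    then have "dist (x i) a + dist (x m) a + 1 \<le> dist (x i) (?\<sigma> (x m))"
      using apart[of i m] j by simp
    then have "c < dist (x i) (?\<sigma> (x m))"
      using c zero_le_dist[of "x i" a] zero_le_dist[of "x m" a] by linarith
    then show ?thesis using 4 s1[of i] s3[of m] by simp
  next
    case (5 l m)
    then show ?thesis using new_turned[of m l] s2[of l] s3[of m] by simp
  next
    case (6 m m')
    then show ?thesis using sa[of m m'] s3[of m] s3[of m'] by simp
  qed
qed

text \<open>Each cut contributes 1 to the distance of the end points, and at most \<open>k\<close> cuts overlap.\<close>

lemma card_cuts_le_dist:
  assumes k: "k > 0" and s: "s \<le> n"
  shows "real (card {j. s \<le> j \<and> cut k n j x}) \<le> real k * dist (x s) (x n)"
  using s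
proof (induction "n - s" arbitrary: s rule: less_induct)
  case less
  define K where "K s = {j. s \<le> j \<and> cut k n j x}" for s
  have fin: "finite (K s)" for s by (rule finite_subset[of _ "{..n}"]) (auto simp: K_def cut_def)
  show ?case
  proof (cases "K s = {}")
    case True
    then have "{j. s \<le> j \<and> cut k n j x} = {}" by (simp only: K_def)
    then have "card {j. s \<le> j \<and> cut k n j x} = 0" by (simp only: card.empty)
    then show ?thesis by simp
  next
    case False
    define j where "j = Min (K s)"
    have j: "j \<in> K s" "\<And>l. l \<in> K s \<Longrightarrow> j \<le> l" using fin False by (auto simp: j_def)
    then have cut: "s \<le> j" "j + k \<le> n"
        "dist (x s) (x j) + dist (x (j + k)) (x n) + 1 \<le> dist (x s) (x n)"
      by (auto simp: K_def cut_def)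
    have "K s \<subseteq> {j..<j + k} \<union> K (j + k)" using j(2) by (auto simp: K_def not_less)
    then have "card (K s) \<le> card ({j..<j + k} \<union> K (j + k))" using fin by (intro card_mono) auto
    also have "\<dots> \<le> k + card (K (j + k))" using card_Un_le[of "{j..<j + k}" "K (j + k)"] by simp
    finally have "real (card (K s)) \<le> real k + real (card (K (j + k)))" by simp
    also have "real (card (K (j + k))) \<le> real k * dist (x (j + k)) (x n)"
      unfolding K_def using cut k by (intro less.hyps) auto
    also have "real k + real k * dist (x (j + k)) (x n) \<le> real k * dist (x s) (x n)"
      using cut(3) mult_left_mono[of "dist (x (j + k)) (x n) + 1" "dist (x s) (x n)" "real k"]
        zero_le_dist[of "x s" "x j"] by (simp add: algebra_simps)
    finally show ?thesis by (simp add: K_def)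
  qed
qed

section \<open>The uniform measure on the unit sphere\<close>

lemma space_unit_sphere_measure [simp]: "space (unit_sphere_measure p) = UNIV"
  by (simp add: unit_sphere_measure_eq)

lemma sets_unit_sphere_measure [simp, measurable_cong]: "sets (unit_sphere_measure p) = sets borel"
  by (simp add: unit_sphere_measure_eq)

lemma uniform_unit_sphere_measure: "uniform_on_unit_sphere p (unit_sphere_measure p)"
  by (simp add: unit_sphere_measure_iff)

lemma prob_space_unit_sphere_measure: "prob_space (unit_sphere_measure p)"
  using uniform_unit_sphere_measure[of p] by (simp add: uniform_on_unit_sphere_def)

lemma AE_unit_sphere_measure: "AE q in unit_sphere_measure p. dist p q = 1"
  using uniform_unit_sphere_measure[of p] by (simp add: uniform_on_unit_sphere_def)

lemma unit_sphere_measure_isometry: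
  fixes f g :: "'d::finite hyperbolic \<Rightarrow> 'd hyperbolic"
  assumes f: "\<And>x y. dist (f x) (f y) = dist x y" and fg: "\<And>x. f (g x) = x"
  shows "distr (unit_sphere_measure p) borel f = unit_sphere_measure (f p)"
proof -
  let ?M = "unit_sphere_measure p"
  have g: "dist (g x) (g y) = dist x y" for x y by (metis f fg)
  have gf: "g (f x) = x" for x by (metis f fg dist_eq_0_iff)
  have meas: "h \<in> borel_measurable borel" if "\<And>x y. dist (h x) (h y) = dist x y"
    for h :: "'d hyperbolic \<Rightarrow> 'd hyperbolic"
    by (rule borel_measurable_continuous_onI) (use that in \<open>auto simp: continuous_on_iff\<close>)
  have [measurable]: "f \<in> borel_measurable borel" "g \<in> borel_measurable borel"
    using meas[of f] meas[of g] f g by auto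
  interpret prob_space ?M by (rule prob_space_unit_sphere_measure)
  have "uniform_on_unit_sphere (f p) (distr ?M borel f)"
    unfolding uniform_on_unit_sphere_def
  proof (intro conjI allI impI)
    show "prob_space (distr ?M borel f)" by (rule prob_space_distr) simp
    show "AE q in distr ?M borel f. q \<in> sphere (f p) 1"
      using AE_unit_sphere_measure[of p] by (subst AE_distr_iff) (auto simp: f)
    fix h assume h: "isometry_fixing (f p) h"
    then have [measurable]: "h \<in> borel_measurable borel" by (rule isometry_measurable)
    let ?h = "\<lambda>x. g (h (f x))"
    have "isometry_fixing p ?h" using h by (auto simp: isometry_fixing_def f g gf)
    then have inv: "distr ?M borel ?h = ?M"
      using uniform_unit_sphere_measure[of p] by (simp add: uniform_on_unit_sphere_def)
    have "distr (distr ?M borel f) borel h = distr ?M borel (f \<circ> ?h)"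
      by (simp add: distr_distr comp_def fg)
    also have "\<dots> = distr (distr ?M borel ?h) borel f"
      by (subst distr_distr) (auto simp: comp_def)
    finally show "distr (distr ?M borel f) borel h = distr ?M borel f" by (simp add: inv)
  qed simp
  then show ?thesis by (simp add: unit_sphere_measure_iff)
qed

lemma unit_sphere_measure_ball_pos:
  assumes "t > 0" and s: "dist p s = 1"
  shows "emeasure (unit_sphere_measure p) (ball s t) > 0"
proof (rule ccontr)
  let ?M = "unit_sphere_measure p"
  interpret prob_space ?M by (rule prob_space_unit_sphere_measure)
  assume "\<not> 0 < emeasure ?M (ball s t)"
  then have zero: "emeasure ?M (ball s' t) = 0" if "dist p s' = 1" for s'
    using uniform_on_unit_sphere_ball[OF uniform_unit_sphere_measure[of p], of s s' t] s that by simp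
  \<comment> \<open>Cover the sphere by finitely many balls of radius \<open>t / 2\<close>. Each is a null set, because it
    misses the sphere or lies in a ball of radius \<open>t\<close> about a point of the sphere.\<close>
  let ?g = "boost p"
  have "compact (?g ` cball (hlift 0) 1)"
    by (intro compact_continuous_image compact_cball_origin) (auto simp: continuous_on_iff)
  then obtain T where T: "finite T" "?g ` cball (hlift 0) 1 \<subseteq> (\<Union>x\<in>T. ball x (t / 2))"
    using assms(1) by (metis compact_imp_seq_compact seq_compact_imp_totally_bounded half_gt_zero)
  have "AE v in ?M. v \<notin> ball x (t / 2)" for x
  proof (cases "\<exists>s'\<in>ball x (t / 2). dist p s' = 1")
    case True
    then obtain s' where s': "dist x s' < t / 2" "dist p s' = 1" by auto
    have sub: "ball x (t / 2) \<subseteq> ball s' t"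
      using s'(1) dist_triangle_half_r[of x s' t] by auto
    have "ball s' t \<in> null_sets ?M" using zero[OF s'(2)] by (auto simp: null_sets_def)
    then have "AE v in ?M. v \<notin> ball s' t" by (rule AE_not_in)
    then show ?thesis by eventually_elim (use sub in blast)
  next
    case False
    then show ?thesis using AE_unit_sphere_measure[of p] by (auto elim: eventually_mono)
  qed
  then have "AE v in ?M. \<forall>x\<in>T. v \<notin> ball x (t / 2)" using T(1) by (simp add: AE_finite_all)
  with AE_unit_sphere_measure[of p] have "AE v in ?M. False"
  proof eventually_elim
    case (elim v)
    have "dist (hlift 0) (boost (reflect p) v) = 1"
      using elim(1) dist_boost[of "reflect p" p v] by simp
    then have "v \<in> ?g ` cball (hlift 0) 1"
      by (intro image_eqI[of _ _ "boost (reflect p) v"]) auto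
    then show False using T(2) elim(2) by auto
  qed
  then show False using AE_contr by auto
qed

text \<open>The first unit of the geodesic from \<open>p\<close> to \<open>q\<close>: a boost moves \<open>p\<close> to the origin, where
  geodesics are radial.\<close>

lemma geodesic_step:
  fixes p q :: "'d::finite hyperbolic"
  assumes "dist p q \<ge> 1"
  obtains s where "dist p s = 1" "dist s q = dist p q - 1"
proof -
  let ?o = "hlift 0 :: 'd hyperbolic"
  define q' where "q' = boost (reflect p) q"
  define D where "D = dist p q"
  have oq: "dist ?o q' = D" using dist_boost[of "reflect p" p q] by (simp add: q'_def D_def)
  have t: "tcoord q' = cosh D" unfolding tcoord_eq_cosh oq ..
  have D: "D \<ge> 1" using assms by (simp add: D_def)
  have "(norm (xcoord q'))\<^sup>2 = (sinh D)\<^sup>2"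
    using tcoord_square[of q'] t cosh_square_eq[of D] by (simp add: power2_norm_eq_inner)
  then have n: "norm (xcoord q') = sinh D" using D by (simp add: power2_eq_iff_nonneg)
  have sD: "sinh D > 0" using D by simp
  define s' :: "'d hyperbolic" where "s' = hlift (sinh 1 *\<^sub>R sgn (xcoord q'))"
  have "sgn (xcoord q') \<bullet> sgn (xcoord q') = 1"
    using n sD by (metis norm_sgn norm_zero less_irrefl power2_norm_eq_inner one_power2)
  then have ts: "tcoord s' = cosh 1"
    using cosh_square_eq[of "1::real"] by (simp add: s'_def coords_hlift power2_eq_square real_sqrt_unique)
  have os: "dist ?o s' = 1"
    using ts unfolding tcoord_eq_cosh by (metis arcosh_cosh_real zero_le_dist zero_le_one)
  have "sgn (xcoord q') \<bullet> xcoord q' = sinh D"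
    using n sD by (simp add: sgn_div_norm power2_norm_eq_inner[symmetric] power2_eq_square)
  then have "cosh (dist s' q') = cosh D * cosh 1 - sinh D * sinh 1"
    unfolding cosh_dist lorentz_def by (simp add: t ts) (simp add: s'_def)
  also have "\<dots> = cosh (D - 1)" by (simp add: cosh_diff)
  finally have sq: "dist s' q' = D - 1" using D by (metis arcosh_cosh_real diff_ge_0_iff_ge zero_le_dist)
  show thesis
  proof (rule that[of "boost p s'"])
    show "dist p (boost p s') = 1" using os dist_boost[of p ?o s'] by simp
    show "dist (boost p s') q = dist p q - 1"
      using sq dist_boost[of p s' q'] by (simp add: q'_def D_def)
  qed
qed

text \<open>A neighbourhood of the geodesic step has a mass that depends only on its radius, since isometries
  act transitively on the pairs of a point and a point of its unit sphere.\<close>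

lemma step_towards:
  assumes t: "t > 0"
  obtains \<pi> :: real where "\<pi> > 0"
    "\<And>p q :: 'd::finite hyperbolic. dist p q \<ge> 1 \<Longrightarrow>
       ennreal \<pi> \<le> emeasure (unit_sphere_measure p) {v. dist p v \<le> 1 \<and> dist v q \<le> dist p q - 1 + t}"
proof -
  let ?o = "hlift 0 :: 'd hyperbolic"
  obtain v\<^sub>0 :: "real^'d" where "v\<^sub>0 \<noteq> 0" by (metis vector_one_nth zero_neq_one one_neq_zero)
  then have s0: "dist ?o (sphere_map ?o v\<^sub>0) = 1" by (rule dist_sphere_map)
  define \<pi> where "\<pi> = measure (unit_sphere_measure ?o) (ball (sphere_map ?o v\<^sub>0) t)"
  interpret o: prob_space "unit_sphere_measure ?o" by (rule prob_space_unit_sphere_measure)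
  have \<pi>: "ennreal \<pi> = emeasure (unit_sphere_measure ?o) (ball (sphere_map ?o v\<^sub>0) t)"
    by (simp add: \<pi>_def o.emeasure_eq_measure)
  show thesis
  proof (rule that)
    show "\<pi> > 0" using unit_sphere_measure_ball_pos[OF t s0] unfolding \<pi>[symmetric] by simp
    fix p q :: "'d hyperbolic" assume "dist p q \<ge> 1"
    then obtain s where s: "dist p s = 1" "dist s q = dist p q - 1" by (rule geodesic_step)
    let ?g = "boost (reflect p)"
    have os: "dist ?o (?g s) = 1" using s(1) dist_boost[of "reflect p" p s] by simp
    have [measurable]: "boost p \<in> borel_measurable borel"
      by (rule borel_measurable_continuous_onI) (auto simp: continuous_on_iff)
    have "emeasure (unit_sphere_measure p) (ball s t) =
        emeasure (distr (unit_sphere_measure ?o) borel (boost p)) (ball s t)"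
      using unit_sphere_measure_isometry[of "boost p" ?g ?o] by simp
    also have "\<dots> = emeasure (unit_sphere_measure ?o) (boost p -` ball s t)"
      by (subst emeasure_distr) auto
    also have "boost p -` ball s t = ball (?g s) t"
    proof -
      have "dist s (boost p v) = dist (?g s) v" for v
        using dist_boost[of "reflect p" s "boost p v"] by simp
      then show ?thesis by auto
    qed
    also have "emeasure (unit_sphere_measure ?o) (ball (?g s) t) = ennreal \<pi>"
      unfolding \<pi>
      using uniform_on_unit_sphere_ball[OF uniform_unit_sphere_measure] s0 os by auto
    finally have "ennreal \<pi> = emeasure (unit_sphere_measure p) (ball s t)" ..
    also have "\<dots> \<le> emeasure (unit_sphere_measure p) {v. dist p v \<le> 1 \<and> dist v q \<le> dist p q - 1 + t}"
    proof (rule emeasure_mono_AE)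
      show "AE v in unit_sphere_measure p. v \<in> ball s t \<longrightarrow>
          v \<in> {v. dist p v \<le> 1 \<and> dist v q \<le> dist p q - 1 + t}"
        using AE_unit_sphere_measure[of p]
      proof eventually_elim
        case (elim v)
        then show ?case using s(2) dist_triangle[of v q s] by (auto simp: dist_commute)
      qed
      show "{v. dist p v \<le> 1 \<and> dist v q \<le> dist p q - 1 + t} \<in> sets (unit_sphere_measure p)"
        by measurable
    qed
    finally show "ennreal \<pi> \<le>
        emeasure (unit_sphere_measure p) {v. dist p v \<le> 1 \<and> dist v q \<le> dist p q - 1 + t}" .
  qed
qed

section \<open>The Markov property of the walk\<close>

lemma sets_walk [simp, measurable_cong]: "sets (walk p n) = sets (path_space n)"
  using walk_prob_algebra[of p n] by (simp add: space_prob_algebra)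

lemma space_walk [simp]: "space (walk p n) = space (path_space n)"
  by (rule sets_eq_imp_space_eq) simp

lemma prob_space_walk: "prob_space (walk p n)"
  using walk_prob_algebra[of p n] by (simp add: space_prob_algebra)

lemma walk_step_kernel:
  "(\<lambda>x. distr (unit_sphere_measure (x n)) (path_space (Suc n)) (\<lambda>y. x(Suc n := y)))
     \<in> walk p n \<rightarrow>\<^sub>M subprob_algebra (path_space (Suc n))"
  using measurable_prob_algebraD[OF walk_step_measurable[of n]]
  by (simp cong: measurable_cong_sets)

lemma measurable_fun_upd_path_space:
  "(\<lambda>(x, y). x(Suc n := y)) \<in> path_space n \<Otimes>\<^sub>M borel \<rightarrow>\<^sub>M path_space (Suc n)"
  using measurable_add_dim[of "Suc n" "{..n}" "\<lambda>_. borel"] by (simp add: atMost_Suc)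

lemma nn_integral_step_measurable:
  assumes "F \<in> borel_measurable (path_space (Suc n))"
  shows "(\<lambda>x. \<integral>\<^sup>+y. F (x(Suc n := y)) \<partial>unit_sphere_measure (x n)) \<in> borel_measurable (path_space n)"
proof (rule nn_integral_measurable_subprob_algebra2[where N = borel])
  show "(\<lambda>(x, y). F (x(Suc n := y))) \<in> borel_measurable (path_space n \<Otimes>\<^sub>M borel)"
    using measurable_compose[OF measurable_fun_upd_path_space assms] by (simp add: case_prod_unfold)
  show "(\<lambda>x. unit_sphere_measure (x n)) \<in> path_space n \<rightarrow>\<^sub>M subprob_algebra borel"
    by (rule measurable_prob_algebraD) measurable
qed

lemma fun_upd_measurable:
  assumes "x \<in> space (path_space n)"
  shows "(\<lambda>y. x(Suc n := y)) \<in> unit_sphere_measure q \<rightarrow>\<^sub>M path_space (Suc n)"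
  using measurable_compose[OF measurable_Pair1'[OF assms] measurable_fun_upd_path_space]
  by (simp cong: measurable_cong_sets)

lemma nn_integral_walk_Suc:
  assumes F: "F \<in> borel_measurable (path_space (Suc n))"
  shows "(\<integral>\<^sup>+x. F x \<partial>walk p (Suc n)) =
    (\<integral>\<^sup>+x. \<integral>\<^sup>+y. F (x(Suc n := y)) \<partial>unit_sphere_measure (x n) \<partial>walk p n)"
proof -
  have "(\<integral>\<^sup>+x. F x \<partial>walk p (Suc n)) = (\<integral>\<^sup>+x. \<integral>\<^sup>+z. F z
      \<partial>distr (unit_sphere_measure (x n)) (path_space (Suc n)) (\<lambda>y. x(Suc n := y)) \<partial>walk p n)"
    unfolding walk.simps by (rule nn_integral_bind[OF F walk_step_kernel])
  also have "\<dots> = (\<integral>\<^sup>+x. \<integral>\<^sup>+y. F (x(Suc n := y)) \<partial>unit_sphere_measure (x n) \<partial>walk p n)"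
    by (intro nn_integral_cong nn_integral_distr fun_upd_measurable) (use F in simp_all)
  finally show ?thesis .
qed

lemma nn_integral_walk_0:
  assumes "F \<in> borel_measurable (path_space 0)"
  shows "(\<integral>\<^sup>+x. F x \<partial>walk p 0) = F (\<lambda>i\<in>{..0}. p)"
  using assms by (simp add: nn_integral_return space_PiM)

lemma walk_kernel [measurable]: "(\<lambda>p. walk p n) \<in> borel \<rightarrow>\<^sub>M prob_algebra (path_space n)"
proof (induction n)
  case 0
  have "(\<lambda>p. \<lambda>i\<in>{..0}. p) \<in> borel \<rightarrow>\<^sub>M path_space 0" by measurable
  then show ?case
    unfolding walk.simps by (rule measurable_compose) (rule measurable_return_prob_space)
next
  case (Suc n)
  show ?case unfolding walk.simps by (rule measurable_bind_prob_space[OF Suc walk_step_measurable])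
qed

lemma AE_walk: "AE x in walk p n. x 0 = p \<and> (\<forall>i<n. dist (x i) (x (Suc i)) = 1)"
proof (induction n)
  case 0
  show ?case unfolding walk.simps by (subst AE_return) (auto simp: space_PiM)
next
  case (Suc n)
  have pred: "Measurable.pred (path_space m) (\<lambda>x. x 0 = p \<and> (\<forall>i<m. dist (x i) (x (Suc i)) = 1))" for m
  proof -
    have *: "(\<forall>i<m. dist (x i) (x (Suc i)) = 1) \<longleftrightarrow> (\<forall>i\<in>{..<m}. dist (x i) (x (Suc i)) = 1)"
      for x :: "nat \<Rightarrow> 'a hyperbolic"
      by auto
    have "Measurable.pred (path_space m) (\<lambda>x. dist (x 0) p = 0 \<and> (\<forall>i\<in>{..<m}. dist (x i) (x (Suc i)) = 1))"
      by measurable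
    then show ?thesis unfolding * by simp
  qed
  have "AE x in walk p n. AE z in distr (unit_sphere_measure (x n)) (path_space (Suc n)) (\<lambda>y. x(Suc n := y)).
      z 0 = p \<and> (\<forall>i<Suc n. dist (z i) (z (Suc i)) = 1)"
    using Suc.IH AE_space
  proof eventually_elim
    case (elim x)
    then have meas: "(\<lambda>y. x(Suc n := y)) \<in> unit_sphere_measure (x n) \<rightarrow>\<^sub>M path_space (Suc n)"
      by (intro fun_upd_measurable) simp
    show ?case
    proof (subst AE_distr_iff[OF meas])
      show "AE y in unit_sphere_measure (x n). (x(Suc n := y)) 0 = p \<and>
          (\<forall>i<Suc n. dist ((x(Suc n := y)) i) ((x(Suc n := y)) (Suc i)) = 1)"
        using AE_unit_sphere_measure[of "x n"]
        by eventually_elim (use elim in \<open>auto simp: less_Suc_eq\<close>)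
    qed (use pred[of "Suc n"] in \<open>simp add: pred_def\<close>)
  qed
  then show ?case unfolding walk.simps by (subst AE_bind[OF walk_step_kernel pred])
qed

text \<open>At the junction \<open>j\<close> the value of the second path is taken, so the end of the glued path is \<open>y m\<close>
  also when \<open>m = 0\<close>.\<close>

definition glue :: "nat \<Rightarrow> nat \<Rightarrow> (nat \<Rightarrow> 'a) \<Rightarrow> (nat \<Rightarrow> 'a) \<Rightarrow> nat \<Rightarrow> 'a" where
  "glue j m x y = (\<lambda>i\<in>{..j + m}. if i < j then x i else y (i - j))"

lemma measurable_glue [measurable]:
  assumes [measurable]: "f \<in> M \<rightarrow>\<^sub>M path_space j" "g \<in> M \<rightarrow>\<^sub>M path_space m"
  shows "(\<lambda>w. glue j m (f w) (g w)) \<in> M \<rightarrow>\<^sub>M path_space (j + m)"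
  unfolding glue_def
proof (rule measurable_restrict)
  fix i assume "i \<in> {..j + m}"
  show "(\<lambda>w. if i < j then f w i else g w (i - j)) \<in> M \<rightarrow>\<^sub>M borel"
  proof (cases "i < j")
    case True
    have "(\<lambda>w. f w i) \<in> M \<rightarrow>\<^sub>M borel"
      using measurable_compose[OF assms(1) measurable_component_singleton[of i "{..j}" "\<lambda>_. borel"]] True
      by simp
    with True show ?thesis by simp
  next
    case False
    have "(\<lambda>w. g w (i - j)) \<in> M \<rightarrow>\<^sub>M borel"
      using measurable_compose[OF assms(2) measurable_component_singleton[of "i - j" "{..m}" "\<lambda>_. borel"]]
        \<open>i \<in> {..j + m}\<close> by simp
    with False show ?thesis by simp
  qed
qed

text \<open>The Markov property, by induction on \<open>m\<close>: the last step of the second part is the last step of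
  the whole walk.\<close>

lemma nn_integral_walk_glue:
  assumes "F \<in> borel_measurable (path_space (j + m))"
  shows "(\<integral>\<^sup>+x. F x \<partial>walk p (j + m)) =
    (\<integral>\<^sup>+x. \<integral>\<^sup>+y. F (glue j m x y) \<partial>walk (x j) m \<partial>walk p j)"
  using assms
proof (induction m arbitrary: F)
  case 0
  show ?case
  proof (simp only: add_0_right, rule nn_integral_cong)
    fix x assume x: "x \<in> space (walk p j)"
    then have g: "glue j 0 x (\<lambda>i\<in>{..0}. x j) = x"
      by (auto simp: glue_def fun_eq_iff space_PiM PiE_def extensional_def)
    have "(\<lambda>y. glue j 0 x y) \<in> path_space 0 \<rightarrow>\<^sub>M path_space (j + 0)"
      using x by (intro measurable_glue) auto
    then have "(\<lambda>y. F (glue j 0 x y)) \<in> borel_measurable (path_space 0)"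
      using 0 by (rule measurable_compose)
    then show "F x = (\<integral>\<^sup>+y. F (glue j 0 x y) \<partial>walk (x j) 0)"
      by (subst nn_integral_walk_0) (simp_all only: g)
  qed
next
  case (Suc m)
  let ?F = "\<lambda>x. \<integral>\<^sup>+z. F (x(Suc (j + m) := z)) \<partial>unit_sphere_measure (x (j + m))"
  have F: "F \<in> borel_measurable (path_space (Suc (j + m)))" using Suc.prems by simp
  have upd: "(glue j m x y)(Suc (j + m) := z) = glue j (Suc m) x (y(Suc m := z))" for x y z
    by (auto simp: glue_def fun_eq_iff Suc_diff_le)
  have "(\<integral>\<^sup>+x. F x \<partial>walk p (j + Suc m)) = (\<integral>\<^sup>+x. ?F x \<partial>walk p (j + m))"
    using nn_integral_walk_Suc[OF F] by simp
  also have "\<dots> = (\<integral>\<^sup>+x. \<integral>\<^sup>+y. ?F (glue j m x y) \<partial>walk (x j) m \<partial>walk p j)"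
    by (rule Suc.IH[OF nn_integral_step_measurable[OF F]])
  also have "\<dots> = (\<integral>\<^sup>+x. \<integral>\<^sup>+y. F (glue j (Suc m) x y) \<partial>walk (x j) (Suc m) \<partial>walk p j)"
  proof (rule nn_integral_cong)
    fix x assume x: "x \<in> space (walk p j)"
    have "(\<lambda>y. glue j (Suc m) x y) \<in> path_space (Suc m) \<rightarrow>\<^sub>M path_space (j + Suc m)"
      using x by (intro measurable_glue) auto
    then have "(\<lambda>y. F (glue j (Suc m) x y)) \<in> borel_measurable (path_space (Suc m))"
      using Suc.prems by (rule measurable_compose)
    from nn_integral_walk_Suc[OF this, of "x j"]
    show "(\<integral>\<^sup>+y. ?F (glue j m x y) \<partial>walk (x j) m) = (\<integral>\<^sup>+y. F (glue j (Suc m) x y) \<partial>walk (x j) (Suc m))"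
      unfolding upd by (simp add: glue_def)
  qed
  finally show ?case .
qed

text \<open>Step by step, since an isometry carries the uniform measure on the unit sphere about a vertex to the
  one about its image.\<close>

lemma nn_integral_walk_isometry:
  fixes f g :: "'d::finite hyperbolic \<Rightarrow> 'd hyperbolic"
  assumes f: "\<And>x y. dist (f x) (f y) = dist x y" and fg: "\<And>x. f (g x) = x"
    and F: "F \<in> borel_measurable (path_space n)"
  shows "(\<integral>\<^sup>+x. F x \<partial>walk (f p) n) = (\<integral>\<^sup>+x. F (\<lambda>i\<in>{..n}. f (x i)) \<partial>walk p n)"
  using F
proof (induction n arbitrary: F)
  case 0
  have fm [measurable]: "f \<in> borel_measurable borel"
    by (rule borel_measurable_continuous_onI) (use f in \<open>auto simp: continuous_on_iff\<close>)
  have "(\<lambda>x. \<lambda>i\<in>{..0}. f (x i)) \<in> path_space 0 \<rightarrow>\<^sub>M path_space 0" by measurable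
  then have Ff: "(\<lambda>x. F (\<lambda>i\<in>{..0}. f (x i))) \<in> borel_measurable (path_space 0)"
    using 0 by (rule measurable_compose)
  show ?case
    unfolding nn_integral_walk_0[OF 0] nn_integral_walk_0[OF Ff] by (rule arg_cong[where f = F]) auto
next
  case (Suc n)
  have fm [measurable]: "f \<in> borel_measurable borel"
    by (rule borel_measurable_continuous_onI) (use f in \<open>auto simp: continuous_on_iff\<close>)
  let ?F = "\<lambda>x. \<integral>\<^sup>+z. F (x(Suc n := z)) \<partial>unit_sphere_measure (x n)"
  have "(\<lambda>x. \<lambda>i\<in>{..Suc n}. f (x i)) \<in> path_space (Suc n) \<rightarrow>\<^sub>M path_space (Suc n)" by measurable
  then have Ff: "(\<lambda>x. F (\<lambda>i\<in>{..Suc n}. f (x i))) \<in> borel_measurable (path_space (Suc n))"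
    using Suc.prems by (rule measurable_compose)
  have "(\<integral>\<^sup>+x. F x \<partial>walk (f p) (Suc n)) = (\<integral>\<^sup>+x. ?F x \<partial>walk (f p) n)"
    by (rule nn_integral_walk_Suc[OF Suc.prems])
  also have "\<dots> = (\<integral>\<^sup>+x. ?F (\<lambda>i\<in>{..n}. f (x i)) \<partial>walk p n)"
    by (rule Suc.IH[OF nn_integral_step_measurable[OF Suc.prems]])
  also have "\<dots> = (\<integral>\<^sup>+x. \<integral>\<^sup>+y. F (\<lambda>i\<in>{..Suc n}. f ((x(Suc n := y)) i)) \<partial>unit_sphere_measure (x n) \<partial>walk p n)"
  proof (rule nn_integral_cong)
    fix x assume x: "x \<in> space (walk p n)"
    have r: "(\<lambda>i\<in>{..n}. f (x i)) \<in> space (path_space n)" by (auto simp: space_PiM)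
    have Fr: "(\<lambda>z. F ((\<lambda>i\<in>{..n}. f (x i))(Suc n := z))) \<in> borel_measurable borel"
      using measurable_compose[OF fun_upd_measurable[OF r] Suc.prems]
      by (simp only: measurable_cong_sets[OF sets_unit_sphere_measure refl])
    have "?F (\<lambda>i\<in>{..n}. f (x i)) =
        (\<integral>\<^sup>+z. F ((\<lambda>i\<in>{..n}. f (x i))(Suc n := z)) \<partial>distr (unit_sphere_measure (x n)) borel f)"
      unfolding unit_sphere_measure_isometry[OF f fg, of "x n"] by simp
    also have "\<dots> = (\<integral>\<^sup>+y. F ((\<lambda>i\<in>{..n}. f (x i))(Suc n := f y)) \<partial>unit_sphere_measure (x n))"
      by (rule nn_integral_distr) (use Fr in simp_all)
    also have "\<dots> = (\<integral>\<^sup>+y. F (\<lambda>i\<in>{..Suc n}. f ((x(Suc n := y)) i)) \<partial>unit_sphere_measure (x n))"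
      by (intro nn_integral_cong arg_cong[where f = F]) (auto simp: fun_eq_iff)
    finally show "?F (\<lambda>i\<in>{..n}. f (x i)) = \<dots>" .
  qed
  also have "\<dots> = (\<integral>\<^sup>+x. F (\<lambda>i\<in>{..Suc n}. f (x i)) \<partial>walk p (Suc n))"
    by (rule nn_integral_walk_Suc[OF Ff, symmetric])
  finally show ?case .
qed

lemma approach_fun_upd:
  "approach t (Suc n) q (x(Suc n := z)) \<longleftrightarrow>
     approach t n q x \<and> dist (x n) z \<le> 1 \<and> dist z q \<le> dist (x n) q - 1 + t"
  by (auto simp: approach_def less_Suc_eq)

lemma approach_measurable [measurable]:
  "{y \<in> space (path_space k). y 0 = p \<and> approach t k q y} \<in> sets (path_space k)"
proof -
  have "(a \<le> b - 1 + t) = (a - b \<le> t - 1)" for a b by linarith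
  then have *: "approach t k q y \<longleftrightarrow> (\<forall>i\<in>{..<k}. dist (y i) (y (Suc i)) \<le> 1) \<and>
      (\<forall>i\<in>{..<k}. dist (y (Suc i)) q - dist (y i) q \<le> t - 1)" for y
    unfolding approach_def by auto
  have "{y \<in> space (path_space k). y 0 = p \<and> approach t k q y} =
      {y \<in> space (path_space k). dist (y 0) p \<le> 0} \<inter>
      {y \<in> space (path_space k). \<forall>i\<in>{..<k}. dist (y i) (y (Suc i)) \<le> 1} \<inter>
      {y \<in> space (path_space k). \<forall>i\<in>{..<k}. dist (y (Suc i)) q - dist (y i) q \<le> t - 1}"
    unfolding * by auto
  also have "\<dots> \<in> sets (path_space k)"
  proof (intro sets.Int)
    show "{y \<in> space (path_space k). dist (y 0) p \<le> 0} \<in> sets (path_space k)" by measurable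
    show "{y \<in> space (path_space k). \<forall>i\<in>{..<k}. dist (y i) (y (Suc i)) \<le> 1} \<in> sets (path_space k)"
      by measurable
    show "{y \<in> space (path_space k). \<forall>i\<in>{..<k}. dist (y (Suc i)) q - dist (y i) q \<le> t - 1}
        \<in> sets (path_space k)"
      by measurable
  qed
  finally show ?thesis .
qed

text \<open>After fewer than \<open>k\<close> steps the walk is still at distance at least 1 from \<open>q\<close>, so each of the
  steps goes towards \<open>q\<close> with probability at least \<open>\<pi>\<close>.\<close>

lemma approach_probability:
  fixes p q :: "'d::finite hyperbolic"
  assumes \<pi>: "\<And>p q :: 'd hyperbolic. dist p q \<ge> 1 \<Longrightarrow>
       ennreal \<pi> \<le> emeasure (unit_sphere_measure p) {v. dist p v \<le> 1 \<and> dist v q \<le> dist p q - 1 + t}"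
    and k: "real k \<le> dist p q"
  shows "ennreal \<pi> ^ k \<le> emeasure (walk p k) {y \<in> space (path_space k). y 0 = p \<and> approach t k q y}"
  using k
proof (induction k)
  case 0
  have "emeasure (walk p 0) {y \<in> space (path_space 0). y 0 = p \<and> approach t 0 q y} = 1"
  proof (rule prob_space.emeasure_eq_1_AE[OF prob_space_walk])
    show "AE y in walk p 0. y \<in> {y \<in> space (path_space 0). y 0 = p \<and> approach t 0 q y}"
      using AE_walk[of p 0] AE_space by eventually_elim (auto simp: approach_def)
  qed (simp only: sets_walk approach_measurable)
  then show ?case by (simp only: power_0 order_refl)
next
  case (Suc k)
  let ?S = "\<lambda>k. {y \<in> space (path_space k). y 0 = p \<and> approach t k q y}"
  have "ennreal \<pi> ^ Suc k \<le> ennreal \<pi> * emeasure (walk p k) (?S k)"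
    using Suc by (simp add: mult_left_mono)
  also have "\<dots> = (\<integral>\<^sup>+x. ennreal \<pi> * indicator (?S k) x \<partial>walk p k)"
    by (subst nn_integral_cmult_indicator) auto
  also have "\<dots> \<le> (\<integral>\<^sup>+x. \<integral>\<^sup>+z. indicator (?S (Suc k)) (x(Suc k := z)) \<partial>unit_sphere_measure (x k) \<partial>walk p k)"
  proof (rule nn_integral_mono)
    fix x assume x: "x \<in> space (walk p k)"
    show "ennreal \<pi> * indicator (?S k) x \<le>
        (\<integral>\<^sup>+z. indicator (?S (Suc k)) (x(Suc k := z)) \<partial>unit_sphere_measure (x k))"
    proof (cases "x \<in> ?S k")
      case True
      let ?V = "{v. dist (x k) v \<le> 1 \<and> dist v q \<le> dist (x k) q - 1 + t}"
      have "dist p q \<le> dist (x 0) (x k) + dist (x k) q"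
        using True by (auto intro: dist_triangle)
      then have "dist (x k) q \<ge> 1"
        using approach_dist(1)[of t k q x 0 k] True Suc.prems by simp
      then have "ennreal \<pi> \<le> emeasure (unit_sphere_measure (x k)) ?V" by (rule \<pi>)
      also have "\<dots> = (\<integral>\<^sup>+z. indicator ?V z \<partial>unit_sphere_measure (x k))"
        by (subst nn_integral_indicator) auto
      also have "\<dots> = (\<integral>\<^sup>+z. indicator (?S (Suc k)) (x(Suc k := z)) \<partial>unit_sphere_measure (x k))"
      proof (rule nn_integral_cong)
        fix z
        have "x(Suc k := z) \<in> space (path_space (Suc k))"
          using measurable_space[OF fun_upd_measurable[of x k]] x by simp
        then show "indicator ?V z = (indicator (?S (Suc k)) (x(Suc k := z)) :: ennreal)"
          using True by (simp add: indicator_def approach_fun_upd)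
      qed
      finally show ?thesis using True by simp
    qed simp
  qed
  also have "\<dots> = (\<integral>\<^sup>+x. indicator (?S (Suc k)) x \<partial>walk p (Suc k))"
    by (rule nn_integral_walk_Suc[symmetric]) measurable
  also have "\<dots> = emeasure (walk p (Suc k)) (?S (Suc k))"
    by (subst nn_integral_indicator) auto
  finally show ?case .
qed

section \<open>Surgery on the random walk\<close>

lemma measurable_half_turn [measurable]:
  assumes [measurable]: "f \<in> M \<rightarrow>\<^sub>M borel" "g \<in> M \<rightarrow>\<^sub>M borel" "h \<in> M \<rightarrow>\<^sub>M borel"
  shows "(\<lambda>w. half_turn (f w) (g w) (h w) :: 'd::finite hyperbolic) \<in> M \<rightarrow>\<^sub>M borel"
proof -
  have eq: "half_turn a b x = hlift
      (((tcoord x * (tcoord a + tcoord b) - xcoord x \<bullet> (xcoord a + xcoord b)) /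
        (1 + (tcoord a * tcoord b - xcoord a \<bullet> xcoord b))) *\<^sub>R (xcoord a + xcoord b) - xcoord x)"
    for a b x :: "'d hyperbolic"
    by (rule hyperbolic_eqI) (simp add: coords_half_turn lorentz_def)
  have [measurable]: "(\<lambda>w. tcoord (u w)) \<in> borel_measurable M" "(\<lambda>w. xcoord (u w)) \<in> borel_measurable M"
    if [measurable]: "u \<in> M \<rightarrow>\<^sub>M borel" for u :: "_ \<Rightarrow> 'd hyperbolic"
    unfolding tcoord_eq by measurable
  show ?thesis unfolding eq by measurable
qed

lemma measurable_vertex:
  assumes "i \<le> n" shows "(\<lambda>x. x i) \<in> path_space n \<rightarrow>\<^sub>M borel"
  using assms by (intro measurable_component_singleton) simp

lemma measurable_surgery:
  fixes f g :: "'w \<Rightarrow> nat \<Rightarrow> 'd::finite hyperbolic"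
  assumes f: "f \<in> M \<rightarrow>\<^sub>M path_space n" and g: "g \<in> M \<rightarrow>\<^sub>M path_space k" and j: "j \<le> n"
  shows "(\<lambda>w. \<lambda>i\<in>{..n + k}. surgery j k (f w) (g w) i) \<in> M \<rightarrow>\<^sub>M path_space (n + k)"
proof (rule measurable_restrict)
  fix i assume i: "i \<in> {..n + k}"
  have fi: "(\<lambda>w. f w l) \<in> M \<rightarrow>\<^sub>M borel" if "l \<le> n" for l
    by (rule measurable_compose[OF f measurable_vertex[OF that]])
  have gi: "(\<lambda>w. g w l) \<in> M \<rightarrow>\<^sub>M borel" if "l \<le> k" for l
    by (rule measurable_compose[OF g measurable_vertex[OF that]])
  show "(\<lambda>w. surgery j k (f w) (g w) i) \<in> M \<rightarrow>\<^sub>M borel"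
    unfolding surgery_def
    by (cases "i < j"; cases "i < j + k") (use i j in \<open>simp_all add: fi gi measurable_half_turn\<close>)
qed

lemma cut_measurable [measurable]:
  "{x \<in> space (path_space n). cut k n j x} \<in> sets (path_space n :: (nat \<Rightarrow> 'd::finite hyperbolic) measure)"
proof (cases "j + k \<le> n")
  case True
  have "{x \<in> space (path_space n). cut k n j x} = {x \<in> space (path_space n :: (nat \<Rightarrow> 'd hyperbolic) measure).
      \<forall>u\<in>{..j}. \<forall>v\<in>{j + k..n}. dist (x u) (x j) + dist (x (j + k)) (x v) - dist (x u) (x v) \<le> - 1}"
    using True by (auto simp: cut_def algebra_simps)
  also have "\<dots> \<in> sets (path_space n)"
  proof (intro sets.sets_Collect_finite_All)
    fix u v assume uv: "u \<in> {..j}" "v \<in> {j + k..n}"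
    have [measurable]: "(\<lambda>x :: nat \<Rightarrow> 'd hyperbolic. x l) \<in> path_space n \<rightarrow>\<^sub>M borel"
      if "l \<in> {u, v, j, j + k}" for l
      using that uv True by (intro measurable_vertex) auto
    show "{x \<in> space (path_space n :: (nat \<Rightarrow> 'd hyperbolic) measure).
        dist (x u) (x j) + dist (x (j + k)) (x v) - dist (x u) (x v) \<le> - 1} \<in> sets (path_space n)"
      by measurable
  qed auto
  finally show ?thesis .
qed (simp add: cut_def)

text \<open>Split the walk of \<open>n + k\<close> steps at \<open>j\<close> and \<open>j + k\<close>. Given the first two parts, the third
  starts at the end of the second, so it has the law of the half-turn of a walk from vertex \<open>j\<close>. The
  law of the latter does not depend on the second part, which may therefore be drawn last.\<close>

lemma nn_integral_surgery:
  fixes F :: "(nat \<Rightarrow> 'd::finite hyperbolic) \<Rightarrow> ennreal"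
  assumes F: "F \<in> borel_measurable (path_space (n + k))" and j: "j \<le> n"
  shows "(\<lambda>x. \<integral>\<^sup>+y. F (\<lambda>i\<in>{..n + k}. surgery j k x y i) \<partial>walk (x j) k) \<in> borel_measurable (path_space n)"
      (is "?H \<in> _")
    and "(\<integral>\<^sup>+x. F x \<partial>walk p (n + k)) =
      (\<integral>\<^sup>+x. \<integral>\<^sup>+y. F (\<lambda>i\<in>{..n + k}. surgery j k x y i) \<partial>walk (x j) k \<partial>walk p n)"
proof -
  show H: "?H \<in> borel_measurable (path_space n)"
  proof (rule nn_integral_measurable_subprob_algebra2[where N = "path_space k"])
    have "(\<lambda>w. \<lambda>i\<in>{..n + k}. surgery j k (fst w) (snd w) i)
        \<in> path_space n \<Otimes>\<^sub>M path_space k \<rightarrow>\<^sub>M path_space (n + k)"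
      by (rule measurable_surgery) (use j in auto)
    from measurable_compose[OF this F]
    show "(\<lambda>(x, y). F (\<lambda>i\<in>{..n + k}. surgery j k x y i)) \<in> borel_measurable (path_space n \<Otimes>\<^sub>M path_space k)"
      by (simp only: case_prod_unfold)
    show "(\<lambda>x. walk (x j) k) \<in> path_space n \<rightarrow>\<^sub>M subprob_algebra (path_space k)"
      by (rule measurable_prob_algebraD, rule measurable_compose[OF measurable_vertex[OF j] walk_kernel])
  qed
  obtain m where n: "n = j + m" using j le_Suc_ex by blast
  have nk: "n + k = j + (k + m)" by (simp add: n)
  have F': "F \<in> borel_measurable (path_space (j + (k + m)))" using F by (simp only: nk)
  define turn where "turn a y \<eta> = (\<lambda>i\<in>{..m}. half_turn a (y k) (\<eta> i))"
    for a :: "'d hyperbolic" and y \<eta> :: "nat \<Rightarrow> 'd hyperbolic"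
  have eq: "(\<lambda>i\<in>{..n + k}. surgery j k (glue j m x \<eta>) y i) = glue j (k + m) x (glue k m y (turn (\<eta> 0) y \<eta>))"
    for x y \<eta> :: "nat \<Rightarrow> 'd hyperbolic"
  proof
    fix i
    have "i - j - k = i - k - j" by simp
    then show "(\<lambda>i\<in>{..n + k}. surgery j k (glue j m x \<eta>) y i) i =
        glue j (k + m) x (glue k m y (turn (\<eta> 0) y \<eta>)) i"
      by (auto simp: glue_def surgery_def turn_def n)
  qed
  have "(\<integral>\<^sup>+x. F x \<partial>walk p (n + k)) =
      (\<integral>\<^sup>+x. \<integral>\<^sup>+z. F (glue j (k + m) x z) \<partial>walk (x j) (k + m) \<partial>walk p j)"
    unfolding nk by (rule nn_integral_walk_glue[OF F'])
  also have "\<dots> = (\<integral>\<^sup>+x. \<integral>\<^sup>+\<eta>. ?H (glue j m x \<eta>) \<partial>walk (x j) m \<partial>walk p j)"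
  proof (rule nn_integral_cong)
    fix x assume x: "x \<in> space (walk p j)"
    define a where "a = x j"
    define G where "G = (\<lambda>z. F (glue j (k + m) x z))"
    have "(\<lambda>z. glue j (k + m) x z) \<in> path_space (k + m) \<rightarrow>\<^sub>M path_space (j + (k + m))"
      using x by (intro measurable_glue) auto
    from measurable_compose[OF this F'] have G: "G \<in> borel_measurable (path_space (k + m))"
      by (simp only: G_def)
    have joint: "(\<lambda>(y, \<eta>). G (glue k m y (turn a y \<eta>))) \<in> borel_measurable (path_space k \<Otimes>\<^sub>M path_space m)"
    proof -
      have "(\<lambda>w. turn a (fst w) (snd w)) \<in> path_space k \<Otimes>\<^sub>M path_space m \<rightarrow>\<^sub>M path_space m"
        unfolding turn_def
        by (intro measurable_restrict measurable_half_turn measurable_const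
            measurable_compose[OF measurable_fst measurable_vertex]
            measurable_compose[OF measurable_snd measurable_vertex]) auto
      then have "(\<lambda>w. glue k m (fst w) (turn a (fst w) (snd w)))
          \<in> path_space k \<Otimes>\<^sub>M path_space m \<rightarrow>\<^sub>M path_space (k + m)"
        by (intro measurable_glue) auto
      from measurable_compose[OF this G] show ?thesis by (simp only: case_prod_unfold)
    qed
    have "(\<integral>\<^sup>+z. F (glue j (k + m) x z) \<partial>walk (x j) (k + m)) =
        (\<integral>\<^sup>+y. \<integral>\<^sup>+\<eta>. G (glue k m y \<eta>) \<partial>walk (y k) m \<partial>walk a k)"
      using nn_integral_walk_glue[OF G, of a] unfolding G_def a_def .
    also have "\<dots> = (\<integral>\<^sup>+y. \<integral>\<^sup>+\<eta>. G (glue k m y (turn a y \<eta>)) \<partial>walk a m \<partial>walk a k)"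
    proof (rule nn_integral_cong)
      fix y assume y: "y \<in> space (walk a k)"
      have "(\<lambda>\<eta>. glue k m y \<eta>) \<in> path_space m \<rightarrow>\<^sub>M path_space (k + m)"
        using y by (intro measurable_glue) auto
      from measurable_compose[OF this G]
      have "(\<integral>\<^sup>+\<eta>. G (glue k m y \<eta>) \<partial>walk (half_turn a (y k) a) m) =
          (\<integral>\<^sup>+\<eta>. G (glue k m y (\<lambda>i\<in>{..m}. half_turn a (y k) (\<eta> i))) \<partial>walk a m)"
        by (intro nn_integral_walk_isometry[where g = "half_turn a (y k)"]) auto
      then show "(\<integral>\<^sup>+\<eta>. G (glue k m y \<eta>) \<partial>walk (y k) m) = (\<integral>\<^sup>+\<eta>. G (glue k m y (turn a y \<eta>)) \<partial>walk a m)"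
        by (simp add: turn_def)
    qed
    also have "\<dots> = (\<integral>\<^sup>+\<eta>. \<integral>\<^sup>+y. G (glue k m y (turn a y \<eta>)) \<partial>walk a k \<partial>walk a m)"
    proof -
      interpret W: prob_space "walk a k" by (rule prob_space_walk)
      interpret W': prob_space "walk a m" by (rule prob_space_walk)
      interpret pair_prob_space "walk a k" "walk a m" ..
      have "(\<lambda>(y, \<eta>). G (glue k m y (turn a y \<eta>))) \<in> borel_measurable (walk a k \<Otimes>\<^sub>M walk a m)"
        using joint
        by (simp only: measurable_cong_sets[OF sets_pair_measure_cong[OF sets_walk sets_walk] refl])
      from Fubini'[OF this] show ?thesis by simp
    qed
    also have "\<dots> = (\<integral>\<^sup>+\<eta>. ?H (glue j m x \<eta>) \<partial>walk a m)"
    proof (rule nn_integral_cong_AE)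
      show "AE \<eta> in walk a m. (\<integral>\<^sup>+y. G (glue k m y (turn a y \<eta>)) \<partial>walk a k) = ?H (glue j m x \<eta>)"
        using AE_walk[of a m]
      proof eventually_elim
        case (elim \<eta>)
        then have "glue j m x \<eta> j = a" "\<eta> 0 = a" by (simp_all add: glue_def)
        then show ?case unfolding eq G_def by simp
      qed
    qed
    finally show "(\<integral>\<^sup>+z. F (glue j (k + m) x z) \<partial>walk (x j) (k + m)) =
        (\<integral>\<^sup>+\<eta>. ?H (glue j m x \<eta>) \<partial>walk (x j) m)"
      by (simp add: a_def)
  qed
  also have "\<dots> = (\<integral>\<^sup>+x. ?H x \<partial>walk p n)"
    using H unfolding n by (rule nn_integral_walk_glue[symmetric])
  finally show "(\<integral>\<^sup>+x. F x \<partial>walk p (n + k)) = (\<integral>\<^sup>+x. ?H x \<partial>walk p n)" .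
qed

lemma self_avoiding_antimono:
  fixes p :: "'d::finite hyperbolic"
  shows "emeasure (walk p (n + k)) (self_avoiding c (n + k)) \<le> emeasure (walk p n) (self_avoiding c n)"
proof -
  have "emeasure (walk p (n + k)) (self_avoiding c (n + k)) =
      (\<integral>\<^sup>+x. indicator (self_avoiding c (n + k)) x \<partial>walk p (n + k))"
    by (subst nn_integral_indicator) auto
  also have "\<dots> = (\<integral>\<^sup>+x. \<integral>\<^sup>+y. indicator (self_avoiding c (n + k)) (glue n k x y) \<partial>walk (x n) k \<partial>walk p n)"
    by (rule nn_integral_walk_glue) measurable
  also have "\<dots> \<le> (\<integral>\<^sup>+x. indicator (self_avoiding c n) x \<partial>walk p n)"
  proof (rule nn_integral_mono)
    fix x assume x: "x \<in> space (walk p n)"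
    have "(\<integral>\<^sup>+y. indicator (self_avoiding c (n + k)) (glue n k x y) \<partial>walk (x n) k) \<le>
        (\<integral>\<^sup>+y. indicator (self_avoiding c n) x \<partial>walk (x n) k)"
    proof (rule nn_integral_mono_AE)
      show "AE y in walk (x n) k. (indicator (self_avoiding c (n + k)) (glue n k x y) :: ennreal)
          \<le> indicator (self_avoiding c n) x"
        using AE_walk[of "x n" k]
      proof eventually_elim
        case (elim y)
        have g: "glue n k x y i = x i" if "i \<le> n" for i
          using that elim by (cases "i = n") (auto simp: glue_def)
        have "x \<in> self_avoiding c n" if sa: "glue n k x y \<in> self_avoiding c (n + k)"
        proof -
          have "c < dist (x i) (x i')" if "i < i'" "i' \<le> n" for i i'
          proof -
            have "c < dist (glue n k x y i) (glue n k x y i')"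
              using sa that unfolding self_avoiding_def by simp
            then show ?thesis using that g by simp
          qed
          then show ?thesis using x by (simp add: self_avoiding_def)
        qed
        then show ?case by (simp add: indicator_def)
      qed
    qed
    also have "\<dots> = indicator (self_avoiding c n) x"
      using prob_space.emeasure_space_1[OF prob_space_walk[of "x n" k]] by simp
    finally show "(\<integral>\<^sup>+y. indicator (self_avoiding c (n + k)) (glue n k x y) \<partial>walk (x n) k) \<le>
        indicator (self_avoiding c n) x" .
  qed
  also have "\<dots> = emeasure (walk p n) (self_avoiding c n)"
    by (subst nn_integral_indicator) auto
  finally show ?thesis .
qed

section \<open>Linear displacement\<close>

lemma surgery_probability:
  fixes x :: "nat \<Rightarrow> 'd::finite hyperbolic"
  assumes x: "x \<in> self_avoiding c n" and c: "c < 1" and j: "j \<le> n"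
    and ex: "exposed C (cosh (real k)) (x ` {..n}) (x j)" and C: "C > 0"
    and t: "t \<ge> 0" "real k * t < 1 - c" "real k * t \<le> 1"
    and k: "8 * (1 + cosh (real k)) \<le> (exp (real k - 1) / (4 * C))\<^sup>2"
    and \<pi>: "\<And>p q :: 'd hyperbolic. dist p q \<ge> 1 \<Longrightarrow>
       ennreal \<pi> \<le> emeasure (unit_sphere_measure p) {v. dist p v \<le> 1 \<and> dist v q \<le> dist p q - 1 + t}"
  shows "ennreal \<pi> ^ k \<le> (\<integral>\<^sup>+y. indicator {z \<in> self_avoiding c (n + k). cut k (n + k) j z}
      (\<lambda>i\<in>{..n + k}. surgery j k x y i) \<partial>walk (x j) k)"
proof -
  obtain q where q: "cosh (real k) \<le> cosh (dist (x j) q)"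
      "\<And>i. i \<le> n \<Longrightarrow> dist (x j) q \<le> dist (x i) q"
      "\<And>i. i \<le> n \<Longrightarrow> cosh (dist (x i) (x j)) * cosh (dist (x j) q) \<le> C * cosh (dist (x i) q)"
    using ex unfolding exposed_def by auto
  have "real k \<le> dist (x j) q" using q(1) by (simp add: cosh_real_nonneg_le_iff)
  then have "ennreal \<pi> ^ k \<le> emeasure (walk (x j) k)
      {y \<in> space (path_space k). y 0 = x j \<and> approach t k q y}"
    by (intro approach_probability \<pi>)
  also have "\<dots> = (\<integral>\<^sup>+y. indicator {y \<in> space (path_space k). y 0 = x j \<and> approach t k q y} y \<partial>walk (x j) k)"
    by (subst nn_integral_indicator) auto
  also have "\<dots> \<le> (\<integral>\<^sup>+y. indicator {z \<in> self_avoiding c (n + k). cut k (n + k) j z}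
      (\<lambda>i\<in>{..n + k}. surgery j k x y i) \<partial>walk (x j) k)"
  proof (rule nn_integral_mono)
    fix y
    have "(\<lambda>i\<in>{..n + k}. surgery j k x y i) \<in> {z \<in> self_avoiding c (n + k). cut k (n + k) j z}"
      if "y 0 = x j" "approach t k q y"
    proof -
      have sa: "c < dist (x i) (x i')" if "i < i'" "i' \<le> n" for i i'
        using x that by (auto simp: self_avoiding_def)
      note s = surgery_self_avoiding_cut[where x = x and n = n and c = c and j = j and q = q and C = C,
          OF sa c j q(2,3) that t C k]
      have "cut k (n + k) j (\<lambda>i\<in>{..n + k}. surgery j k x y i)"
        using s(2) unfolding cut_def by auto
      then show ?thesis using s(1) by (auto simp: self_avoiding_def space_PiM)
    qed
    then show "indicator {y \<in> space (path_space k). y 0 = x j \<and> approach t k q y} y \<le>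
        (indicator {z \<in> self_avoiding c (n + k). cut k (n + k) j z}
          (\<lambda>i\<in>{..n + k}. surgery j k x y i) :: ennreal)"
      by (auto simp: indicator_def)
  qed
  finally show ?thesis .
qed

lemma sum_indicator_cuts_le:
  assumes "k > 0"
  shows "(\<Sum>j\<le>n. indicator {z \<in> S. cut k N j z} x) \<le> ennreal (real k * dist (x 0) (x N)) * indicator S x"
proof (cases "x \<in> S")
  case True
  have "(\<Sum>j\<le>n. indicator {z \<in> S. cut k N j z} x) = (\<Sum>j\<le>n. indicator {j. cut k N j x} j :: ennreal)"
    using True by (intro sum.cong) (auto simp: indicator_def)
  also have "\<dots> = of_nat (card ({..n} \<inter> {j. cut k N j x}))"
    by (simp add: indicator_def sum.inter_restrict[symmetric])
  also have "\<dots> = ennreal (real (card ({..n} \<inter> {j. cut k N j x})))"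
    by (simp add: ennreal_of_nat_eq_real_of_nat)
  also have "\<dots> \<le> ennreal (real k * dist (x 0) (x N))"
  proof (rule ennreal_leI)
    have "finite {j. 0 \<le> j \<and> cut k N j x}"
      by (rule finite_subset[of _ "{..N}"]) (auto simp: cut_def)
    then have "card ({..n} \<inter> {j. cut k N j x}) \<le> card {j. 0 \<le> j \<and> cut k N j x}"
      by (intro card_mono) auto
    then show "real (card ({..n} \<inter> {j. cut k N j x})) \<le> real k * dist (x 0) (x N)"
      using card_cuts_le_dist[OF assms, of 0 N x] by linarith
  qed
  finally show ?thesis using True by simp
qed (simp add: indicator_def)

text \<open>Double counting. Summed over \<open>j\<close>, the probability of a self-avoiding \<open>(n + k)\<close>-step walk with a
  cut at \<open>j\<close> is at most \<open>k\<close> times the displacement; by surgery it is at least a constant times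
  the number of exposed vertices of self-avoiding \<open>n\<close>-step walks. Normalisation is harmless because
  the probability of self-avoidance decreases with the number of steps.\<close>

lemma displacement_after_surgery:
  assumes d: "CARD('d::finite) \<ge> 2" and c: "0 < c" "c < 1"
  obtains \<kappa> :: real and k :: nat where "\<kappa> > 0" "k > 0"
    "\<And>(p :: 'd hyperbolic) n. ennreal (\<kappa> * real n) * emeasure (walk p (n + k)) (self_avoiding c (n + k)) \<le>
      (\<integral>\<^sup>+x. ennreal (dist (x 0) (x (n + k))) * indicator (self_avoiding c (n + k)) x \<partial>walk p (n + k))"
proof -
  obtain C N where C: "C > 0" and N: "N > 0" "\<And>L (A :: 'd hyperbolic set). finite A \<Longrightarrow> separated c A \<Longrightarrow>
       card A \<le> N * card {a \<in> A. exposed C L A a}"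
    using many_exposed[OF d c(1)] by blast
  obtain k\<^sub>0 :: nat where k0: "256 * C\<^sup>2 * exp 2 \<le> real k\<^sub>0" using real_arch_simple by blast
  define k where "k = Suc k\<^sub>0"
  have k: "256 * C\<^sup>2 * exp 2 \<le> real k" "k > 0" using k0 by (simp_all add: k_def)
  \<comment> \<open>The right-hand side grows like \<open>exp (2 * k)\<close>, the left-hand side like \<open>exp k\<close>.\<close>
  have k': "8 * (1 + cosh (real k)) \<le> (exp (real k - 1) / (4 * C))\<^sup>2"
  proof -
    have "256 * C\<^sup>2 * exp 2 \<le> exp (real k)" using k(1) exp_ge_add_one_self[of "real k"] by linarith
    then have "256 * C\<^sup>2 * exp 2 * exp (real k) \<le> exp (real k) * exp (real k)" by simp
    then have "256 * C\<^sup>2 * exp 2 * exp (real k) / (16 * C\<^sup>2 * exp 2) \<le>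
        exp (real k) * exp (real k) / (16 * C\<^sup>2 * exp 2)"
      by (rule divide_right_mono) simp
    also have "256 * C\<^sup>2 * exp 2 * exp (real k) / (16 * C\<^sup>2 * exp 2) = 16 * exp (real k)"
      using C by simp
    also have "exp (real k) * exp (real k) / (16 * C\<^sup>2 * exp 2) = (exp (real k - 1) / (4 * C))\<^sup>2"
      by (simp add: power2_eq_square exp_diff flip: exp_add)
    finally have le: "16 * exp (real k) \<le> (exp (real k - 1) / (4 * C))\<^sup>2" .
    have "1 + cosh (real k) \<le> 2 * exp (real k)"
      using add_mono[of 1 "exp (real k)" "cosh (real k)" "exp (real k)"] by (simp add: cosh_field_def)
    then have "8 * (1 + cosh (real k)) \<le> 8 * (2 * exp (real k))" by (rule mult_left_mono) simp
    also have "\<dots> = 16 * exp (real k)" by simp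
    finally have "8 * (1 + cosh (real k)) \<le> 16 * exp (real k)" .
    from this le show ?thesis by (rule order_trans)
  qed
  \<comment> \<open>The loss of \<open>t\<close> in each of the \<open>k\<close> steps must not add up to \<open>1 - c\<close>.\<close>
  define t where "t = (1 - c) / (2 * real k)"
  have t: "t > 0" "real k * t < 1 - c" "real k * t \<le> 1" using c k(2) by (simp_all add: t_def)
  obtain \<pi> where \<pi>: "\<pi> > 0" "\<And>p q :: 'd hyperbolic. dist p q \<ge> 1 \<Longrightarrow>
      ennreal \<pi> \<le> emeasure (unit_sphere_measure p) {v. dist p v \<le> 1 \<and> dist v q \<le> dist p q - 1 + t}"
    using step_towards[OF t(1)] by blast
  define \<kappa> where "\<kappa> = \<pi> ^ k / (real N * real k)"
  show thesis
  proof (rule that)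
    show "\<kappa> > 0" "k > 0" using \<pi>(1) N(1) k(2) by (simp_all add: \<kappa>_def)
    fix p :: "'d hyperbolic" and n
    let ?S = "self_avoiding c (n + k) :: (nat \<Rightarrow> 'd hyperbolic) set"
    let ?Z = "emeasure (walk p (n + k)) ?S"
    define F where "F j = (indicator {z \<in> ?S. cut k (n + k) j z} :: _ \<Rightarrow> ennreal)" for j
    define H where "H j x = (\<integral>\<^sup>+y. F j (\<lambda>i\<in>{..n + k}. surgery j k x y i) \<partial>walk (x j) k)" for j x
    have F [measurable]: "F j \<in> borel_measurable (path_space (n + k))" for j
    proof -
      have "{z \<in> ?S. cut k (n + k) j z} = ?S \<inter> {z \<in> space (path_space (n + k)). cut k (n + k) j z}"
        by (auto simp: self_avoiding_def)
      also have "\<dots> \<in> sets (path_space (n + k))"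
        by (intro sets.Int self_avoiding_measurable cut_measurable)
      finally show ?thesis unfolding F_def by (rule borel_measurable_indicator)
    qed
    have H [measurable]: "H j \<in> borel_measurable (path_space n)" if "j \<le> n" for j
      using nn_integral_surgery(1)[OF F that] by (simp add: H_def[abs_def])
    have count: "ennreal (\<pi> ^ k * real n / real N) * indicator (self_avoiding c n) x \<le> (\<Sum>j\<le>n. H j x)" for x
    proof (cases "x \<in> self_avoiding c n")
      case True
      define G where "G = {j \<in> {..n}. exposed C (cosh (real k)) (x ` {..n}) (x j)}"
      have sa: "c < dist (x i) (x i')" if "i < i'" "i' \<le> n" for i i'
        using True that by (auto simp: self_avoiding_def)
      have sep: "c < dist (x i) (x i')" if "i \<noteq> i'" "i \<le> n" "i' \<le> n" for i i'
        using sa[of i i'] sa[of i' i] that by (cases "i < i'") (auto simp: dist_commute)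
      have inj: "inj_on x {..n}"
        using sep c(1) by (intro inj_onI) (metis atMost_iff dist_self not_less_iff_gr_or_eq)
      have "separated c (x ` {..n})"
        unfolding separated_def using sep by (metis (no_types, lifting) atMost_iff imageE)
      then have "card (x ` {..n}) \<le> N * card {a \<in> x ` {..n}. exposed C (cosh (real k)) (x ` {..n}) a}"
        by (intro N(2)) auto
      also have "{a \<in> x ` {..n}. exposed C (cosh (real k)) (x ` {..n}) a} = x ` G" by (auto simp: G_def)
      also have "card (x ` G) = card G"
        using inj by (intro card_image) (auto simp: G_def inj_on_def)
      finally have "n \<le> N * card G" using inj by (simp add: card_image)
      then have "real n \<le> real N * real (card G)" by (metis of_nat_le_iff of_nat_mult)
      then have "real n / real N \<le> real (card G)" using N(1) by (simp add: field_simps)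
      then have "\<pi> ^ k * real n / real N \<le> real (card G) * \<pi> ^ k"
        using \<pi>(1) mult_left_mono[of "real n / real N" "real (card G)" "\<pi> ^ k"] by (simp add: mult.commute)
      then have "ennreal (\<pi> ^ k * real n / real N) \<le> ennreal (real (card G) * \<pi> ^ k)" by (rule ennreal_leI)
      also have "\<dots> = (\<Sum>j\<in>G. ennreal \<pi> ^ k)"
        using \<pi>(1) by (simp add: ennreal_mult ennreal_of_nat_eq_real_of_nat ennreal_power)
      also have "\<dots> \<le> (\<Sum>j\<in>G. H j x)"
      proof (rule sum_mono)
        fix j assume "j \<in> G"
        then show "ennreal \<pi> ^ k \<le> H j x"
          unfolding H_def F_def G_def
          by (intro surgery_probability[OF True c(2) _ _ C _ t(2,3) k' \<pi>(2)]) (use t(1) in auto)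
      qed
      also have "\<dots> \<le> (\<Sum>j\<le>n. H j x)" by (intro sum_mono2) (auto simp: G_def)
      finally show ?thesis using True by simp
    qed simp
    have "ennreal (\<pi> ^ k * real n / real N) * ?Z \<le>
        ennreal (\<pi> ^ k * real n / real N) * emeasure (walk p n) (self_avoiding c n)"
      by (intro mult_left_mono self_avoiding_antimono) simp
    also have "\<dots> = (\<integral>\<^sup>+x. ennreal (\<pi> ^ k * real n / real N) * indicator (self_avoiding c n) x \<partial>walk p n)"
      by (subst nn_integral_cmult_indicator) auto
    also have "\<dots> \<le> (\<integral>\<^sup>+x. (\<Sum>j\<le>n. H j x) \<partial>walk p n)"
      by (intro nn_integral_mono count)
    also have "\<dots> = (\<Sum>j\<le>n. \<integral>\<^sup>+x. H j x \<partial>walk p n)"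
      by (rule nn_integral_sum) (use H in \<open>simp only: measurable_cong_sets[OF sets_walk refl] atMost_iff\<close>)
    also have "\<dots> = (\<Sum>j\<le>n. \<integral>\<^sup>+x. F j x \<partial>walk p (n + k))"
      unfolding H_def by (intro sum.cong refl nn_integral_surgery(2)[symmetric] F) simp
    also have "\<dots> = (\<integral>\<^sup>+x. (\<Sum>j\<le>n. F j x) \<partial>walk p (n + k))"
      by (rule nn_integral_sum[symmetric]) measurable
    also have "\<dots> \<le> (\<integral>\<^sup>+x. ennreal (real k) * (ennreal (dist (x 0) (x (n + k))) * indicator ?S x) \<partial>walk p (n + k))"
    proof (rule nn_integral_mono)
      fix x
      show "(\<Sum>j\<le>n. F j x) \<le> ennreal (real k) * (ennreal (dist (x 0) (x (n + k))) * indicator ?S x)"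
        using sum_indicator_cuts_le[OF k(2), where S = ?S and N = "n + k" and n = n and x = x]
        by (simp add: F_def ennreal_mult mult.assoc)
    qed
    also have "\<dots> = ennreal (real k) * (\<integral>\<^sup>+x. ennreal (dist (x 0) (x (n + k))) * indicator ?S x \<partial>walk p (n + k))"
      by (rule nn_integral_cmult) measurable
    finally have le: "ennreal (\<pi> ^ k * real n / real N) * ?Z \<le> \<dots>" .
    have "ennreal (\<pi> ^ k * real n / real N) = ennreal (real k) * ennreal (\<kappa> * real n)"
      using k(2) \<pi>(1) by (simp add: \<kappa>_def flip: ennreal_mult)
    with le show "ennreal (\<kappa> * real n) * ?Z \<le>
        (\<integral>\<^sup>+x. ennreal (dist (x 0) (x (n + k))) * indicator ?S x \<partial>walk p (n + k))"
      using k(2) by (simp add: mult.assoc ennreal_mult_le_mult_iff)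
  qed
qed

lemma point_at_distance:
  fixes p :: "'d::finite hyperbolic"
  assumes "r \<ge> 0"
  obtains q where "dist p q = r"
proof -
  obtain e :: "real^'d" where e: "norm e = 1" using vector_choose_size[of 1] by auto
  let ?q = "hlift (sinh r *\<^sub>R e)"
  have "cosh (dist (hlift 0) ?q) = cosh r"
    unfolding tcoord_eq_cosh[symmetric] coords_hlift
    using e cosh_square_eq[of r] by (simp add: real_sqrt_unique dot_square_norm flip: power2_eq_square)
  then have "dist (hlift 0) ?q = r" using assms by (metis arcosh_cosh_real zero_le_dist)
  then have "dist p (boost p ?q) = r" using dist_boost[of p "hlift 0" ?q] by simp
  then show thesis by (rule that)
qed

text \<open>A walk that keeps close to a geodesic is self-avoiding, and such walks have positive
  probability.\<close>

lemma self_avoiding_positive: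
  fixes p :: "'d::finite hyperbolic"
  assumes c: "c < 1"
  shows "emeasure (walk p n) (self_avoiding c n) > 0"
proof -
  define t where "t = (1 - c) / (2 * (real n + 1))"
  have t: "t > 0" using c by (simp add: t_def)
  have "real n * t \<le> (1 - c) / 2" using c by (simp add: t_def field_simps)
  then have nt: "real n * t < 1 - c" using c by simp
  obtain \<pi> where \<pi>: "\<pi> > 0" "\<And>p q :: 'd hyperbolic. dist p q \<ge> 1 \<Longrightarrow>
      ennreal \<pi> \<le> emeasure (unit_sphere_measure p) {v. dist p v \<le> 1 \<and> dist v q \<le> dist p q - 1 + t}"
    using step_towards[OF t] by blast
  obtain q where q: "dist p q = real n" using point_at_distance[of "real n"] by auto
  have "0 < ennreal \<pi> ^ n" using \<pi>(1) by (simp add: ennreal_power)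
  also have "\<dots> \<le> emeasure (walk p n) {y \<in> space (path_space n). y 0 = p \<and> approach t n q y}"
    by (intro approach_probability \<pi>(2)) (use q in auto)
  also have "\<dots> \<le> emeasure (walk p n) (self_avoiding c n)"
  proof (rule emeasure_mono)
    show "{y \<in> space (path_space n). y 0 = p \<and> approach t n q y} \<subseteq> self_avoiding c n"
      using approach_separates[of t n q _ c] t nt by (auto simp: self_avoiding_def)
  qed simp
  finally show ?thesis .
qed

lemma saw_expectation_ge:
  fixes p :: "'d::finite hyperbolic"
  assumes c: "c < 1" and r: "r \<ge> 0"
    and le: "ennreal r * emeasure (walk p n) (self_avoiding c n) \<le>
      (\<integral>\<^sup>+x. ennreal (dist (x 0) (x n)) * indicator (self_avoiding c n) x \<partial>walk p n)"
  shows "r \<le> (\<integral>x. dist (x 0) (x n) \<partial>saw_measure c p n)"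
proof -
  let ?S = "self_avoiding c n :: (nat \<Rightarrow> 'd hyperbolic) set"
  let ?Z = "emeasure (walk p n) ?S"
  let ?I = "\<integral>\<^sup>+x. ennreal (dist (x 0) (x n)) * indicator ?S x \<partial>walk p n"
  interpret prob_space "walk p n" by (rule prob_space_walk)
  have Z: "?Z > 0" "?Z < \<top>" using self_avoiding_positive[OF c] by (simp_all add: less_top[symmetric])
  have m: "(\<lambda>x. dist (x 0) (x n)) \<in> borel_measurable (walk p n)" by measurable
  have "?I \<le> (\<integral>\<^sup>+x. ennreal (real n) * indicator ?S x \<partial>walk p n)"
  proof (rule nn_integral_mono_AE)
    show "AE x in walk p n. ennreal (dist (x 0) (x n)) * indicator ?S x \<le> ennreal (real n) * indicator ?S x"
      using AE_walk[of p n]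
    proof eventually_elim
      case (elim x)
      have "dist (x 0) (x i) \<le> real i" if "i \<le> n" for i
        using that
      proof (induction i)
        case (Suc i)
        then show ?case using elim dist_triangle[of "x 0" "x (Suc i)" "x i"] by force
      qed simp
      then show ?case by (intro mult_right_mono ennreal_leI) auto
    qed
  qed
  also have "\<dots> = ennreal (real n) * ?Z" by (subst nn_integral_cmult_indicator) auto
  also have "\<dots> < \<top>" using Z(2) by (simp add: ennreal_mult_less_top)
  finally have I: "?I < \<top>" .
  have nn: "(\<integral>\<^sup>+x. ennreal (dist (x 0) (x n)) \<partial>saw_measure c p n) = ?I / ?Z"
    unfolding saw_measure_def by (rule nn_integral_uniform_measure) (use m in auto)
  have "ennreal r = ennreal r * ?Z / ?Z"
    using Z by (simp add: ennreal_mult_divide_eq less_top)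
  also have "\<dots> \<le> ?I / ?Z" using le by (rule divide_right_mono_ennreal)
  finally have "ennreal r \<le> ?I / ?Z" .
  moreover have "?I / ?Z \<noteq> \<top>" using I Z by (auto simp only: ennreal_divide_eq_top_iff)
  then have "?I / ?Z < \<top>" by (simp add: less_top)
  ultimately have "enn2real (ennreal r) \<le> enn2real (?I / ?Z)" by (intro enn2real_mono) auto
  then have "r \<le> enn2real (?I / ?Z)" using r by simp
  also have "enn2real (?I / ?Z) = (\<integral>x. dist (x 0) (x n) \<partial>saw_measure c p n)"
    unfolding nn[symmetric] by (rule integral_eq_nn_integral[symmetric]) (use m in \<open>simp_all add: saw_measure_def\<close>)
  finally show ?thesis .
qed

theorem theorem1p1:
  fixes c :: real
  assumes "CARD('d::finite) \<ge> 2" and "0 < c" and "c < 1"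
  shows "\<exists>C::real. C > 0 \<and>
    (\<forall>(x\<^sub>0 :: 'd hyperbolic) (n :: nat). n \<ge> 1 \<longrightarrow>
      (\<integral>x. dist (x 0) (x n) \<partial>saw_measure c x\<^sub>0 n) > C * real n)"
proof -
  obtain \<kappa> k where \<kappa>: "\<kappa> > 0" "k > 0"
    and far: "\<And>(p :: 'd hyperbolic) n. ennreal (\<kappa> * real n) *
        emeasure (walk p (n + k)) (self_avoiding c (n + k)) \<le>
      (\<integral>\<^sup>+x. ennreal (dist (x 0) (x (n + k))) * indicator (self_avoiding c (n + k)) x \<partial>walk p (n + k))"
    using displacement_after_surgery[OF assms] by blast
  \<comment> \<open>The bound for \<open>n + k\<close> steps is used for walks of at least \<open>2 * k\<close> steps; shorter ones have
    displacement at least \<open>c\<close> by self-avoidance.\<close>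
  define C where "C = min \<kappa> (c / real k) / 3"
  have C: "C > 0" "C < \<kappa> / 2" "C * real k < c / 2"
    using \<kappa> assms(2) by (simp_all add: C_def min_def field_simps)
  have "C * real n < (\<integral>x. dist (x 0) (x n) \<partial>saw_measure c p n)" if n: "n \<ge> 1"
    for p :: "'d hyperbolic" and n
  proof (cases "n \<ge> 2 * k")
    case True
    have nk: "n - k + k = n" using True by simp
    have "C * real n < \<kappa> / 2 * real n" using C(2) n by simp
    also have "\<dots> \<le> \<kappa> * real (n - k)" using True \<kappa>(1) by (simp add: of_nat_diff field_simps)
    also have "\<dots> \<le> (\<integral>x. dist (x 0) (x n) \<partial>saw_measure c p n)"
      using far[of "n - k" p] unfolding nk by (intro saw_expectation_ge assms(3)) (use \<kappa>(1) in auto)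
    finally show ?thesis .
  next
    case False
    then have "C * real n \<le> C * (2 * real k)" using C(1) by (intro mult_left_mono) auto
    also have "\<dots> < c" using C(3) by simp
    also have "c \<le> (\<integral>x. dist (x 0) (x n) \<partial>saw_measure c p n)"
    proof (rule saw_expectation_ge[OF assms(3)])
      have "ennreal c * emeasure (walk p n) (self_avoiding c n) =
          (\<integral>\<^sup>+x. ennreal c * indicator (self_avoiding c n) x \<partial>walk p n)"
        by (subst nn_integral_cmult_indicator) auto
      also have "\<dots> \<le> (\<integral>\<^sup>+x. ennreal (dist (x 0) (x n)) * indicator (self_avoiding c n) x \<partial>walk p n)"
        using n by (intro nn_integral_mono)
          (auto simp: indicator_def self_avoiding_def intro!: ennreal_leI less_imp_le)
      finally show "ennreal c * emeasure (walk p n) (self_avoiding c n) \<le> \<dots>" .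
    qed (use assms(2) in simp)
    finally show ?thesis .
  qed
  with C(1) show ?thesis by blast
qed

end
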